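(* Let $\mathcal{P}$ be a finite presentation of a group. There is a constant $C$, depending only on $\mathcal{P}$, such that for all $n\in\mathbb{N}$ the Dehn function $\mathrm{Area}$ and the filling length, free filling length and fragmenting free filling length functions $\mathrm{FL},\mathrm{FFL},\mathrm{FFFL}:\mathbb{N}\to\mathbb{N}$ of $\mathcal{P}$ satisfy $$\mathrm{Area}(n)\ \le\ C^{\mathrm{FFFL}(n)},$$ $$\mathrm{FFFL}(n)\ \le\ \mathrm{FFL}(n)\ \le\ \mathrm{FL}(n)\ \le\ C\,\mathrm{Area}(n)+n .$$
   Context: A word is null-homotopic if it represents $1$ in the group; $\ell(w)$ is the length of the word $w$. A diagram is a finite, planar, contractible, combinatorial 2-complex $\Delta$; $\ell(\partial\Delta)$ is the length of its boundary circuit (edges in 1-dimensional portions are traversed twice). A van Kampen diagram for a word $w$ over a presentation $\langle\mathcal{A}\mid\mathcal{R}\rangle$ is a diagram with edges oriented and labelled by elements of $\mathcal{A}$ so that around each 2-cell one reads (from some vertex, in some direction) an element of $\mathcal{R}^{\pm1}$, and around the boundary circuit from a base vertex $\star\in\partial\Delta$ one reads $w$. A full shelling of $\Delta$ is a sequence of diagrams $\Delta=\Delta_0,\dots,\Delta_m$ with $\Delta_m$ a single vertex, each $\Delta_{i+1}$ being obtained from $\Delta_i$ by one of the moves: (1) 1-cell collapse: remove a pair $(e^1,e^0)$, where $e^1$ is a 1-cell, $e^0\in\partial e^1$, and $e^1$ is attached to the rest of $\Delta_i$ only by its end vertex $\neq e^0$; (2) 1-cell expansion: cut along a 1-cell $e^1$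 of $\Delta_i$ that has a vertex $e^0$ in $\partial\Delta_i$, so that $e^0$ and $e^1$ are doubled; (3) 2-cell collapse: remove a pair $(e^2,e^1)$, where $e^2$ is a 2-cell and $e^1$ is an edge in $\partial e^2\cap\partial\Delta_i$ (on the boundary circuit $e^1$ is replaced by $\partial e^2\smallsetminus e^1$). A full shelling to a base vertex $\star\in\partial\Delta$ is a full shelling in which $\star$ is preserved throughout and $\Delta_m=\star$ (in every 1-cell collapse $e^0\ne\star$, and in a 1-cell expansion with $e^0=\star$ one of the two copies of $e^0$ is chosen to be $\star$ in $\Delta_{i+1}$). A full fragmenting shelling is defined like a full shelling except that each $\Delta_i$ may be a disjoint union of finitely many diagrams, $\Delta_m$ is a set of vertices, and one extra move is allowed: (4) fragmentation: $\Delta_{i+1}$ is the disjoint union of $\Delta_i'$ and $\Delta_i''$, where $\Delta_i=\Delta_i'\cup\Delta_i''$ and $\Delta_i'\cap\Delta_i''$ is a single vertex. For a shelling $\mathcal{S}=(\Delta_i)$ let $\ell(\mathcal{S})=\max_i\ell(\partial\Delta_i)$, where $\ell(\partial\Delta_i)$ is the sum of the lengths of the boundary circuits of the components of $\Delta_i$. Then $\mathrm{FL}(\Delta,\star)$, $\mathrm{FFL}(\Delta)$, $\mathrm{FFFL}(\Delta)$ are the minima of $\ell(\mathcal{S})$ over full shellings to $\star$, full shellings, and full fragmenting shellings of $\Delta$, respectively. For a null-homotopic word $w$: $\mathrm{FL}(w)$, $\mathrm{FFL}(w)$, $\mathrm{FFFL}(w)$ are the minima of $\mathrm{FL}(\Delta,\star)$,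 $\mathrm{FFL}(\Delta)$, $\mathrm{FFFL}(\Delta)$ over all van Kampen diagrams $\Delta$ for $w$; $\mathrm{Area}(w)$ is the minimal number of 2-cells of a van Kampen diagram for $w$. For $\mathrm{M}=\mathrm{Area},\mathrm{FL},\mathrm{FFL},\mathrm{FFFL}$, the filling function is $\mathrm{M}(n):=\max\{\mathrm{M}(w)\mid w\text{ null-homotopic},\ \ell(w)\le n\}$; $\mathrm{Area}(n)$ is the Dehn function. *)

theory Defs
  imports Main "HOL-Library.Multiset" "HOL-Combinatorics.Orbits"
begin

section \<open>Words and group presentations\<close>

text \<open>The letter \<open>(a, True)\<close> stands for the generator \<open>a\<close>, and \<open>(a, False)\<close> for its inverse.\<close>

type_synonym 'a letter = "'a \<times> bool"
type_synonym 'a word = "'a letter list"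

definition inv_letter :: "'a letter \<Rightarrow> 'a letter" where
  "inv_letter x = (fst x, \<not> snd x)"

definition inv_word :: "'a word \<Rightarrow> 'a word" where
  "inv_word w = rev (map inv_letter w)"

definition words :: "'a set \<Rightarrow> 'a word set" where
  "words A = lists (A \<times> UNIV)"

definition finite_presentation :: "'a set \<Rightarrow> 'a word set \<Rightarrow> bool" where
  "finite_presentation A R \<longleftrightarrow> finite A \<and> finite R \<and> R \<subseteq> words A"

text \<open>The group presented by \<open>A\<close> and \<open>R\<close> is the free monoid \<open>words A\<close> modulo the following
  congruence.\<close>

inductive group_eq :: "'a set \<Rightarrow> 'a word set \<Rightarrow> 'a word \<Rightarrow> 'a word \<Rightarrow> bool" for A R where
  refl: "w \<in> words A \<Longrightarrow> group_eq A R w w"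
| sym: "group_eq A R u v \<Longrightarrow> group_eq A R v u"
| trans: "group_eq A R u v \<Longrightarrow> group_eq A R v w \<Longrightarrow> group_eq A R u w"
| mult: "group_eq A R u u' \<Longrightarrow> group_eq A R v v' \<Longrightarrow> group_eq A R (u @ v) (u' @ v')"
| cancel: "fst x \<in> A \<Longrightarrow> group_eq A R [x, inv_letter x] []"
| relator: "r \<in> R \<Longrightarrow> group_eq A R r []"

definition null_homotopic :: "'a set \<Rightarrow> 'a word set \<Rightarrow> 'a word \<Rightarrow> bool" where
  "null_homotopic A R w \<longleftrightarrow> w \<in> words A \<and> group_eq A R w []"


section \<open>Diagrams\<close>

text \<open>A planar 2-complex is encoded as a combinatorial map. Every 1-cell consists of two darts
  (oriented edges) \<open>d\<close> and \<open>opp d\<close>; \<open>org d\<close> is the vertex from which \<open>d\<close> starts. The dart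
  \<open>nxt d\<close> follows \<open>d\<close> on the boundary of the complementary region of the 1-skeleton in the sphere
  lying on a fixed side of \<open>d\<close>, so the orbits of \<open>nxt\<close> are the boundary circuits of these regions.
  The orbit \<open>outer\<close> bounds the unbounded region and hence is the boundary circuit of the complex;
  it contains both darts of an edge in a 1-dimensional portion. The other orbits are (the attaching
  circuits of) the 2-cells. Vertices and darts are named by natural numbers, which loses no
  generality for finite complexes.\<close>

record complex2 =
  verts :: "nat set"
  darts :: "nat set"
  org :: "nat \<Rightarrow> nat"
  opp :: "nat \<Rightarrow> nat"
  nxt :: "nat \<Rightarrow> nat"
  outer :: "nat set"

definition edges :: "complex2 \<Rightarrow> nat set set" where
  "edges D = (\<lambda>d. {d, opp D d}) ` darts D"

definition faces :: "complex2 \<Rightarrow> nat set set" where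
  "faces D = orbit (nxt D) ` darts D"

definition cells :: "complex2 \<Rightarrow> nat set set" where
  "cells D = faces D - {outer D}"

text \<open>Rotation about the origin of a dart: the cyclic order, given by the planar embedding, of the
  darts issuing from a common vertex.\<close>

definition rot :: "complex2 \<Rightarrow> nat \<Rightarrow> nat" where
  "rot D = nxt D \<circ> opp D"

definition connected_complex :: "complex2 \<Rightarrow> bool" where
  "connected_complex D \<longleftrightarrow>
     verts D \<noteq> {} \<and>
     (\<forall>u\<in>verts D. \<forall>v\<in>verts D. (u, v) \<in> {(org D d, org D (opp D d)) | d. d \<in> darts D}\<^sup>*)"

definition euler_char :: "complex2 \<Rightarrow> int" where
  "euler_char D = int (card (verts D)) - int (card (edges D)) + int (card (cells D))"

text \<open>Gluing a disc to every orbit of \<open>nxt\<close>, including \<open>outer\<close>, yields a closed connected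
  oriented surface whose Euler characteristic is \<open>euler_char D + 1\<close>. Thus the last condition says
  that this surface is a sphere. Accordingly the complex obtained by leaving out the single open
  disc bounded by \<open>outer\<close> is planar and contractible, and every finite planar contractible
  combinatorial 2-complex arises in this way, since its complement in the sphere is an open
  disc. If there are no darts, the complex is a single vertex.\<close>

definition diagram :: "complex2 \<Rightarrow> bool" where
  "diagram D \<longleftrightarrow>
     finite (verts D) \<and> finite (darts D) \<and>
     opp D permutes darts D \<and> (\<forall>d\<in>darts D. opp D d \<noteq> d \<and> opp D (opp D d) = d) \<and>
     nxt D permutes darts D \<and>
     org D ` darts D \<subseteq> verts D \<and>
     (\<forall>d\<in>darts D. \<forall>e\<in>darts D. org D d = org D e \<longleftrightarrow> e \<in> orbit (rot D) d) \<and>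
     (if darts D = {} then outer D = {} else outer D \<in> faces D) \<and>
     connected_complex D \<and>
     euler_char D = 1"

definition perimeter :: "complex2 \<Rightarrow> nat" where
  "perimeter D = card (outer D)"

definition single_vertex :: "complex2 \<Rightarrow> bool" where
  "single_vertex D \<longleftrightarrow> (\<exists>v. verts D = {v}) \<and> darts D = {}"


section \<open>Van Kampen diagrams\<close>

text \<open>The word read along the circuit through \<open>d\<close>, starting with \<open>d\<close>. A dart labelled \<open>(a, True)\<close>
  is an edge labelled \<open>a\<close> traversed along its orientation.\<close>

definition circuit_word :: "complex2 \<Rightarrow> (nat \<Rightarrow> 'a letter) \<Rightarrow> nat \<Rightarrow> 'a word" where
  "circuit_word D lab d = map (\<lambda>k. lab ((nxt D ^^ k) d)) [0..<card (orbit (nxt D) d)]"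

definition van_kampen ::
  "'a set \<Rightarrow> 'a word set \<Rightarrow> 'a word \<Rightarrow> complex2 \<Rightarrow> nat \<Rightarrow> (nat \<Rightarrow> 'a letter) \<Rightarrow> bool" where
  "van_kampen A R w D v lab \<longleftrightarrow>
     diagram D \<and> v \<in> verts D \<and>
     (\<forall>d\<in>darts D. fst (lab d) \<in> A \<and> lab (opp D d) = inv_letter (lab d)) \<and>
     (\<forall>f\<in>cells D. \<exists>d\<in>f. circuit_word D lab d \<in> R \<union> inv_word ` R) \<and>
     (if outer D = {} then w = []
      else \<exists>d\<in>outer D. org D d = v \<and> circuit_word D lab d = w)"


section \<open>Shelling moves\<close>

definition first_return :: "nat set \<Rightarrow> (nat \<Rightarrow> nat) \<Rightarrow> nat \<Rightarrow> nat" where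
  "first_return E f x = (f ^^ (LEAST k. (f ^^ k) x \<in> E)) x"

text \<open>The planar embedding of a subcomplex is the induced one: around each vertex the cyclic order
  of the remaining darts is that of the ambient complex. Since \<open>nxt d\<close> comes right after
  \<open>opp d\<close> in the rotation, the new successor of \<open>d\<close> is the first remaining dart met when
  rotating from \<open>nxt d\<close> on.\<close>

definition subcomplex :: "complex2 \<Rightarrow> complex2 \<Rightarrow> bool" where
  "subcomplex S D \<longleftrightarrow>
     verts S \<subseteq> verts D \<and> darts S \<subseteq> darts D \<and> cells S \<subseteq> cells D \<and>
     (\<forall>d\<in>darts S. org S d = org D d \<and> opp S d = opp D d \<and>
        nxt S d = first_return (darts S) (rot D) (nxt D d))"

text \<open>In the next definition \<open>{d, opp d}\<close> is the removed edge and \<open>org d\<close> the removed end vertex;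
  \<open>d \<in> outer D\<close> says that the edge does not lie on the boundary of a 2-cell.\<close>

definition collapse1 :: "complex2 \<Rightarrow> complex2 \<Rightarrow> bool" where
  "collapse1 D D' \<longleftrightarrow>
     (\<exists>d\<in>outer D.
        org D (opp D d) \<noteq> org D d \<and> (\<forall>e\<in>darts D. org D e = org D d \<longrightarrow> e = d) \<and>
        subcomplex D' D \<and>
        verts D' = verts D - {org D d} \<and>
        darts D' = darts D - {d, opp D d} \<and>
        cells D' = cells D)"

text \<open>The cut runs along the edge \<open>{d, opp d}\<close>, beginning at the boundary vertex \<open>org d\<close> in the
  corner of the outer region between the outer darts \<open>p\<close> and \<open>c = nxt p\<close>. Afterwards the two
  copies of the edge are \<open>{d, y}\<close> and \<open>{x, opp d}\<close>, and the boundary circuit runs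
  \<open>p, x, y, c\<close>. The darts that issued from the doubled vertex are distributed between its copies
  \<open>v1\<close> (to which \<open>d\<close> is attached) and \<open>v2\<close> (to which \<open>x\<close> is attached) in accordance with the new
  rotation. Either copy may keep the name of the original vertex; this is the choice of the copy that
  serves as base vertex.\<close>

definition expansion1 :: "complex2 \<Rightarrow> complex2 \<Rightarrow> bool" where
  "expansion1 D D' \<longleftrightarrow>
     (\<exists>p\<in>outer D. \<exists>c d x y v1 v2.
        c = nxt D p \<and> d \<in> darts D \<and> org D d = org D c \<and>
        x \<notin> darts D \<and> y \<notin> darts D \<and> x \<noteq> y \<and>
        v1 \<noteq> v2 \<and> org D c \<in> {v1, v2} \<and> {v1, v2} \<inter> verts D = {org D c} \<and>
        verts D' = verts D \<union> {v1, v2} \<and>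
        darts D' = darts D \<union> {x, y} \<and>
        opp D' = (opp D)(d := y, y := d, opp D d := x, x := opp D d) \<and>
        nxt D' = (nxt D)(p := x, x := y, y := c) \<and>
        outer D' = outer D \<union> {x, y} \<and>
        (\<forall>e\<in>darts D. org D' e =
           (if org D e = org D c then if e \<in> orbit (rot D') d then v1 else v2 else org D e)) \<and>
        org D' x = v2 \<and> org D' y = org D' (opp D d))"

definition collapse2 :: "complex2 \<Rightarrow> complex2 \<Rightarrow> bool" where
  "collapse2 D D' \<longleftrightarrow>
     (\<exists>f\<in>cells D. \<exists>d\<in>f. opp D d \<in> outer D \<and>
        subcomplex D' D \<and>
        verts D' = verts D \<and>
        darts D' = darts D - {d, opp D d} \<and>
        cells D' = cells D - {f})"

definition fragmentation :: "complex2 \<Rightarrow> complex2 \<Rightarrow> complex2 \<Rightarrow> bool" where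
  "fragmentation D D' D'' \<longleftrightarrow>
     subcomplex D' D \<and> subcomplex D'' D \<and>
     verts D' \<union> verts D'' = verts D \<and>
     darts D' \<union> darts D'' = darts D \<and>
     cells D' \<union> cells D'' = cells D \<and>
     (\<exists>v. verts D' \<inter> verts D'' = {v}) \<and> darts D' \<inter> darts D'' = {}"

definition shelling_move :: "complex2 \<Rightarrow> complex2 \<Rightarrow> bool" where
  "shelling_move D D' \<longleftrightarrow> collapse1 D D' \<or> expansion1 D D' \<or> collapse2 D D'"

text \<open>Disjoint unions of diagrams are represented by multisets of diagrams.\<close>

definition fragmenting_move :: "complex2 multiset \<Rightarrow> complex2 multiset \<Rightarrow> bool" where
  "fragmenting_move M M' \<longleftrightarrow>
     (\<exists>N D D'. M = N + {#D#} \<and> M' = N + {#D'#} \<and> shelling_move D D') \<or>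
     (\<exists>N D D' D''. M = N + {#D#} \<and> M' = N + {#D', D''#} \<and> fragmentation D D' D'')"


section \<open>Full shellings and filling lengths of diagrams\<close>

definition full_shelling :: "complex2 \<Rightarrow> complex2 list \<Rightarrow> bool" where
  "full_shelling D Ds \<longleftrightarrow>
     Ds \<noteq> [] \<and> hd Ds = D \<and> (\<forall>E\<in>set Ds. diagram E) \<and>
     successively shelling_move Ds \<and> single_vertex (last Ds)"

definition full_shelling_to :: "complex2 \<Rightarrow> nat \<Rightarrow> complex2 list \<Rightarrow> bool" where
  "full_shelling_to D v Ds \<longleftrightarrow> full_shelling D Ds \<and> (\<forall>E\<in>set Ds. v \<in> verts E)"

definition full_fragmenting_shelling :: "complex2 \<Rightarrow> complex2 multiset list \<Rightarrow> bool" where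
  "full_fragmenting_shelling D Ms \<longleftrightarrow>
     Ms \<noteq> [] \<and> hd Ms = {#D#} \<and> (\<forall>M\<in>set Ms. \<forall>E\<in>#M. diagram E) \<and>
     successively fragmenting_move Ms \<and> (\<forall>E\<in>#last Ms. single_vertex E)"

definition shelling_length :: "complex2 list \<Rightarrow> nat" where
  "shelling_length Ds = Max (perimeter ` set Ds)"

definition fragmenting_length :: "complex2 multiset list \<Rightarrow> nat" where
  "fragmenting_length Ms = Max ((\<lambda>M. \<Sum>E\<in>#M. perimeter E) ` set Ms)"

definition diagram_FL :: "complex2 \<Rightarrow> nat \<Rightarrow> nat" where
  "diagram_FL D v = Inf {shelling_length Ds | Ds. full_shelling_to D v Ds}"

definition diagram_FFL :: "complex2 \<Rightarrow> nat" where
  "diagram_FFL D = Inf {shelling_length Ds | Ds. full_shelling D Ds}"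

definition diagram_FFFL :: "complex2 \<Rightarrow> nat" where
  "diagram_FFFL D = Inf {fragmenting_length Ms | Ms. full_fragmenting_shelling D Ms}"


section \<open>Filling functions\<close>

definition word_Area :: "'a set \<Rightarrow> 'a word set \<Rightarrow> 'a word \<Rightarrow> nat" where
  "word_Area A R w = Inf {card (cells D) | D v lab. van_kampen A R w D v lab}"

definition word_FL :: "'a set \<Rightarrow> 'a word set \<Rightarrow> 'a word \<Rightarrow> nat" where
  "word_FL A R w = Inf {diagram_FL D v | D v lab. van_kampen A R w D v lab}"

definition word_FFL :: "'a set \<Rightarrow> 'a word set \<Rightarrow> 'a word \<Rightarrow> nat" where
  "word_FFL A R w = Inf {diagram_FFL D | D v lab. van_kampen A R w D v lab}"

definition word_FFFL :: "'a set \<Rightarrow> 'a word set \<Rightarrow> 'a word \<Rightarrow> nat" where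
  "word_FFFL A R w = Inf {diagram_FFFL D | D v lab. van_kampen A R w D v lab}"

definition filling_function ::
  "'a set \<Rightarrow> 'a word set \<Rightarrow> ('a word \<Rightarrow> nat) \<Rightarrow> nat \<Rightarrow> nat" where
  "filling_function A R M n = Max {M w | w. null_homotopic A R w \<and> length w \<le> n}"

definition Area :: "'a set \<Rightarrow> 'a word set \<Rightarrow> nat \<Rightarrow> nat" where
  "Area A R = filling_function A R (word_Area A R)"

definition FL :: "'a set \<Rightarrow> 'a word set \<Rightarrow> nat \<Rightarrow> nat" where
  "FL A R = filling_function A R (word_FL A R)"

definition FFL :: "'a set \<Rightarrow> 'a word set \<Rightarrow> nat \<Rightarrow> nat" where
  "FFL A R = filling_function A R (word_FFL A R)"

definition FFFL :: "'a set \<Rightarrow> 'a word set \<Rightarrow> nat \<Rightarrow> nat" where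
  "FFFL A R = filling_function A R (word_FFFL A R)"

end

theory Submission
  imports Defs "HOL-Library.Extended_Nat"
begin

text \<open>Every diagram can be shelled by 2-cell collapses followed by 1-cell collapses, and a collapse of a
  2-cell lengthens the boundary by less than the length of a relator; this bounds \<open>FL\<close> linearly
  by \<open>Area\<close>. The other two comparisons of filling lengths hold diagram by diagram.

  For the exponential bound, cut the diagrams of a fragmenting shelling apart at boundary vertices
  and let the cost of a stage be the sum of the areas of the resulting boundary words. It is
  determined by a list of words of total length at most \<open>L\<close>, the length of the shelling, so it
  takes at most \<open>(4 |A| + 1)^L\<close> values. On the other hand it decreases by at most one in
  each move and is finally zero, so it takes every value up to the initial one, which is the area of
  the boundary word. Cutting is compatible with areas because in a planar diagram it separates the
  pieces; planarity enters through the genus inequality for permutations.\<close>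

section \<open>Fillable words\<close>

text \<open>The exponential bound counts the values of a single number, so that no repeated stages
  have to be excised from a shelling and no diagrams reglued along them. This number may depend on
  boundary words only, since only words can be counted in terms of the shelling length; hence areas
  of words and not numbers of cells. It lives in \<open>enat\<close>, because the boundary words of
  a stage are recognised as fillable only after those of all later stages: finiteness is propagated
  backwards from the last stage, together with the set of attained values.

  The obstacle is that moves are described at the vertices of the diagram, while the cost sees only
  circuits. A cut never lowers the cost, since area is subadditive under concatenation, so one may
  cut whenever this simplifies the situation at a vertex. What has to be shown is that such a cut
  really separates, and for this it is enough to count vertices, edges, faces and components. Only
  at the very end is a filling of the original word turned back into a diagram.\<close>

lemma inv_letter_inv_letter [simp]: "inv_letter (inv_letter x) = x"
  by (simp add: inv_letter_def)

lemma fst_inv_letter [simp]: "fst (inv_letter x) = fst x"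
  by (simp add: inv_letter_def)

lemma append_Cons_eq_append:
  assumes "a @ y # b = u @ v"
  obtains c where "u = a @ y # c" "b = c @ v" | c where "a = u @ c" "v = c @ y # b"
  using assms by (auto simp: append_eq_append_conv2 append_eq_Cons_conv Cons_eq_append_conv)

text \<open>\<open>fillable A Q n w\<close> encodes a filling of \<open>w\<close> with at most \<open>n\<close> cells by describing what lies
  along the first edge of the boundary: a cell or, if the edge belongs to a 1-dimensional portion,
  the same edge traversed backwards. The set \<open>Q\<close> is meant to be closed under cyclic permutation
  and inversion of relators. That free reduction preserves fillability is a cut elimination
  argument, which replaces the folding of diagrams.\<close>

inductive fillable :: "'a set \<Rightarrow> 'a word set \<Rightarrow> nat \<Rightarrow> 'a word \<Rightarrow> bool" for A Q where
  fill_Nil: "fillable A Q n []"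
| fill_Cell: "fillable A Q n (s @ u) \<Longrightarrow> inv_letter x # s \<in> Q \<Longrightarrow> fillable A Q (Suc n) (x # u)"
| fill_Edge: "fillable A Q n u \<Longrightarrow> fillable A Q m v \<Longrightarrow> fst x \<in> A \<Longrightarrow>
    fillable A Q (n + m) (x # u @ inv_letter x # v)"

text \<open>\<open>Inf\<close> of the empty set is infinity in \<open>enat\<close>, so words without
  a filling get infinite area.\<close>

definition filling_area :: "'a set \<Rightarrow> 'a word set \<Rightarrow> 'a word \<Rightarrow> enat" where
  "filling_area A Q w = Inf (enat ` {n. fillable A Q n w})"

section \<open>Cut elimination for fillings\<close>

locale relators =
  fixes A :: "'a set" and Q :: "'a word set"
  assumes rotate_relator: "u @ v \<in> Q \<Longrightarrow> v @ u \<in> Q"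
    and relators_in_words: "Q \<subseteq> words A"
begin

abbreviation "fill \<equiv> fillable A Q"
abbreviation "area \<equiv> filling_area A Q"

lemma fst_relator_letter: "r \<in> Q \<Longrightarrow> x \<in> set r \<Longrightarrow> fst x \<in> A"
  using relators_in_words by (fastforce simp: words_def)

lemma fill_add: "fill n w \<Longrightarrow> fill (n + k) w"
proof (induction rule: fillable.induct)
  case (fill_Edge n u m v x)
  from fillable.fill_Edge[OF fill_Edge.IH(1) fill_Edge.hyps(2,3)] show ?case
    by (simp add: ac_simps)
next
  case (fill_Cell n s u x)
  from fillable.fill_Cell[OF fill_Cell.IH fill_Cell.hyps(2)] show ?case by simp
qed (rule fillable.intros)

lemma fill_mono: "fill n w \<Longrightarrow> n \<le> m \<Longrightarrow> fill m w"
  using fill_add[of n w "m - n"] by simp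

lemma fill_append: "fill n u \<Longrightarrow> fill m v \<Longrightarrow> fill (n + m) (u @ v)"
proof (induction rule: fillable.induct)
  case (fill_Nil n)
  then show ?case using fill_add[of m v n] by (simp add: ac_simps)
next
  case (fill_Cell n s u x)
  then show ?case using fillable.fill_Cell[of A Q "n + m" s "u @ v" x] by simp
next
  case (fill_Edge n u k w x)
  then show ?case using fillable.fill_Edge[of A Q n u "k + m" "w @ v" x] by (simp add: ac_simps)
qed

text \<open>The filling of \<open>q\<close> is hung on the boundary point between \<open>u\<close>
  and \<open>v\<close>. As \<open>fillable\<close> is rooted at the first letter, the induction
  carries this point down to the subfilling in which it lies.\<close>

lemma fill_insert: "fill n (u @ v) \<Longrightarrow> fill m q \<Longrightarrow> fill (n + m) (u @ q @ v)"
proof (induction n "u @ v" arbitrary: u v rule: fillable.induct)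
  case (fill_Nil n)
  then show ?case using fill_add[of m q n] by (simp add: ac_simps)
next
  case (fill_Cell n s w x)
  show ?case
  proof (cases u)
    case Nil
    with fill_Cell.hyps fillable.fill_Cell[OF fill_Cell.hyps(1,3)] have "fill (Suc n) v" by simp
    from fill_append[OF fill_Cell.prems this] Nil show ?thesis by (simp add: ac_simps)
  next
    case (Cons a u')
    with fill_Cell.hyps have [simp]: "a = x" "w = u' @ v" by auto
    from fill_Cell.hyps(2)[of "s @ u'" v] fill_Cell.prems
    have "fill (n + m) (s @ u' @ q @ v)" by simp
    with fillable.fill_Cell[of A Q "n + m" s "u' @ q @ v" x] fill_Cell.hyps(3) Cons
    show ?thesis by simp
  qed
next
  case (fill_Edge n a k b x)
  show ?case
  proof (cases u)
    case Nil
    with fill_Edge.hyps fillable.fill_Edge[OF fill_Edge.hyps(1,3,5)] have "fill (n + k) v" by simp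
    from fill_append[OF fill_Edge.prems this] Nil show ?thesis by (simp add: ac_simps)
  next
    case (Cons y u')
    with fill_Edge.hyps have [simp]: "y = x" and "a @ inv_letter x # b = u' @ v" by auto
    from this(2) show ?thesis
    proof (cases rule: append_Cons_eq_append)
      case (1 c)
      from fill_Edge.hyps(4)[of c v] fill_Edge.prems 1 have "fill (k + m) (c @ q @ v)" by simp
      from fillable.fill_Edge[OF fill_Edge.hyps(1) this fill_Edge.hyps(5)] Cons 1 show ?thesis
        by (simp add: ac_simps)
    next
      case (2 c)
      from fill_Edge.hyps(2)[of u' c] fill_Edge.prems 2 have "fill (n + m) (u' @ q @ c)" by simp
      from fillable.fill_Edge[OF this fill_Edge.hyps(3,5)] Cons 2 show ?thesis
        by (simp add: ac_simps)
    qed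
  qed
qed

text \<open>The cell rule acts on the first letter only; here a cell is glued on in the middle of
  the word. Rotation is assumed up to the bound \<open>N\<close>, because \<open>fill_rotate\<close>
  invokes this lemma inside its own induction on the number of cells.\<close>

lemma fill_cell_inside:
  assumes rot: "\<And>k u v. k \<le> N \<Longrightarrow> fill k (u @ v) \<Longrightarrow> fill k (v @ u)"
    and rel: "inv_letter x # s \<in> Q"
  shows "fill n (u @ s @ v) \<Longrightarrow> n \<le> N \<Longrightarrow> fill (Suc n) (u @ x # v)"
proof (induction n "u @ s @ v" arbitrary: u v rule: fillable.induct)
  case (fill_Nil n)
  then show ?case using fillable.fill_Cell[of A Q n "[]" "[]" x] fillable.fill_Nil rel by auto
next
  case (fill_Cell n t w z)
  show ?case
  proof (cases u)
    case Nil
    with fill_Cell.hyps fillable.fill_Cell[OF fill_Cell.hyps(1,3)]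
    have "fill (Suc n) (s @ v)" by simp
    from fillable.fill_Cell[OF this rel] Nil show ?thesis by simp
  next
    case (Cons a u')
    with fill_Cell.hyps have [simp]: "a = z" "w = u' @ s @ v" by auto
    from fill_Cell.hyps(2)[of "t @ u'" v] fill_Cell.prems
    have "fill (Suc n) (t @ u' @ x # v)" by simp
    with fillable.fill_Cell[of A Q "Suc n" t "u' @ x # v" z] fill_Cell.hyps(3) Cons
    show ?thesis by simp
  qed
next
  case (fill_Edge n a k b z)
  show ?case
  proof (cases u)
    case Nil
    with fill_Edge.hyps fillable.fill_Edge[OF fill_Edge.hyps(1,3,5)]
    have "fill (n + k) (s @ v)" by simp
    from fillable.fill_Cell[OF this rel] Nil show ?thesis by simp
  next
    case (Cons y u')
    with fill_Edge.hyps have [simp]: "y = z" and "a @ inv_letter z # b = u' @ s @ v" by auto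
    from this(2) show ?thesis
    proof (cases rule: append_Cons_eq_append)
      case (1 c)
      from fill_Edge.hyps(4)[of c v] fill_Edge.prems 1 have "fill (Suc k) (c @ x # v)" by simp
      from fillable.fill_Edge[OF fill_Edge.hyps(1) this fill_Edge.hyps(5)] Cons 1 show ?thesis
        by (simp add: ac_simps)
    next
      case (2 c)
      from 2(2)[symmetric] show ?thesis
      proof (cases rule: append_Cons_eq_append)
        \<comment> \<open>The partner of \<open>z\<close> lies inside \<open>s\<close>, so the edge
          of \<open>z\<close> becomes an edge of the new cell, and the cell is entered from
          \<open>z\<close>. Behind it one reads \<open>e\<close>, the closed path
          \<open>inv_letter x # c @ u' @ [x]\<close> and \<open>v\<close>; this path is inserted
          into the filling of \<open>e @ v\<close>.\<close>
        case (1 e)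
        have x: "fst (inv_letter x) \<in> A" using fst_relator_letter[OF rel, of "inv_letter x"] by simp
        have "fill n (c @ u')" using rot fill_Edge.hyps(1) fill_Edge.prems 2 by simp
        from fillable.fill_Edge[OF this fillable.fill_Nil x, of 0]
        have "fill n (inv_letter x # c @ u' @ [x])" by simp
        from fill_insert[of k e v, OF _ this] fill_Edge.hyps(3) 1
        have "fill (k + n) ((e @ inv_letter x # c) @ u' @ x # v)" by simp
        moreover have "inv_letter z # e @ inv_letter x # c \<in> Q"
          using rotate_relator[of "inv_letter x # c" "inv_letter z # e"] rel 1 by simp
        ultimately show ?thesis
          using fillable.fill_Cell[of A Q "k + n" "e @ inv_letter x # c" "u' @ x # v" z] Cons
          by (simp add: ac_simps)
      next
        case (2 e)
        with fill_Edge.hyps(2)[of u' e] fill_Edge.prems \<open>a = u' @ c\<close>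
        have "fill (Suc n) (u' @ x # e)" by simp
        from fillable.fill_Edge[OF this fill_Edge.hyps(3,5)] Cons 2 show ?thesis by simp
      qed
    qed
  qed
qed

text \<open>Moving one letter is enough. An edge pair is re-rooted at its other dart. A cell on the
  first letter is taken off, the remaining word is rotated by induction, and the cell is put back at
  the far end by \<open>fill_cell_inside\<close>.\<close>

lemma fill_rotate: "fill n (u @ v) \<Longrightarrow> fill n (v @ u)"
proof (induction n arbitrary: u v rule: less_induct)
  case (less n)
  have rot1: "fill n (u @ [x])" if "fill n (x # u)" for x u
    using that
  proof (cases rule: fillable.cases)
    case (fill_Cell k s)
    with less.IH[of k s u] have "fill k (u @ s @ [])" by simp
    from fill_cell_inside[OF less.IH fill_Cell(3) this, of k] fill_Cell show ?thesis by simp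
  next
    case (fill_Edge k a m b)
    from fillable.fill_Edge[OF fill_Edge(4) fillable.fill_Nil, of "inv_letter x" 0] fill_Edge
    have "fill m (inv_letter x # b @ [x])" by simp
    from fill_append[OF fill_Edge(3) this] fill_Edge show ?thesis by simp
  qed
  from less.prems show ?case
  proof (induction u arbitrary: v)
    case (Cons x u)
    from Cons.IH[of "v @ [x]"] rot1[of x "u @ v"] Cons.prems show ?case by simp
  qed simp
qed

text \<open>A disc with boundary \<open>r\<close> is glued onto the segment \<open>r\<close>. The
  induction, on the number of cells and then on the length of \<open>u\<close>, peels off what lies
  along the first letter of \<open>u\<close>. If that letter is paired with a letter of
  \<open>r\<close>, the disc itself becomes the cell along it.\<close>

lemma fill_delete_relator: "fill n (r @ u) \<Longrightarrow> r \<in> Q \<Longrightarrow> fill (Suc n) u"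
proof (induction n arbitrary: u r rule: less_induct)
  case n: (less n)
  from n.prems show ?case
  proof (induction u arbitrary: r rule: length_induct)
    case (1 u)
    have step: "fill (Suc m) c" if "length c < length u" "m \<le> n" "fill m (r @ c)" "r \<in> Q" for c m r
      using 1(1) that n.IH[of m r c] by (cases "m = n") auto
    note prems = 1(2,3)
    show ?case
    proof (cases u)
      case Nil
      then show ?thesis by (simp add: fill_Nil)
    next
      case (Cons z u')
      with prems fill_rotate[of n r u] have "fill n (z # u' @ r)" by simp
      then show ?thesis
      proof (cases rule: fillable.cases)
        case (fill_Cell k t)
        then have "fill k (r @ t @ u')" using fill_rotate[of k "t @ u'" r] by simp
        with n.IH[of k r "t @ u'"] fill_Cell prems have "fill n (t @ u')" by simp
        with fill_Cell Cons show ?thesis using fillable.fill_Cell[of A Q n t u' z] by simp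
      next
        case (fill_Edge k a m b)
        from fill_Edge(2)[symmetric] show ?thesis
        proof (cases rule: append_Cons_eq_append)
          case (1 c)
          have "fill m (r @ c)" using fill_rotate[of m c r] 1 fill_Edge by simp
          then have "fill (Suc m) c"
            using step[of c m r] prems(2) 1 Cons fill_Edge(1) by simp
          from fillable.fill_Edge[OF fill_Edge(3) this fill_Edge(5)] 1 Cons fill_Edge(1)
          show ?thesis by simp
        next
          case (2 c)
          have "fill k (c @ u')" using fill_rotate[of k u' c] 2 fill_Edge by simp
          from fill_append[OF fill_Edge(4) this] have "fill n ((b @ c) @ u')"
            using fill_Edge by (simp add: ac_simps)
          moreover have "inv_letter z # b @ c \<in> Q"
            using rotate_relator[of c "inv_letter z # b"] 2 prems(2) by simp
          ultimately show ?thesis using Cons fillable.fill_Cell[of A Q n "b @ c" u' z] by simp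
        qed
      qed
    qed
  qed
qed

text \<open>This folds two adjacent boundary edges. If \<open>x\<close> lies on a cell, taking it
  off leaves the rotated relator \<open>s @ [inv_letter x]\<close> in front of \<open>u\<close>;
  deleting that relator costs one cell, which is the one just saved.\<close>

lemma fill_delete_pair: "fill n (x # inv_letter x # u) \<Longrightarrow> fill n u"
proof (cases rule: fillable.cases)
  assume "fill n (x # inv_letter x # u)"
  then show "fill n (x # inv_letter x # u)" .
next
  fix k s v y
  assume "n = Suc k" "x # inv_letter x # u = y # v" "fill k (s @ v)" "inv_letter y # s \<in> Q"
  then show "fill n u"
    by auto (use fill_delete_relator[of k "s @ [inv_letter x]" u]
      rotate_relator[of "[inv_letter x]" s] in auto)
next
  fix k m a b y
  assume *: "n = k + m" "x # inv_letter x # u = y # a @ inv_letter y # b"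
    "fill k a" "fill m b" "fst y \<in> A"
  show "fill n u"
  proof (cases a)
    case Nil
    with * show ?thesis using fill_mono by simp
  next
    case (Cons z a')
    with *(2) have "x = y" "z = inv_letter y" by auto
    with * Cons have "fill k (a' @ [inv_letter x])" using fill_rotate[of k "[inv_letter x]" a'] by simp
    from fill_append[OF this *(4)] * Cons show ?thesis by simp
  qed
qed simp

section \<open>Area of words\<close>

lemma area_leI: "fill n w \<Longrightarrow> area w \<le> enat n"
  unfolding filling_area_def by (rule Inf_lower) simp

lemma area_enatD: "area w = enat n \<Longrightarrow> fill n w"
proof -
  assume *: "area w = enat n"
  then have "{n. fill n w} \<noteq> {}" by (auto simp: filling_area_def Inf_enat_def split: if_splits)
  then have "Inf (enat ` {n. fill n w}) \<in> enat ` {n. fill n w}"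
    by (metis Inf_enat_def LeastI_ex ex_in_conv image_is_empty)
  then show ?thesis using * by (auto simp: filling_area_def)
qed

lemma area_leE:
  assumes "\<And>n. fill n v \<Longrightarrow> fill (n + k) w"
  shows "area w \<le> area v + enat k"
proof (cases "area v")
  case (enat n)
  then show ?thesis using area_leI[OF assms[OF area_enatD[OF enat]]] by simp
qed simp

lemma area_Nil [simp]: "area [] = 0"
  using area_leI[OF fill_Nil[of A Q 0]] by (simp add: zero_enat_def[symmetric])

lemma area_append: "area (u @ v) \<le> area u + area v"
proof (cases "area u"; cases "area v")
  fix n m assume *: "area u = enat n" "area v = enat m"
  show ?thesis using area_leI[OF fill_append[OF area_enatD[OF *(1)] area_enatD[OF *(2)]]] *
    by simp
qed simp_all

lemma area_rotate: "area (u @ v) = area (v @ u)"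
proof -
  have "area (v @ u) \<le> area (u @ v)" for u v
    using area_leE[of "u @ v" 0 "v @ u"] fill_rotate[of _ u v] by (simp add: zero_enat_def[symmetric])
  then show ?thesis by (simp add: antisym)
qed

lemma area_delete_pair: "area u \<le> area (x # inv_letter x # u)"
  using area_leE[of "x # inv_letter x # u" 0 u] fill_delete_pair[of _ x u]
  by (simp add: zero_enat_def[symmetric])

lemma area_pair: "fst x \<in> A \<Longrightarrow> area [x, inv_letter x] = 0"
  using area_leI[OF fill_Edge[OF fill_Nil[of A Q 0] fill_Nil[of A Q 0], of x]]
  by (simp add: zero_enat_def[symmetric])

lemma area_cell: "inv_letter x # s \<in> Q \<Longrightarrow> area (x # u) \<le> area (s @ u) + 1"
  using area_leE[of "s @ u" 1 "x # u"] fill_Cell[of A Q _ s u x] by (simp add: one_enat_def)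

end

section \<open>Cycles of permutations\<close>

text \<open>A list fixes the starting point of an orbit, which boundary words need, and lets
  circuits be spliced by concatenation.\<close>

definition is_cycle :: "('a \<Rightarrow> 'a) \<Rightarrow> 'a list \<Rightarrow> bool" where
  "is_cycle f xs \<longleftrightarrow> xs \<noteq> [] \<and> distinct xs \<and> successively (\<lambda>a b. f a = b) xs \<and> f (last xs) = hd xs"

lemma successively_fun_cong:
  "(\<And>a. a \<in> set (butlast xs) \<Longrightarrow> f a = g a) \<Longrightarrow>
   successively (\<lambda>a b. f a = b) xs \<longleftrightarrow> successively (\<lambda>a b. g a = b) xs"
proof (induction xs)
  case (Cons x xs)
  then show ?case by (cases xs) auto
qed simp

lemma is_cycle_cong: "(\<And>a. a \<in> set xs \<Longrightarrow> f a = g a) \<Longrightarrow> is_cycle f xs \<longleftrightarrow> is_cycle g xs"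
  using successively_fun_cong[of xs f g] in_set_butlastD[of _ xs] unfolding is_cycle_def by auto

lemma is_cycle_rotate: "is_cycle f (u @ v) \<Longrightarrow> is_cycle f (v @ u)"
  by (cases "u = []"; cases "v = []") (auto simp: is_cycle_def successively_append_iff)

lemma last_notin_butlast: "distinct xs \<Longrightarrow> xs \<noteq> [] \<Longrightarrow> last xs \<notin> set (butlast xs)"
  by (metis append_butlast_last_id distinct_butlast distinct_append disjoint_iff list.set_intros(1))

text \<open>The transposition exchanges the successors of the two last entries, which splices two
  circuits into one.\<close>

lemma is_cycle_transpose:
  assumes "xs \<noteq> []" "ys \<noteq> []" "distinct (xs @ ys)"
  shows "is_cycle (f \<circ> transpose (last xs) (last ys)) (xs @ ys) \<longleftrightarrow> is_cycle f xs \<and> is_cycle f ys"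
    (is "is_cycle ?g _ \<longleftrightarrow> _")
proof -
  have "?g a = f a" if "a \<in> set (butlast xs) \<union> set (butlast ys)" for a
  proof -
    have "a \<noteq> last xs" "a \<noteq> last ys"
      using that assms last_notin_butlast[of xs] last_notin_butlast[of ys] last_in_set[of xs]
        last_in_set[of ys] in_set_butlastD[of a xs] in_set_butlastD[of a ys]
      by (auto simp: disjoint_iff)
    then show ?thesis by (simp add: transpose_def)
  qed
  then have "successively (\<lambda>a b. ?g a = b) xs = successively (\<lambda>a b. f a = b) xs"
    "successively (\<lambda>a b. ?g a = b) ys = successively (\<lambda>a b. f a = b) ys"
    by (intro successively_fun_cong; blast)+
  then show ?thesis using assms by (auto simp: is_cycle_def successively_append_iff)
qed

lemma is_cycle_closed: "is_cycle f xs \<Longrightarrow> x \<in> set xs \<Longrightarrow> f x \<in> set xs"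
proof -
  assume *: "is_cycle f xs" "x \<in> set xs"
  then obtain u v where "xs = u @ x # v" by (auto simp: in_set_conv_decomp)
  with is_cycle_rotate[of f u "x # v"] * have "is_cycle f (x # v @ u)" "set xs = set (x # v @ u)"
    by auto
  then show ?thesis by (cases "v @ u") (auto simp: is_cycle_def)
qed

lemma is_cycle_nth: "is_cycle f xs \<Longrightarrow> k < length xs \<Longrightarrow> xs ! k = (f ^^ k) (hd xs)"
proof (induction k)
  case 0
  then show ?case by (simp add: is_cycle_def hd_conv_nth)
next
  case (Suc k)
  then have "f (xs ! k) = xs ! Suc k"
    by (auto simp: is_cycle_def successively_conv_nth)
  then show ?case using Suc by simp
qed

lemma orbit_cycle: "is_cycle f xs \<Longrightarrow> x \<in> set xs \<Longrightarrow> orbit f x = set xs"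
proof -
  assume *: "is_cycle f xs" "x \<in> set xs"
  then obtain u v where xs: "xs = u @ x # v" by (auto simp: in_set_conv_decomp)
  let ?ys = "x # v @ u"
  have c: "is_cycle f ?ys" "set xs = set ?ys" using is_cycle_rotate[of f u "x # v"] * xs by auto
  have "y \<in> set xs" if "y \<in> orbit f x" for y
    using that by induction (use *(2) is_cycle_closed[OF *(1)] in auto)
  moreover have "y \<in> orbit f x" if y: "y \<in> set xs" for y
  proof -
    obtain k where k: "k < length ?ys" "?ys ! k = y" using y c(2) by (metis in_set_conv_nth)
    show ?thesis
    proof (cases k)
      case 0
      have "f (last ?ys) = x" using c(1) by (simp add: is_cycle_def del: last.simps)
      moreover have "last ?ys = (f ^^ (length ?ys - 1)) x"
        using is_cycle_nth[OF c(1), of "length ?ys - 1"] by (subst last_conv_nth) auto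
      ultimately have "(f ^^ length ?ys) x = x" by simp
      moreover have "(f ^^ length ?ys) x \<in> orbit f x"
        unfolding orbit_altdef by (rule CollectI, rule exI[of _ "length ?ys"]) simp
      ultimately have "x \<in> orbit f x" by simp
      then show ?thesis using 0 k by simp
    next
      case (Suc j)
      then have "y = (f ^^ k) x" using is_cycle_nth[OF c(1) k(1)] k(2) by simp
      then show ?thesis unfolding orbit_altdef using Suc by blast
    qed
  qed
  ultimately show ?thesis by blast
qed

definition cycle_from :: "('a \<Rightarrow> 'a) \<Rightarrow> 'a \<Rightarrow> 'a list" where
  "cycle_from f e = map (\<lambda>k. (f ^^ k) e) [0..<card (orbit f e)]"

lemma cycle_from_eq: "is_cycle f xs \<Longrightarrow> cycle_from f (hd xs) = xs"
  using orbit_cycle[of f xs "hd xs"]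
  by (intro nth_equalityI)
    (auto simp: cycle_from_def is_cycle_def distinct_card is_cycle_nth[unfolded is_cycle_def])

definition num_orbits :: "('a \<Rightarrow> 'a) \<Rightarrow> 'a set \<Rightarrow> nat" where
  "num_orbits f B = card (orbit f ` B)"

text \<open>Bijectivity is asked for on \<open>B\<close> only, because the same function is later
  restricted to invariant subsets of its carrier.\<close>

locale finite_perm =
  fixes f :: "'a \<Rightarrow> 'a" and B :: "'a set"
  assumes finite_carrier: "finite B" and bij: "bij_betw f B B"
begin

lemma closed: "x \<in> B \<Longrightarrow> f x \<in> B"
  using bij by (auto simp: bij_betw_def)

lemma orbit_sub: "x \<in> B \<Longrightarrow> orbit f x \<subseteq> B"
proof
  fix y assume "x \<in> B" "y \<in> orbit f x"
  from this(2,1) show "y \<in> B" by induction (auto intro: closed)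
qed

lemma self_orbit: "x \<in> B \<Longrightarrow> x \<in> orbit f x"
proof -
  assume x: "x \<in> B"
  define g where "g = (\<lambda>y. if y \<in> B then f y else y)"
  have "bij_betw g B B" using bij by (auto simp: g_def cong: bij_betw_cong)
  then have "g permutes B" by (intro bij_imp_permutes) (auto simp: g_def)
  then have "x \<in> orbit g x"
    using permutation_self_in_orbit[of g x] permutation_permutes[of g] finite_carrier by metis
  moreover have "y \<in> orbit f x" if "y \<in> orbit g x" for y
    using that
  proof induction
    case (step y)
    then show ?case using orbit_sub[OF x] by (auto simp: g_def intro: orbit.intros)
  qed (use x in \<open>auto simp: g_def intro: orbit.intros\<close>)
  ultimately show ?thesis by blast
qed

lemma cycle_from: assumes "e \<in> B"
  shows "is_cycle f (cycle_from f e)" "hd (cycle_from f e) = e" "set (cycle_from f e) = orbit f e"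
proof -
  let ?n = "funpow_dist1 f e e"
  let ?xs = "map (\<lambda>k. (f ^^ k) e) [0..<?n]"
  have e: "e \<in> orbit f e" using self_orbit assms .
  define n where "n = ?n"
  have n: "n > 0" "inj_on (\<lambda>k. (f ^^ k) e) {0..<n}" "(f ^^ n) e = e"
    unfolding n_def by (simp, rule inj_on_funpow_dist1[OF e], rule funpow_dist1_prop[OF e])
  have "f ((f ^^ (n - 1)) e) = e" using n(1,3) by (metis Suc_pred' comp_apply funpow.simps(2))
  then have "is_cycle f ?xs" unfolding n_def[symmetric]
    using n by (simp add: is_cycle_def distinct_map successively_conv_nth last_map hd_map)
  moreover have "hd ?xs = e" by (simp add: hd_map del: upt_Suc)
  ultimately show "is_cycle f (cycle_from f e)" "hd (cycle_from f e) = e" using cycle_from_eq[of f ?xs] by auto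
  moreover have "cycle_from f e \<noteq> []" using calculation(1) by (simp add: is_cycle_def)
  ultimately show "set (cycle_from f e) = orbit f e"
    using orbit_cycle[of f "cycle_from f e" e] hd_in_set by metis
qed

lemma orbit_eq: "x \<in> B \<Longrightarrow> y \<in> orbit f x \<Longrightarrow> orbit f y = orbit f x"
  using cycle_from[of x] orbit_cycle by metis

text \<open>The chosen element is put last because \<open>is_cycle_transpose\<close> acts on last
  entries.\<close>

lemma cycle_last: assumes "e \<in> B"
  obtains xs where "is_cycle f (xs @ [e])" "set (xs @ [e]) = orbit f e"
proof -
  obtain zs where "cycle_from f e = e # zs" using cycle_from(1,2)[OF assms] by (cases "cycle_from f e") (auto simp: is_cycle_def)
  then show ?thesis using that[of zs] cycle_from[OF assms] is_cycle_rotate[of f "[e]" zs] by auto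
qed

lemma finite_perm_transpose: "a \<in> B \<Longrightarrow> b \<in> B \<Longrightarrow> finite_perm (f \<circ> transpose a b) B"
proof
  assume "a \<in> B" "b \<in> B"
  then have "bij_betw (transpose a b) B B"
    using permutes_imp_bij[OF permutes_swap_id[of a B b]] by simp
  then show "bij_betw (f \<circ> transpose a b) B B" using bij bij_betw_trans by blast
qed (rule finite_carrier)

lemma transpose_other:
  assumes "x \<in> B" "a \<notin> orbit f x" "b \<notin> orbit f x"
  shows "orbit (f \<circ> transpose a b) x = orbit f x" "cycle_from (f \<circ> transpose a b) x = cycle_from f x"
proof -
  have "(f \<circ> transpose a b) e = f e" if "e \<in> set (cycle_from f x)" for e
    using that assms unfolding cycle_from(3)[OF assms(1)] by (auto simp: transpose_def)
  then have "is_cycle (f \<circ> transpose a b) (cycle_from f x)"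
    using is_cycle_cong cycle_from(1)[OF assms(1)] by blast
  from cycle_from_eq[OF this] orbit_cycle[OF this, of x]
  show "orbit (f \<circ> transpose a b) x = orbit f x" "cycle_from (f \<circ> transpose a b) x = cycle_from f x"
    unfolding cycle_from(2,3)[OF assms(1)] using self_orbit[OF assms(1)] by simp_all
qed

text \<open>Splitting an orbit here and joining two orbits in \<open>join_cycle\<close> are the two
  directions of \<open>is_cycle_transpose\<close>, since a transposition cancels itself.\<close>

lemma split_cycle:
  assumes "a \<in> B" "b \<in> orbit f a" "a \<noteq> b"
  obtains xs ys where "is_cycle f ((xs @ [a]) @ (ys @ [b]))" "set ((xs @ [a]) @ (ys @ [b])) = orbit f a"
    "is_cycle (f \<circ> transpose a b) (xs @ [a])" "is_cycle (f \<circ> transpose a b) (ys @ [b])"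
proof -
  have b: "b \<in> B" using assms orbit_sub by blast
  obtain zs where zs: "is_cycle f (zs @ [b])" "set (zs @ [b]) = orbit f b" by (rule cycle_last[OF b])
  have "orbit f b = orbit f a" using orbit_eq assms by blast
  then have "a \<in> set zs" using zs assms self_orbit[of a] by auto
  then obtain xs ys where "zs = xs @ a # ys" by (auto simp: in_set_conv_decomp)
  then have *: "is_cycle f ((xs @ [a]) @ (ys @ [b]))" "set ((xs @ [a]) @ (ys @ [b])) = orbit f a"
    using zs \<open>orbit f b = orbit f a\<close> by auto
  have "f = (f \<circ> transpose a b) \<circ> transpose a b" by (simp add: comp_assoc)
  with * is_cycle_transpose[of "xs @ [a]" "ys @ [b]" "f \<circ> transpose a b"]
  show ?thesis using that[OF *] by (auto simp: is_cycle_def)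
qed

lemma join_cycle:
  assumes "a \<in> B" "b \<in> B" "b \<notin> orbit f a"
  obtains xs ys where "is_cycle f (xs @ [a])" "set (xs @ [a]) = orbit f a"
    "is_cycle f (ys @ [b])" "set (ys @ [b]) = orbit f b"
    "is_cycle (f \<circ> transpose a b) ((xs @ [a]) @ (ys @ [b]))"
proof -
  obtain xs where xs: "is_cycle f (xs @ [a])" "set (xs @ [a]) = orbit f a" by (rule cycle_last[OF assms(1)])
  obtain ys where ys: "is_cycle f (ys @ [b])" "set (ys @ [b]) = orbit f b" by (rule cycle_last[OF assms(2)])
  have "orbit f a \<inter> orbit f b = {}"
    using assms orbit_eq[of a] orbit_eq[of b] self_orbit[of b] by blast
  then have "distinct ((xs @ [a]) @ (ys @ [b]))"
    using xs ys by (metis distinct_append is_cycle_def)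
  from is_cycle_transpose[OF _ _ this, of f] xs ys
  have "is_cycle (f \<circ> transpose a b) ((xs @ [a]) @ (ys @ [b]))" by simp
  from that[OF xs ys this] show ?thesis .
qed

lemma split_orbits:
  assumes "a \<in> B" "b \<in> orbit f a" "a \<noteq> b"
  shows "b \<notin> orbit (f \<circ> transpose a b) a" "num_orbits (f \<circ> transpose a b) B = Suc (num_orbits f B)"
    "orbit f a = orbit (f \<circ> transpose a b) a \<union> orbit (f \<circ> transpose a b) b"
proof -
  let ?g = "f \<circ> transpose a b"
  obtain xs ys where c: "is_cycle f ((xs @ [a]) @ (ys @ [b]))" "set ((xs @ [a]) @ (ys @ [b])) = orbit f a"
    "is_cycle ?g (xs @ [a])" "is_cycle ?g (ys @ [b])" by (rule split_cycle[OF assms])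
  let ?O = "set (xs @ [a]) \<union> set (ys @ [b])"
  have o: "orbit ?g x = set (xs @ [a])" if "x \<in> set (xs @ [a])" for x using orbit_cycle[OF c(3) that] .
  have o': "orbit ?g x = set (ys @ [b])" if "x \<in> set (ys @ [b])" for x using orbit_cycle[OF c(4) that] .
  have d: "distinct ((xs @ [a]) @ (ys @ [b]))" using c(1) unfolding is_cycle_def by blast
  show "b \<notin> orbit ?g a" using o[of a] d by auto
  show "orbit f a = orbit ?g a \<union> orbit ?g b" using o[of a] o'[of b] c(2) by auto
  let ?R = "orbit f ` (B - orbit f a)"
  have b: "b \<in> B" using assms orbit_sub by blast
  have other: "orbit f x \<inter> orbit f a = {}" if "x \<in> B - orbit f a" for x
    using that self_orbit[of x] orbit_eq[of x] orbit_eq[of a] assms(1) by blast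
  have R: "orbit ?g ` (B - orbit f a) = ?R"
    using transpose_other(1)[of _ a b] other assms self_orbit[OF assms(1)]
    by (intro image_cong) (auto dest!: other)
  have sub: "?O \<subseteq> B" using orbit_sub[OF assms(1)] c(2) by auto
  have "orbit ?g ` B = orbit ?g ` (B - orbit f a) \<union> orbit ?g ` ?O"
    using sub c(2) by (metis Un_Diff_cancel2 image_Un set_append sup.absorb1)
  moreover have "orbit ?g ` ?O = {set (xs @ [a]), set (ys @ [b])}"
    unfolding image_Un using o o' by (auto simp: image_def)
  ultimately have 1: "orbit ?g ` B = ?R \<union> {set (xs @ [a]), set (ys @ [b])}" using R by (simp only:)
  have "orbit f ` B = ?R \<union> orbit f ` orbit f a"
    using orbit_sub[OF assms(1)] by blast
  moreover have "orbit f ` orbit f a = {orbit f a}"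
    using orbit_eq[OF assms(1)] assms(2) by auto
  ultimately have 2: "orbit f ` B = ?R \<union> {orbit f a}" by simp
  have fin: "finite ?R" using finite_carrier by simp
  have "T \<notin> ?R" if "T \<subseteq> orbit f a" "T \<noteq> {}" for T
  proof
    assume "T \<in> ?R"
    then obtain x where "x \<in> B - orbit f a" "T = orbit f x" by blast
    with other[of x] that show False by blast
  qed
  then have "orbit f a \<notin> ?R" "set (xs @ [a]) \<notin> ?R" "set (ys @ [b]) \<notin> ?R"
    using c(2) assms(2) by auto
  moreover have "set (xs @ [a]) \<noteq> set (ys @ [b])" using d by auto
  ultimately show "num_orbits ?g B = Suc (num_orbits f B)"
    unfolding num_orbits_def 1 2 using fin by simp
qed

text \<open>The count comes from \<open>split_orbits\<close> for the composed permutation, from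
  which the same transposition leads back to \<open>f\<close>.\<close>

lemma join_orbits:
  assumes "a \<in> B" "b \<in> B" "b \<notin> orbit f a"
  shows "orbit (f \<circ> transpose a b) a = orbit f a \<union> orbit f b"
    "num_orbits f B = Suc (num_orbits (f \<circ> transpose a b) B)"
proof -
  let ?g = "f \<circ> transpose a b"
  obtain xs ys where c: "set (xs @ [a]) = orbit f a" "set (ys @ [b]) = orbit f b"
    "is_cycle ?g ((xs @ [a]) @ (ys @ [b]))" by (rule join_cycle[OF assms])
  interpret g: finite_perm ?g B by (rule finite_perm_transpose[OF assms(1,2)])
  have *: "orbit ?g a = set ((xs @ [a]) @ (ys @ [b]))" using orbit_cycle[OF c(3), of a] by simp
  then show "orbit ?g a = orbit f a \<union> orbit f b" using c by auto
  have "a \<noteq> b" using assms self_orbit by blast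
  from g.split_orbits(2)[OF assms(1) _ this] * show "num_orbits f B = Suc (num_orbits ?g B)"
    by (simp add: comp_assoc)
qed

end

section \<open>The genus inequality\<close>

definition eqv :: "('a \<times> 'a) set \<Rightarrow> ('a \<times> 'a) set" where
  "eqv r = (r \<union> r\<inverse>)\<^sup>*"

text \<open>The number of connected components of the graph \<open>r\<close> that meet
  \<open>B\<close>.\<close>

definition num_classes :: "('a \<times> 'a) set \<Rightarrow> 'a set \<Rightarrow> nat" where
  "num_classes r B = card ((\<lambda>e. eqv r `` {e}) ` B)"

lemma eqv_refl [simp]: "(x, x) \<in> eqv r" by (simp add: eqv_def)
lemma eqv_base: "(x, y) \<in> r \<Longrightarrow> (x, y) \<in> eqv r" by (auto simp: eqv_def)
lemma eqv_sym: "(x, y) \<in> eqv r \<Longrightarrow> (y, x) \<in> eqv r"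
  unfolding eqv_def using sym_rtrancl[OF sym_Un_converse[of r]] by (auto dest: symD)
lemma eqv_trans: "(x, y) \<in> eqv r \<Longrightarrow> (y, z) \<in> eqv r \<Longrightarrow> (x, z) \<in> eqv r"
  by (auto simp: eqv_def)
lemma equiv_eqv: "equiv UNIV (eqv r)"
  by (rule equivI) (auto simp: refl_on_def sym_def trans_def intro: eqv_sym eqv_trans)
lemma eqv_class_eq: "eqv r `` {x} = eqv r `` {y} \<longleftrightarrow> (x, y) \<in> eqv r"
  by (metis eq_equiv_class_iff equiv_eqv UNIV_I)

lemma eqv_map:
  assumes "(x, y) \<in> eqv r" "\<And>a b. (a, b) \<in> r \<Longrightarrow> (h a, h b) \<in> eqv r'"
  shows "(h x, h y) \<in> eqv r'"
  using assms(1)[unfolded eqv_def]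
proof (induction rule: rtrancl_induct)
  case (step y z)
  from step(2) have "(h y, h z) \<in> eqv r'"
    using assms(2)[of y z] eqv_sym[OF assms(2), of z y] by auto
  with step.IH show ?case by (rule eqv_trans)
qed simp

lemma eqv_subset: "r \<subseteq> eqv r' \<Longrightarrow> eqv r \<subseteq> eqv r'"
  using eqv_map[of _ _ r "\<lambda>x. x" r'] by auto

lemma subset_eqv: "r \<subseteq> eqv r" by (auto intro: eqv_base)

lemma eqv_insert_iff:
  "(x, y) \<in> eqv (insert (a, b) r) \<longleftrightarrow> (x, y) \<in> eqv r \<or>
     ((a, x) \<in> eqv r \<or> (b, x) \<in> eqv r) \<and> ((a, y) \<in> eqv r \<or> (b, y) \<in> eqv r)" (is "_ \<longleftrightarrow> ?R x y")
proof
  assume "(x, y) \<in> eqv (insert (a, b) r)"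
  then show "?R x y" unfolding eqv_def[of "insert (a,b) r"]
  proof (induction rule: rtrancl_induct)
    case (step y z)
    then consider "(y, z) \<in> r" | "(z, y) \<in> r" | "{y, z} = {a, b}" by auto
    then have "(y, z) \<in> eqv r \<or> {y, z} = {a, b}"
      by cases (use eqv_base[of _ _ r] eqv_sym[OF eqv_base, of z y r] in simp_all)
    then show ?case
    proof
      assume "(y, z) \<in> eqv r"
      then show ?thesis
        using step.IH eqv_trans[of x y r z] eqv_trans[of a y r z] eqv_trans[of b y r z] by blast
    next
      assume "{y, z} = {a, b}"
      then have "(y = a \<or> y = b) \<and> (z = a \<or> z = b)" by auto
      then show ?thesis using step.IH eqv_sym[of x y r] by auto
    qed
  qed simp
next
  have sub: "eqv r \<subseteq> eqv (insert (a, b) r)" by (rule eqv_subset) (auto intro: eqv_base)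
  have ab: "(a, b) \<in> eqv (insert (a, b) r)" by (simp add: eqv_base)
  have *: "(a, z) \<in> eqv (insert (a, b) r)" if "(a, z) \<in> eqv r \<or> (b, z) \<in> eqv r" for z
    using that sub eqv_trans[OF ab, of z] by blast
  assume "?R x y"
  then show "(x, y) \<in> eqv (insert (a, b) r)"
    using sub eqv_trans[OF eqv_sym[OF *[of x]] *[of y]] by blast
qed

lemma num_classes_mono: assumes "finite B" "eqv r \<subseteq> eqv r'" shows "num_classes r' B \<le> num_classes r B"
proof -
  have "eqv r' `` (eqv r `` {e}) = eqv r' `` {e}" for e
    using assms(2) eqv_trans[of e _ r'] by (auto intro: eqv_refl)
  then have "(\<lambda>e. eqv r' `` {e}) ` B = (\<lambda>C. eqv r' `` C) ` (\<lambda>e. eqv r `` {e}) ` B"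
    by (simp add: image_image)
  then show ?thesis unfolding num_classes_def using assms(1) by (simp add: card_image_le)
qed

lemma num_classes_insert_related: assumes "finite B" "(a, b) \<in> eqv r" shows "num_classes (insert (a, b) r) B = num_classes r B"
proof -
  have "eqv (insert (a, b) r) = eqv r"
    using eqv_subset[of "insert (a, b) r" r] eqv_subset[of r "insert (a, b) r"] assms(2)
      subset_eqv[of r] subset_eqv[of "insert (a, b) r"] by blast
  then show ?thesis by (simp add: num_classes_def)
qed

lemma num_classes_insert_unrelated:
  assumes B: "finite B" "a \<in> B" "b \<in> B" and ab: "(a, b) \<notin> eqv r"
  shows "num_classes r B = Suc (num_classes (insert (a, b) r) B)"
proof -
  let ?c = "\<lambda>e. eqv r `` {e}" and ?c' = "\<lambda>e. eqv (insert (a, b) r) `` {e}"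
  let ?U = "?c a \<union> ?c b"
  define B' where "B' = B - ?U"
  have in_U: "?c' e = ?U" if "e \<in> ?U" for e
    using that eqv_trans[of a e r] eqv_trans[of b e r] by (auto simp: eqv_insert_iff)
  have out_U: "?c' e = ?c e" if "e \<in> B'" for e
    using that by (auto simp: eqv_insert_iff B'_def)
  have c_in: "?c e \<in> {?c a, ?c b}" if "e \<in> ?U" for e
    using that eqv_class_eq[of r a e] eqv_class_eq[of r b e] by auto
  have "B = B' \<union> (B \<inter> ?U)" by (auto simp: B'_def)
  then have "?c ` B = ?c ` B' \<union> ?c ` (B \<inter> ?U)" "?c' ` B = ?c' ` B' \<union> ?c' ` (B \<inter> ?U)"
    by (metis image_Un)+
  moreover have "?c ` (B \<inter> ?U) = {?c a, ?c b}" using c_in B(2,3) by (auto simp: image_iff)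
  moreover have "?c' ` (B \<inter> ?U) = {?U}"
  proof -
    have "a \<in> B \<inter> ?U" using B by simp
    then show ?thesis using in_U by blast
  qed
  moreover have "?c' ` B' = ?c ` B'" using out_U by simp
  ultimately have *: "?c ` B = ?c ` B' \<union> {?c a, ?c b}" "?c' ` B = ?c ` B' \<union> {?U}" by simp_all
  have "e \<in> ?c e" for e by simp
  then have "T \<notin> ?c ` B'" if "T \<subseteq> ?U" for T
    using that unfolding B'_def by blast
  then have "?c a \<notin> ?c ` B'" "?c b \<notin> ?c ` B'" "?U \<notin> ?c ` B'"
    by simp_all
  moreover have "?c a \<noteq> ?c b" using ab by (simp add: eqv_class_eq)
  ultimately show ?thesis unfolding num_classes_def * using B(1) by (simp add: B'_def)
qed

definition fgraph :: "('a \<Rightarrow> 'a) \<Rightarrow> 'a set \<Rightarrow> ('a \<times> 'a) set" where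
  "fgraph f B = (\<lambda>e. (e, f e)) ` B"

text \<open>If \<open>f\<close> runs along faces and \<open>\<alpha>\<close> reverses edges, the
  classes of this graph are the dart sets of the components of the surface.\<close>

definition links :: "'a set \<Rightarrow> ('a \<Rightarrow> 'a) \<Rightarrow> ('a \<Rightarrow> 'a) \<Rightarrow> ('a \<times> 'a) set" where
  "links B \<alpha> f = fgraph \<alpha> B \<union> fgraph f B"

text \<open>The last pair acts first, so appending a pair to \<open>ps\<close> composes
  \<open>f \<circ> transposes ps\<close> with one more transposition on the right, as in
  \<open>split_orbits\<close> and \<open>join_orbits\<close>.\<close>

definition transposes :: "('a \<times> 'a) list \<Rightarrow> 'a \<Rightarrow> 'a" where
  "transposes ps = fold (\<lambda>(a, b) g. g \<circ> transpose a b) ps id"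

lemma transposes_Nil [simp]: "transposes [] = id" by (simp add: transposes_def)
lemma transposes_snoc [simp]: "transposes (ps @ [(a, b)]) = transposes ps \<circ> transpose a b"
  by (simp add: transposes_def)

context finite_perm
begin

lemma orbit_eqv:
  assumes "e \<in> B" "fgraph f B \<subseteq> eqv r" "y \<in> orbit f e"
  shows "(e, y) \<in> eqv r"
  using assms(3)
proof induction
  case base
  then show ?case using assms by (auto simp: fgraph_def)
next
  case (step y)
  then have "y \<in> B" using orbit_sub assms(1) by blast
  then have "(y, f y) \<in> eqv r" using assms(2) by (auto simp: fgraph_def)
  with step.IH show ?case by (rule eqv_trans)
qed

lemma orbit_eq_class: "e \<in> B \<Longrightarrow> orbit f e = eqv (fgraph f B) `` {e}"
proof (intro equalityI subsetI)
  fix y assume "e \<in> B" "y \<in> orbit f e"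
  then show "y \<in> eqv (fgraph f B) `` {e}" using orbit_eqv[of e "fgraph f B" y] subset_eqv by auto
next
  fix y assume e: "e \<in> B" and "y \<in> eqv (fgraph f B) `` {e}"
  then have "(e, y) \<in> (fgraph f B \<union> (fgraph f B)\<inverse>)\<^sup>*" by (simp add: eqv_def)
  then show "y \<in> orbit f e"
  proof (induction rule: rtrancl_induct)
    case base
    then show ?case using self_orbit e .
  next
    case (step y z)
    then have y: "y \<in> B" "orbit f y = orbit f e" using e orbit_sub orbit_eq[of e y] by auto
    from step(2) consider "z = f y" | "y = f z" "z \<in> B" by (auto simp: fgraph_def)
    then show ?case
    proof cases
      case 1
      then show ?thesis using step.IH orbit.step by auto
    next
      case 2
      then have "orbit f y = orbit f z" using orbit_eq[of z y] orbit.base[of f z] by simp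
      then show ?thesis using y self_orbit[OF 2(2)] by simp
    qed
  qed
qed

lemma num_orbits_eq_num_classes: "num_orbits f B = num_classes (fgraph f B) B"
  unfolding num_orbits_def num_classes_def using orbit_eq_class by (metis (no_types, lifting) image_cong)

text \<open>This is Ree's inequality, i.e. that the genus of a surface is nonnegative. Composing with one more
  transposition changes the number of orbits by one, and it decreases this number if it joins two
  classes.\<close>

lemma genus_transposes:
  assumes "set ps \<subseteq> B \<times> B"
  shows "finite_perm (f \<circ> transposes ps) B \<and>
    fgraph (f \<circ> transposes ps) B \<subseteq> eqv (fgraph f B \<union> set ps) \<and>
    num_orbits (f \<circ> transposes ps) B + num_orbits f B \<le> length ps + 2 * num_classes (fgraph f B \<union> set ps) B"
  using assms
proof (induction ps rule: rev_induct)
  case Nil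
  then show ?case using num_orbits_eq_num_classes finite_perm_axioms by (auto intro: eqv_base)
next
  case (snoc z ps)
  obtain a b where z: "z = (a, b)" by force
  let ?F = "f \<circ> transposes ps"
  let ?r = "fgraph f B \<union> set ps"
  have ab: "a \<in> B" "b \<in> B" and ps: "set ps \<subseteq> B \<times> B" using snoc.prems z by auto
  have IH: "finite_perm ?F B" "fgraph ?F B \<subseteq> eqv ?r"
    "num_orbits ?F B + num_orbits f B \<le> length ps + 2 * num_classes ?r B" using snoc.IH[OF ps] by blast+
  interpret F: finite_perm ?F B by (rule IH)
  have r: "fgraph f B \<union> set (ps @ [z]) = insert (a, b) ?r" using z by auto
  have sub: "eqv ?r \<subseteq> eqv (insert (a, b) ?r)" by (rule eqv_subset) (auto intro: eqv_base)
  have new: "f \<circ> transposes (ps @ [z]) = ?F \<circ> transpose a b" by (simp add: z comp_assoc)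
  have rel: "(a, b) \<in> eqv (insert (a, b) ?r)" by (simp add: eqv_base)
  have "fgraph (?F \<circ> transpose a b) B \<subseteq> eqv (insert (a, b) ?r)"
  proof
    fix p assume "p \<in> fgraph (?F \<circ> transpose a b) B"
    then obtain e where e: "e \<in> B" "p = (e, ?F (transpose a b e))" by (auto simp: fgraph_def)
    let ?t = "transpose a b e"
    have "?t \<in> B" using e ab by (auto simp: transpose_def)
    then have "(?t, ?F ?t) \<in> eqv (insert (a, b) ?r)" using IH(2) sub by (auto simp: fgraph_def)
    moreover have "(e, ?t) \<in> eqv (insert (a, b) ?r)" using rel eqv_sym[OF rel] by (auto simp: transpose_def)
    ultimately show "p \<in> eqv (insert (a, b) ?r)" using e(2) eqv_trans[of e ?t] by simp
  qed
  moreover have "num_orbits (?F \<circ> transpose a b) B + num_orbits f B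
      \<le> Suc (length ps) + 2 * num_classes (insert (a, b) ?r) B"
  proof (cases "(a, b) \<in> eqv ?r")
    case True
    have "num_orbits (?F \<circ> transpose a b) B \<le> Suc (num_orbits ?F B)"
    proof (cases "b \<in> orbit ?F a")
      case t: True
      show ?thesis
      proof (cases "a = b")
        case False
        then show ?thesis using F.split_orbits(2)[OF ab(1) t] by simp
      qed simp
    next
      case False
      then show ?thesis using F.join_orbits(2)[OF ab] by simp
    qed
    then show ?thesis using IH(3) num_classes_insert_related[OF finite_carrier True] by simp
  next
    case False
    then have "b \<notin> orbit ?F a" using F.orbit_eqv[OF ab(1) IH(2)] by blast
    then have "num_orbits ?F B = Suc (num_orbits (?F \<circ> transpose a b) B)" by (rule F.join_orbits(2)[OF ab])
    moreover have "num_classes ?r B = Suc (num_classes (insert (a, b) ?r) B)"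
      by (rule num_classes_insert_unrelated[OF finite_carrier ab False])
    ultimately show ?thesis using IH(3) by simp
  qed
  moreover have "length (ps @ [z]) = Suc (length ps)" by simp
  ultimately show ?case unfolding new r using F.finite_perm_transpose[OF ab] by (simp only:)
qed

end

text \<open>One transposition is spent per edge, so \<open>length ps\<close> becomes the edge term
  of the Euler characteristic.\<close>

lemma involution_transposes:
  assumes "finite B" "\<And>e. e \<in> B \<Longrightarrow> \<alpha> e \<in> B \<and> \<alpha> e \<noteq> e \<and> \<alpha> (\<alpha> e) = e"
  shows "\<exists>ps. 2 * length ps = card B \<and> set ps \<subseteq> fgraph \<alpha> B \<and>
    (\<forall>e. transposes ps e = (if e \<in> B then \<alpha> e else e))"
  using assms
proof (induction "card B" arbitrary: B rule: less_induct)
  case less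
  show ?case
  proof (cases "B = {}")
    case True
    then show ?thesis by (intro exI[of _ "[]"]) auto
  next
    case False
    then obtain a where a: "a \<in> B" by blast
    let ?B = "B - {a, \<alpha> a}"
    have al: "\<alpha> a \<in> B" "\<alpha> a \<noteq> a" "\<alpha> (\<alpha> a) = a" using less.prems(2)[OF a] by auto
    have c: "card B = card ?B + 2"
      using card_Diff_subset[of "{a, \<alpha> a}" B] al a less.prems(1) card_mono[of B "{a, \<alpha> a}"] by auto
    have inv: "\<alpha> e \<in> ?B \<and> \<alpha> e \<noteq> e \<and> \<alpha> (\<alpha> e) = e" if "e \<in> ?B" for e
      using less.prems(2)[of e] that al by (auto; metis)
    have "\<exists>ps. 2 * length ps = card ?B \<and> set ps \<subseteq> fgraph \<alpha> ?B \<and>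
      (\<forall>e. transposes ps e = (if e \<in> ?B then \<alpha> e else e))"
      by (rule less.hyps) (use c less.prems(1) inv in auto)
    then obtain ps where ps: "2 * length ps = card ?B" "set ps \<subseteq> fgraph \<alpha> ?B"
      "\<And>e. transposes ps e = (if e \<in> ?B then \<alpha> e else e)" by blast
    show ?thesis
    proof (intro exI[of _ "ps @ [(a, \<alpha> a)]"] conjI allI)
      show "2 * length (ps @ [(a, \<alpha> a)]) = card B" using ps c by simp
      show "set (ps @ [(a, \<alpha> a)]) \<subseteq> fgraph \<alpha> B" using ps(2) a by (auto simp: fgraph_def)
      show "transposes (ps @ [(a, \<alpha> a)]) e = (if e \<in> B then \<alpha> e else e)" for e
        using al a by (auto simp: ps(3) transpose_def)
    qed
  qed
qed

lemma finite_perm_cong: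
  assumes "finite_perm f B" "\<And>e. e \<in> B \<Longrightarrow> f e = g e"
  shows "finite_perm g B" "e \<in> B \<Longrightarrow> orbit g e = orbit f e" "num_orbits g B = num_orbits f B"
    "e \<in> B \<Longrightarrow> cycle_from g e = cycle_from f e"
proof -
  interpret finite_perm f B by fact
  show fp: "finite_perm g B"
    using finite_carrier bij assms(2) by unfold_locales (auto cong: bij_betw_cong)
  have *: "orbit g e = orbit f e \<and> cycle_from g e = cycle_from f e" if e: "e \<in> B" for e
  proof -
    have "f x = g x" if "x \<in> set (cycle_from f e)" for x
      using that assms(2) orbit_sub[OF e] cycle_from(3)[OF e] by blast
    then have "is_cycle g (cycle_from f e)" using is_cycle_cong cycle_from(1)[OF e] by metis
    from cycle_from_eq[OF this] orbit_cycle[OF this, of e] show ?thesis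
      unfolding cycle_from(2,3)[OF e] using self_orbit[OF e] by simp
  qed
  then show "e \<in> B \<Longrightarrow> orbit g e = orbit f e" "e \<in> B \<Longrightarrow> cycle_from g e = cycle_from f e" by auto
  show "num_orbits g B = num_orbits f B" unfolding num_orbits_def using * by (metis (no_types, lifting) image_cong)
qed

text \<open>With the orbits of \<open>f \<circ> \<alpha>\<close> as vertices, those of
  \<open>f\<close> as faces and \<open>card B\<close> as twice the number of edges, this is V - E +
  F \<le> 2c for a map with c components, multiplied by two.\<close>

lemma genus_nonneg:
  assumes "finite_perm f B" "\<And>e. e \<in> B \<Longrightarrow> \<alpha> e \<in> B \<and> \<alpha> e \<noteq> e \<and> \<alpha> (\<alpha> e) = e"
  shows "finite_perm (f \<circ> \<alpha>) B" "2 * (num_orbits (f \<circ> \<alpha>) B + num_orbits f B) \<le> card B + 4 * num_classes (links B \<alpha> f) B"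
proof -
  interpret finite_perm f B by fact
  obtain ps where ps: "2 * length ps = card B" "set ps \<subseteq> fgraph \<alpha> B"
    "\<And>e. transposes ps e = (if e \<in> B then \<alpha> e else e)"
    using involution_transposes[OF finite_carrier assms(2)] by blast
  have "set ps \<subseteq> B \<times> B" using ps(2) assms(2) by (auto simp: fgraph_def)
  note * = genus_transposes[OF this]
  have eq: "(f \<circ> transposes ps) e = (f \<circ> \<alpha>) e" if "e \<in> B" for e using ps(3) that by simp
  from * have fp: "finite_perm (f \<circ> transposes ps) B" by blast
  show "finite_perm (f \<circ> \<alpha>) B" by (rule finite_perm_cong(1)[OF fp eq])
  have al: "\<alpha> e = transposes ps e" if "e \<in> B" for e using ps(3) that by simp
  have nb: "num_orbits (f \<circ> \<alpha>) B = num_orbits (f \<circ> transposes ps) B" by (rule finite_perm_cong(3)[OF fp eq])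
  have id: "finite_perm id B" using finite_carrier by unfold_locales auto
  \<comment> \<open>Applied to the identity, the class bound says that \<open>\<alpha>\<close> moves
    darts only within the classes generated by \<open>ps\<close>. Hence \<open>ps\<close> and
    \<open>\<alpha>\<close> generate the same components.\<close>
  have "fgraph (id \<circ> transposes ps) B \<subseteq> eqv (fgraph id B \<union> set ps)"
    using finite_perm.genus_transposes[OF id \<open>set ps \<subseteq> B \<times> B\<close>] by blast
  then have "fgraph \<alpha> B \<subseteq> eqv (fgraph id B \<union> set ps)" using al by (auto simp: fgraph_def)
  also have "\<dots> \<subseteq> eqv (fgraph f B \<union> set ps)"
    by (rule eqv_subset) (auto intro: eqv_base simp: fgraph_def)
  finally have "links B \<alpha> f \<subseteq> eqv (fgraph f B \<union> set ps)"
    by (auto simp: links_def intro: eqv_base)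
  moreover have "fgraph f B \<union> set ps \<subseteq> eqv (links B \<alpha> f)"
    using ps(2) by (auto simp: links_def intro!: eqv_base)
  ultimately have "eqv (fgraph f B \<union> set ps) = eqv (links B \<alpha> f)"
    using eqv_subset by (metis subset_antisym)
  then have "num_classes (fgraph f B \<union> set ps) B = num_classes (links B \<alpha> f) B" by (simp add: num_classes_def)
  then show "2 * (num_orbits (f \<circ> \<alpha>) B + num_orbits f B) \<le> card B + 4 * num_classes (links B \<alpha> f) B"
    using * nb ps(1) by simp
qed

section \<open>Planar systems\<close>

lemma num_orbits_Un:
  assumes "finite_perm f S" "finite_perm f T" "S \<inter> T = {}"
  shows "num_orbits f (S \<union> T) = num_orbits f S + num_orbits f T"
proof -
  interpret s: finite_perm f S by fact
  interpret t: finite_perm f T by fact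
  have "orbit f ` S \<inter> orbit f ` T = {}"
    using s.orbit_sub t.orbit_sub s.self_orbit assms(3) by fastforce
  then show ?thesis unfolding num_orbits_def image_Un
    using s.finite_carrier t.finite_carrier by (simp add: card_Un_disjoint)
qed

text \<open>The combinatorial map with dart set \<open>B\<close>, edges \<open>{e, \<alpha> e}\<close> and faces the orbits of \<open>\<phi>\<close> is a
  disjoint union of spheres (this is \<open>euler\<close>, in view of \<open>genus_nonneg\<close>), and the orbits inside \<open>X\<close> are
  regarded as outer. By \<open>one_outer\<close> every component has at most one outer face, so the components
  are discs or closed spheres. This is what makes pinching two corners of an outer face at the same vertex disconnect
  the component (\<open>split_planar\<close>).\<close>

locale planar_system = finite_perm \<phi> B for \<phi> :: "'a \<Rightarrow> 'a" and B :: "'a set" +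
  fixes \<alpha> :: "'a \<Rightarrow> 'a" and X :: "'a set"
  assumes involution: "e \<in> B \<Longrightarrow> \<alpha> e \<in> B \<and> \<alpha> e \<noteq> e \<and> \<alpha> (\<alpha> e) = e"
    and outer_sub: "X \<subseteq> B"
    and outer_closed: "e \<in> X \<Longrightarrow> \<phi> e \<in> X"
    and euler: "card B + 4 * num_classes (links B \<alpha> \<phi>) B \<le> 2 * (num_orbits (\<phi> \<circ> \<alpha>) B + num_orbits \<phi> B)"
    and one_outer: "a \<in> X \<Longrightarrow> b \<in> X \<Longrightarrow> (a, b) \<in> eqv (links B \<alpha> \<phi>) \<Longrightarrow> b \<in> orbit \<phi> a"
begin

sublocale rot: finite_perm "\<phi> \<circ> \<alpha>" B
  by (rule genus_nonneg(1)[OF finite_perm_axioms involution])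

abbreviation "L \<equiv> links B \<alpha> \<phi>"

lemma phi_link: "e \<in> B \<Longrightarrow> (e, \<phi> e) \<in> eqv L"
  by (rule eqv_base) (auto simp: links_def fgraph_def)

lemma alpha_link: "e \<in> B \<Longrightarrow> (e, \<alpha> e) \<in> eqv L"
  by (rule eqv_base) (auto simp: links_def fgraph_def)

lemma orbit_linked: "e \<in> B \<Longrightarrow> y \<in> orbit \<phi> e \<Longrightarrow> (e, y) \<in> eqv L"
  by (rule orbit_eqv) (auto simp: fgraph_def phi_link)

lemma rot_linked: "e \<in> B \<Longrightarrow> y \<in> orbit (\<phi> \<circ> \<alpha>) e \<Longrightarrow> (e, y) \<in> eqv L"
proof (rule rot.orbit_eqv)
  show "fgraph (\<phi> \<circ> \<alpha>) B \<subseteq> eqv L"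
    using eqv_trans[OF alpha_link phi_link] involution by (auto simp: fgraph_def)
qed

lemma orbit_outer: "e \<in> X \<Longrightarrow> orbit \<phi> e \<subseteq> X"
proof
  fix y assume "e \<in> X" "y \<in> orbit \<phi> e"
  from this(2,1) show "y \<in> X" by induction (auto intro: outer_closed)
qed

lemma outer_iff: "e \<in> B \<Longrightarrow> \<phi> e \<in> X \<longleftrightarrow> e \<in> X"
  using orbit_outer[of "\<phi> e"] orbit_eq[of e "\<phi> e"] self_orbit[of e] outer_closed[of e]
  by (auto intro: orbit.base)

text \<open>Conjugation by \<open>\<alpha>\<close>: changing the faces by a transposition of
  \<open>p\<close> and \<open>q\<close> changes the vertices by a transposition of the reversed
  darts. Thus both counts are governed by \<open>split_orbits\<close> and
  \<open>join_orbits\<close>.\<close>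

lemma rot_transpose:
  assumes "p \<in> B" "q \<in> B"
  shows "num_orbits ((\<phi> \<circ> transpose p q) \<circ> \<alpha>) B = num_orbits ((\<phi> \<circ> \<alpha>) \<circ> transpose (\<alpha> p) (\<alpha> q)) B"
proof (rule finite_perm_cong(3))
  show "finite_perm (\<phi> \<circ> \<alpha> \<circ> transpose (\<alpha> p) (\<alpha> q)) B"
    using rot.finite_perm_transpose involution assms by blast
  fix e assume "e \<in> B"
  then have "\<alpha> (transpose (\<alpha> p) (\<alpha> q) e) = transpose p q (\<alpha> e)"
    using involution[of e] involution[OF assms(1)] involution[OF assms(2)]
    by (auto simp: transpose_def)
  then show "(\<phi> \<circ> \<alpha> \<circ> transpose (\<alpha> p) (\<alpha> q)) e = (\<phi> \<circ> transpose p q \<circ> \<alpha>) e" by simp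
qed

text \<open>Exchanging two successors can only link or unlink \<open>p\<close> and \<open>q\<close>,
  so the components agree once this pair is added. One inclusion yields the other, the exchange
  being an involution.\<close>

lemma links_transpose:
  assumes "p \<in> B" "q \<in> B"
  shows "eqv (insert (p, q) (links B \<alpha> (\<phi> \<circ> transpose p q))) = eqv (insert (p, q) L)"
proof -
  have half: "fgraph g B \<subseteq> eqv (insert (p, q) (links B \<alpha> (g \<circ> transpose p q)))" for g
  proof
    fix z assume "z \<in> fgraph g B"
    then obtain e where e: "e \<in> B" "z = (e, g e)" by (auto simp: fgraph_def)
    let ?r = "insert (p, q) (links B \<alpha> (g \<circ> transpose p q))"
    let ?t = "transpose p q e"
    have t: "?t \<in> B" using e assms by (auto simp: transpose_def)
    have "(?t, g (transpose p q ?t)) \<in> eqv ?r"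
      using t by (intro eqv_base) (auto simp: links_def fgraph_def)
    moreover have "(p, q) \<in> eqv ?r" by (simp add: eqv_base)
    then have "(e, ?t) \<in> eqv ?r" using eqv_sym[of p q ?r] by (auto simp: transpose_def)
    ultimately show "z \<in> eqv ?r" using e(2) eqv_trans[of e ?t ?r] by simp
  qed
  have 1: "insert (p, q) L \<subseteq> eqv (insert (p, q) (links B \<alpha> (\<phi> \<circ> transpose p q)))"
    using half[of \<phi>] by (auto simp: links_def intro: eqv_base)
  have "insert (p, q) (links B \<alpha> (\<phi> \<circ> transpose p q)) \<subseteq> eqv (insert (p, q) L)"
    using half[of "\<phi> \<circ> transpose p q"] by (auto simp: links_def comp_assoc intro: eqv_base)
  with 1 show ?thesis using eqv_subset by (metis subset_antisym)
qed

text \<open>The darts \<open>p\<close> and \<open>q\<close> end at the same vertex, and by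
  \<open>one_outer\<close> they lie on the same outer circuit. Exchanging their successors therefore
  splits both the vertex and the face, raising V + F by two with E fixed. The genus inequality then
  forces a new component, so \<open>p\<close> and \<open>q\<close> are separated, and the two halves
  of the circuit become the outer faces of different components.\<close>

lemma split_planar:
  assumes pq: "p \<in> X" "q \<in> X" "p \<noteq> q" and rot: "\<alpha> q \<in> orbit (\<phi> \<circ> \<alpha>) (\<alpha> p)"
  shows "q \<in> orbit \<phi> p" "planar_system (\<phi> \<circ> transpose p q) B \<alpha> X"
proof -
  let ?f = "\<phi> \<circ> transpose p q"
  let ?L = "links B \<alpha> ?f"
  have B: "p \<in> B" "q \<in> B" using pq outer_sub by auto
  have "(\<alpha> p, \<alpha> q) \<in> eqv L" using rot_linked[OF _ rot] involution B by blast
  then have rel: "(p, q) \<in> eqv L"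
    using eqv_trans[OF alpha_link[OF B(1)]] eqv_trans[OF _ eqv_sym[OF alpha_link[OF B(2)]]] by blast
  then show same: "q \<in> orbit \<phi> p" using one_outer pq by blast
  interpret f: finite_perm ?f B by (rule finite_perm_transpose[OF B])
  note s = split_orbits[OF B(1) same pq(3)]
  have "eqv (insert (p, q) L) = eqv L"
    using eqv_subset[of "insert (p, q) L" L] eqv_subset[of L "insert (p, q) L"] rel
      subset_eqv[of L] subset_eqv[of "insert (p, q) L"] by blast
  then have e: "eqv (insert (p, q) ?L) = eqv L" using links_transpose[OF B] by simp
  have "\<alpha> p \<noteq> \<alpha> q" using involution B pq(3) by metis
  then have r: "num_orbits (?f \<circ> \<alpha>) B = Suc (num_orbits (\<phi> \<circ> \<alpha>) B)"
    using rot.split_orbits(2)[OF _ rot] rot_transpose[OF B] involution B by simp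
  \<comment> \<open>With the number of components unchanged, two more orbits would violate
    \<open>genus_nonneg\<close>, as \<open>euler\<close> already attains the bound.\<close>
  have unrel: "(p, q) \<notin> eqv ?L"
  proof
    assume "(p, q) \<in> eqv ?L"
    from num_classes_insert_related[OF finite_carrier this] have "num_classes ?L B = num_classes L B"
      using e by (simp add: num_classes_def)
    with genus_nonneg(2)[OF f.finite_perm_axioms involution] euler r s(2) show False by simp
  qed
  have "num_classes L B = num_classes (insert (p, q) ?L) B" using e by (simp add: num_classes_def)
  with num_classes_insert_unrelated[OF finite_carrier B unrel] have n: "num_classes ?L B = Suc (num_classes L B)" by simp
  have sub: "eqv ?L \<subseteq> eqv L"
    using e eqv_subset[of ?L "insert (p, q) ?L"] subset_eqv[of "insert (p, q) ?L"] by blast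
  have fl: "(x, y) \<in> eqv ?L" if "x \<in> B" "y \<in> orbit ?f x" for x y
    by (rule f.orbit_eqv[OF that(1) _ that(2)]) (auto simp: links_def intro: eqv_base)
  show "planar_system ?f B \<alpha> X"
  proof unfold_locales
    show "e \<in> X \<Longrightarrow> ?f e \<in> X" for e using pq outer_closed by (auto simp: transpose_def)
    show "card B + 4 * num_classes ?L B \<le> 2 * (num_orbits (?f \<circ> \<alpha>) B + num_orbits ?f B)"
      using euler n r s(2) by simp
    fix a b assume ab: "a \<in> X" "b \<in> X" "(a, b) \<in> eqv ?L"
    then have b: "b \<in> orbit \<phi> a" using sub one_outer by blast
    have aB: "a \<in> B" "b \<in> B" using ab outer_sub by auto
    show "b \<in> orbit ?f a"
    proof (cases "a \<in> orbit \<phi> p")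
      case False
      then have "p \<notin> orbit \<phi> a" "q \<notin> orbit \<phi> a"
        using orbit_eq[of a p] orbit_eq[of a q] orbit_eq[of p q] same self_orbit aB B by auto
      then show ?thesis using transpose_other(1)[OF aB(1)] b by simp
    next
      case True
      then have "b \<in> orbit \<phi> p" using b orbit_eq[of p a] B by auto
      then have "(a \<in> orbit ?f p \<or> a \<in> orbit ?f q) \<and> (b \<in> orbit ?f p \<or> b \<in> orbit ?f q)"
        using True s(3) by blast
      moreover have False if "x \<in> orbit ?f p" "y \<in> orbit ?f q" "(x, y) \<in> eqv ?L" for x y
        using unrel eqv_trans[OF fl[OF B(1) that(1)] eqv_trans[OF that(3) eqv_sym[OF fl[OF B(2) that(2)]]]]
        by simp
      ultimately show ?thesis
        using f.orbit_eq[of p a] f.orbit_eq[of q a] B ab(3) eqv_sym[OF ab(3)] by blast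
    qed
  qed (use involution outer_sub in auto)
qed

text \<open>The face of \<open>p\<close> is opened to the outside at the corner after
  \<open>p\<close>. The two faces become one, while the edge of \<open>o'\<close> turns into a spike
  with a free end, which is a new vertex; so V - E + F stays the same. The component stays
  connected, since \<open>p\<close> and \<open>o'\<close> are linked before and after.\<close>

lemma merge_planar:
  assumes p: "p \<in> B" "p \<notin> X" and o: "o' \<in> X" and po: "\<phi> p = \<alpha> o'"
  shows "o' \<notin> orbit \<phi> p" "planar_system (\<phi> \<circ> transpose p o') B \<alpha> (X \<union> orbit \<phi> p)"
proof -
  let ?f = "\<phi> \<circ> transpose p o'"
  let ?L = "links B \<alpha> ?f"
  have B: "p \<in> B" "o' \<in> B" using p o outer_sub by auto
  have "p \<in> X" if "o' \<in> orbit \<phi> p"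
    using orbit_outer[OF o] orbit_eq[OF B(1) that] self_orbit[OF B(1)] by auto
  then show diff: "o' \<notin> orbit \<phi> p" using p by blast
  interpret f: finite_perm ?f B by (rule finite_perm_transpose[OF B])
  note j = join_orbits[OF B diff]
  have rel: "(p, o') \<in> eqv L"
    using eqv_trans[OF phi_link[OF B(1)]] po eqv_sym[OF alpha_link[OF B(2)]] by simp
  have fl: "(x, y) \<in> eqv ?L" if "x \<in> B" "y \<in> orbit ?f x" for x y
    by (rule f.orbit_eqv[OF that(1) _ that(2)]) (auto simp: links_def intro: eqv_base)
  have "o' \<in> orbit ?f p" using j(1) self_orbit[OF B(2)] by blast
  then have rel': "(p, o') \<in> eqv ?L" using fl[OF B(1)] by blast
  have ins: "eqv (insert (p, o') r) = eqv r" if "(p, o') \<in> eqv r" for r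
    using eqv_subset[of "insert (p, o') r" r] eqv_subset[of r "insert (p, o') r"] that
      subset_eqv[of r] subset_eqv[of "insert (p, o') r"] by blast
  have e: "eqv ?L = eqv L" using links_transpose[OF B] ins[OF rel] ins[OF rel'] by simp
  have "\<alpha> p \<noteq> \<alpha> o'" using involution B p o by metis
  moreover have "\<alpha> o' \<in> orbit (\<phi> \<circ> \<alpha>) (\<alpha> p)"
    using orbit.base[of "\<phi> \<circ> \<alpha>" "\<alpha> p"] involution[OF B(1)] po by simp
  ultimately have r: "num_orbits (?f \<circ> \<alpha>) B = Suc (num_orbits (\<phi> \<circ> \<alpha>) B)"
    using rot.split_orbits(2)[of "\<alpha> p" "\<alpha> o'"] rot_transpose[OF B] involution B by simp
  show "planar_system ?f B \<alpha> (X \<union> orbit \<phi> p)"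
  proof unfold_locales
    show "X \<union> orbit \<phi> p \<subseteq> B" using outer_sub orbit_sub B by blast
    show "e \<in> X \<union> orbit \<phi> p \<Longrightarrow> ?f e \<in> X \<union> orbit \<phi> p" for e
      using o outer_closed[of e] outer_closed[OF o] orbit.base[of \<phi> p] orbit.step[of e \<phi> p]
      by (auto simp: transpose_def)
    show "card B + 4 * num_classes ?L B \<le> 2 * (num_orbits (?f \<circ> \<alpha>) B + num_orbits ?f B)"
      using euler r j(2) e by (simp add: num_classes_def)
    have in_p: "x \<in> orbit ?f p" if "x \<in> X \<union> orbit \<phi> p" "(p, x) \<in> eqv L" for x
    proof (cases "x \<in> orbit \<phi> p")
      case False
      then have "x \<in> orbit \<phi> o'"
        using that one_outer[OF o, of x] eqv_trans[OF eqv_sym[OF rel]] by blast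
      then show ?thesis using j(1) by blast
    qed (use j(1) in blast)
    fix a b assume ab: "a \<in> X \<union> orbit \<phi> p" "b \<in> X \<union> orbit \<phi> p" "(a, b) \<in> eqv ?L"
    then have abL: "(a, b) \<in> eqv L" using e by simp
    have aB: "a \<in> B" using ab outer_sub orbit_sub B by blast
    show "b \<in> orbit ?f a"
    proof (cases "(p, a) \<in> eqv L")
      case True
      then have "(p, b) \<in> eqv L" using eqv_trans abL by metis
      then show ?thesis using in_p[OF ab(1) True] in_p[OF ab(2)] f.orbit_eq[OF B(1)] by blast
    next
      case False
      then have "a \<in> X" using ab(1) orbit_linked[OF B(1)] by blast
      moreover have "(p, b) \<notin> eqv L" using False eqv_trans[OF _ eqv_sym[OF abL]] by metis
      then have "b \<in> X" using ab(2) orbit_linked[OF B(1)] by blast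
      ultimately have "b \<in> orbit \<phi> a" using one_outer abL by blast
      moreover have "p \<notin> orbit \<phi> a" "o' \<notin> orbit \<phi> a"
        using False orbit_linked[OF aB] eqv_sym[of a _ L] eqv_trans[OF rel, of a] by metis+
      ultimately show ?thesis using transpose_other(1)[OF aB] by simp
    qed
  qed (use involution in auto)
qed

text \<open>An invariant finite set has an invariant complement, and darts, orbits and components
  are counted additively over the two. The genus inequality bounds the share of the complement, so
  the Euler condition passes to \<open>S\<close>.\<close>

lemma restrict_planar:
  assumes S: "S \<subseteq> B" "\<And>e. e \<in> S \<Longrightarrow> \<alpha> e \<in> S" "\<And>e. e \<in> S \<Longrightarrow> \<phi> e \<in> S"
  shows "planar_system \<phi> S \<alpha> (X \<inter> S)"
proof -
  let ?T = "B - S"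
  have fin: "finite S" "finite ?T" using S finite_carrier finite_subset by auto
  have inj: "inj_on \<phi> B" using bij by (simp add: bij_betw_def)
  have surjS: "\<phi> ` S = S"
    by (rule endo_inj_surj[OF fin(1) _ inj_on_subset[OF inj S(1)]]) (use S(3) in blast)
  have T: "\<phi> e \<in> ?T" "\<alpha> e \<in> ?T" if "e \<in> ?T" for e
  proof -
    show "\<phi> e \<in> ?T" using that closed[of e] surjS S(1) inj by (auto dest: inj_onD)
    show "\<alpha> e \<in> ?T" using that S(2)[of "\<alpha> e"] involution[of e] by auto
  qed
  have surjT: "\<phi> ` ?T = ?T"
    by (rule endo_inj_surj[OF fin(2) _ inj_on_subset[OF inj]]) (use T(1) in blast)+
  interpret s: finite_perm \<phi> S
    using fin surjS inj_on_subset[OF inj S(1)] by unfold_locales (auto simp: bij_betw_def)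
  interpret t: finite_perm \<phi> ?T
    using fin surjT inj_on_subset[OF inj, of ?T] by unfold_locales (auto simp: bij_betw_def)
  have invS: "\<alpha> e \<in> S \<and> \<alpha> e \<noteq> e \<and> \<alpha> (\<alpha> e) = e" if "e \<in> S" for e using that S involution by auto
  have invT: "\<alpha> e \<in> ?T \<and> \<alpha> e \<noteq> e \<and> \<alpha> (\<alpha> e) = e" if "e \<in> ?T" for e using that T involution by auto
  have part: "num_orbits f B = num_orbits f S + num_orbits f ?T" if "finite_perm f S" "finite_perm f ?T" for f :: "'a \<Rightarrow> 'a"
    using num_orbits_Un[OF that] S(1) by (simp add: Un_absorb1)
  note gs = genus_nonneg[OF s.finite_perm_axioms invS]
  note gt = genus_nonneg[OF t.finite_perm_axioms invT]
  have stay: "(x, y) \<in> eqv (links M \<alpha> \<phi>) \<and> y \<in> M"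
    if "x \<in> M" "(x, y) \<in> eqv L" "M = S \<or> M = ?T" for x y M
    using that(2)[unfolded eqv_def]
  proof (induction rule: rtrancl_induct)
    case base
    then show ?case using that(1) by simp
  next
    case (step y z)
    have M: "e \<in> M \<Longrightarrow> \<phi> e \<in> M \<and> \<alpha> e \<in> M" "e \<in> B \<Longrightarrow> \<phi> e \<in> M \<or> \<alpha> e \<in> M \<Longrightarrow> e \<in> M" for e
      using that(3) S(2,3)[of e] T[of e] by blast+
    from step(2) obtain e where e: "e \<in> B" "y = e \<and> (z = \<phi> e \<or> z = \<alpha> e) \<or> z = e \<and> (y = \<phi> e \<or> y = \<alpha> e)"
      by (auto simp: links_def fgraph_def)
    then have "e \<in> M" using M(2)[of e] step.IH by blast
    with M(1) e(2) have "z \<in> M" by blast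
    moreover have "(e, \<phi> e) \<in> links M \<alpha> \<phi>" "(e, \<alpha> e) \<in> links M \<alpha> \<phi>"
      using \<open>e \<in> M\<close> by (auto simp: links_def fgraph_def)
    ultimately have "z \<in> M \<and> ((y, z) \<in> links M \<alpha> \<phi> \<or> (z, y) \<in> links M \<alpha> \<phi>)"
      using e(2) by blast
    then have "z \<in> M" "(y, z) \<in> eqv (links M \<alpha> \<phi>)"
      using eqv_base[of y z "links M \<alpha> \<phi>"] eqv_sym[OF eqv_base, of z y "links M \<alpha> \<phi>"] by auto
    then show ?case using step.IH eqv_trans[of x y _ z] by simp
  qed
  have sub: "eqv (links M \<alpha> \<phi>) \<subseteq> eqv L" if "M \<subseteq> B" for M
    using that by (intro eqv_subset) (auto simp: links_def fgraph_def intro!: eqv_base)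
  have cls: "eqv L `` {e} = eqv (links M \<alpha> \<phi>) `` {e}" if "e \<in> M" "M = S \<or> M = ?T" for e M
    using stay[OF that(1) _ that(2)] sub[of M] that(2) S(1) by blast
  have "(\<lambda>e. eqv L `` {e}) ` B = (\<lambda>e. eqv L `` {e}) ` S \<union> (\<lambda>e. eqv L `` {e}) ` ?T"
    using S(1) by blast
  moreover have "(\<lambda>e. eqv L `` {e}) ` S \<inter> (\<lambda>e. eqv L `` {e}) ` ?T = {}"
  proof -
    have False if "x \<in> S" "y \<in> ?T" "eqv L `` {x} = eqv L `` {y}" for x y
      using stay[of x S y] that eqv_class_eq[of L x y] by blast
    then show ?thesis by blast
  qed
  ultimately have "num_classes L B = num_classes (links S \<alpha> \<phi>) S + num_classes (links ?T \<alpha> \<phi>) ?T"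
    unfolding num_classes_def using fin cls[of _ S] cls[of _ ?T] by (simp add: card_Un_disjoint)
  moreover have "card B = card S + card ?T"
    using card_Diff_subset[OF fin(1) S(1)] card_mono[OF finite_carrier S(1)] by simp
  ultimately have "card S + 4 * num_classes (links S \<alpha> \<phi>) S \<le> 2 * (num_orbits (\<phi> \<circ> \<alpha>) S + num_orbits \<phi> S)"
    using euler gt(2) part[OF s.finite_perm_axioms t.finite_perm_axioms] part[OF gs(1) gt(1)] by simp
  then show ?thesis
  proof unfold_locales
    show "a \<in> X \<inter> S \<Longrightarrow> b \<in> X \<inter> S \<Longrightarrow> (a, b) \<in> eqv (links S \<alpha> \<phi>) \<Longrightarrow> b \<in> orbit \<phi> a" for a b
      using sub[OF S(1)] one_outer by blast
  qed (use invS outer_closed S(3) in auto)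
qed

end

text \<open>\<open>\<kappa>\<close> is to be thought of as a colour of the origin of a dart. The
  last condition says that it is constant around every vertex of the cut system; corners where it
  changes are outer and are removed by cuts. \<open>P\<close> carries along whatever cuts preserve,
  such as a lower bound on the cost.\<close>

lemma colour_split:
  assumes "planar_system \<phi> B \<alpha> X" "P \<phi>"
    and "\<And>e. e \<in> B - X \<Longrightarrow> \<kappa> (\<phi> e) = \<kappa> (\<alpha> e)"
    and P: "\<And>\<psi> p q. planar_system \<psi> B \<alpha> X \<Longrightarrow> P \<psi> \<Longrightarrow> p \<in> X \<Longrightarrow> q \<in> X \<Longrightarrow> p \<noteq> q \<Longrightarrow>
      q \<in> orbit \<psi> p \<Longrightarrow> P (\<psi> \<circ> transpose p q)"
  shows "\<exists>\<psi>. planar_system \<psi> B \<alpha> X \<and> P \<psi> \<and> (\<forall>e\<in>B - X. \<psi> e = \<phi> e) \<and> (\<forall>e\<in>B. \<kappa> (\<psi> e) = \<kappa> (\<alpha> e))"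
  using assms(1-3)
proof (induction "card {e \<in> X. \<kappa> (\<phi> e) \<noteq> \<kappa> (\<alpha> e)}" arbitrary: \<phi> rule: less_induct)
  case less
  interpret planar_system \<phi> B \<alpha> X by (rule less.prems(1))
  let ?bad = "\<lambda>\<phi>. {e \<in> X. \<kappa> (\<phi> e) \<noteq> \<kappa> (\<alpha> e)}"
  show ?case
  proof (cases "?bad \<phi> = {}")
    case True
    then have "\<forall>e\<in>B. \<kappa> (\<phi> e) = \<kappa> (\<alpha> e)" using less.prems(3) by blast
    then show ?thesis using less.prems by blast
  next
    case False
    then obtain p where p: "p \<in> X" "\<kappa> (\<phi> p) \<noteq> \<kappa> (\<alpha> p)" by blast
    then have pB: "p \<in> B" "\<alpha> p \<in> B" using outer_sub involution by auto
    let ?rot = "\<phi> \<circ> \<alpha>"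
    have rp: "?rot (\<alpha> p) = \<phi> p" using involution pB by simp
    \<comment> \<open>The rotation leaves the colour of \<open>\<alpha> p\<close> right after
      \<open>\<alpha> p\<close>. Going once around the vertex it must come back to that colour, and
      \<open>e\<close> is the last dart before such a return.\<close>
    have "\<exists>e\<in>orbit ?rot (\<alpha> p). \<kappa> e \<noteq> \<kappa> (\<alpha> p) \<and> \<kappa> (?rot e) = \<kappa> (\<alpha> p)"
    proof (rule ccontr)
      assume *: "\<not> ?thesis"
      have "\<kappa> e \<noteq> \<kappa> (\<alpha> p)" if "e \<in> orbit ?rot (\<alpha> p)" for e
        using that
      proof induction
        case base
        then show ?case using p rp by metis
      next
        case (step e)
        then show ?case using * by blast
      qed
      then show False using rot.self_orbit[OF pB(2)] by blast
    qed
    then obtain e where e: "e \<in> orbit ?rot (\<alpha> p)" "\<kappa> e \<noteq> \<kappa> (\<alpha> p)" "\<kappa> (\<phi> (\<alpha> e)) = \<kappa> (\<alpha> p)" by auto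
    define q where "q = \<alpha> e"
    have eB: "e \<in> B" using e(1) rot.orbit_sub pB by blast
    then have q: "q \<in> B" "\<alpha> q = e" using involution by (auto simp: q_def)
    have qX: "q \<in> X" using less.prems(3)[of q] e q by (auto simp: q_def)
    have ne: "p \<noteq> q" using e q by auto
    note s = split_planar[OF p(1) qX ne]
    let ?f = "\<phi> \<circ> transpose p q"
    have pl: "planar_system ?f B \<alpha> X" "q \<in> orbit \<phi> p" using s e(1) q by auto
    have out: "?f x = \<phi> x" if "x \<in> B - X" for x using that p(1) qX by (auto simp: transpose_def)
    \<comment> \<open>After the exchange \<open>p\<close> has a successor of the right colour, while
      \<open>q\<close> was bad already: \<open>\<phi> q\<close> has the colour of
      \<open>\<alpha> p\<close>, and \<open>\<alpha> q = e\<close> has not.\<close>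
    have "?bad ?f \<subseteq> ?bad \<phi> - {p}" using e q by (auto simp: transpose_def q_def split: if_splits)
    moreover have "finite (?bad \<phi>)" using finite_subset[OF outer_sub finite_carrier] by simp
    moreover have "p \<in> ?bad \<phi>" using p by blast
    ultimately have "card (?bad ?f) < card (?bad \<phi>)"
      by (metis (no_types, lifting) card_Diff1_less card_mono finite_Diff le_less_trans)
    then have "\<exists>\<psi>. planar_system \<psi> B \<alpha> X \<and> P \<psi> \<and> (\<forall>e\<in>B - X. \<psi> e = ?f e) \<and> (\<forall>e\<in>B. \<kappa> (\<psi> e) = \<kappa> (\<alpha> e))"
    proof (rule less.hyps)
      show "P ?f" by (rule P[OF less.prems(1,2) p(1) qX ne pl(2)])
      show "\<kappa> (?f x) = \<kappa> (\<alpha> x)" if "x \<in> B - X" for x using less.prems(3)[OF that] out[OF that] by simp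
    qed (rule pl)
    then show ?thesis using out by auto
  qed
qed

text \<open>The circuit turns back along the edge right after \<open>x\<close>, so this end of the
  edge is free in the cut system. A single cut at the other end, between \<open>\<alpha> x\<close>
  and the predecessor of \<open>x\<close>, makes the edge a component of its own.\<close>

lemma isolate_edge:
  assumes "planar_system \<phi> B \<alpha> X" "P \<phi>" "x \<in> X" "\<phi> x = \<alpha> x"
    and P: "\<And>\<psi> p q. planar_system \<psi> B \<alpha> X \<Longrightarrow> P \<psi> \<Longrightarrow> p \<in> X \<Longrightarrow> q \<in> X \<Longrightarrow> p \<noteq> q \<Longrightarrow>
      q \<in> orbit \<psi> p \<Longrightarrow> P (\<psi> \<circ> transpose p q)"
  shows "\<exists>\<psi>. planar_system \<psi> B \<alpha> X \<and> P \<psi> \<and> (\<forall>e\<in>B - X. \<psi> e = \<phi> e) \<and> \<psi> x = \<alpha> x \<and> \<psi> (\<alpha> x) = x"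
proof (cases "\<phi> (\<alpha> x) = x")
  case True
  then show ?thesis using assms by blast
next
  case False
  interpret planar_system \<phi> B \<alpha> X by fact
  have xB: "x \<in> B" "\<alpha> x \<in> B" using assms(3) outer_sub involution by auto
  have aX: "\<alpha> x \<in> X" using outer_closed[OF assms(3)] assms(4) by simp
  have "x \<in> \<phi> ` B" using bij xB(1) by (simp add: bij_betw_def)
  then obtain q where q: "q \<in> B" "\<phi> q = x" by blast
  then have qX: "q \<in> X" using outer_iff[of q] assms(3) by simp
  have ne: "q \<noteq> \<alpha> x" "q \<noteq> x" using q False assms(4) involution[OF xB(1)] by auto
  have "\<alpha> (\<alpha> x) \<in> orbit (\<phi> \<circ> \<alpha>) (\<alpha> q)"
    using orbit.base[of "\<phi> \<circ> \<alpha>" "\<alpha> q"] involution[OF q(1)] involution[OF xB(1)] q(2) by simp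
  from split_planar[OF qX aX ne(1) this] P[OF assms(1,2) qX aX ne(1)]
  have "planar_system (\<phi> \<circ> transpose q (\<alpha> x)) B \<alpha> X" "P (\<phi> \<circ> transpose q (\<alpha> x))" by auto
  moreover have "x \<noteq> \<alpha> x" using involution[OF xB(1)] by metis
  ultimately show ?thesis
    using q assms(4) ne(2) qX aX by (intro exI[of _ "\<phi> \<circ> transpose q (\<alpha> x)"]) (auto simp: transpose_def)
qed

section \<open>Slitting a planar system open along an edge\<close>

context planar_system
begin

text \<open>Slitting the edge of \<open>d\<close> from the outer corner after \<open>q\<close> gives
  one vertex and one edge more and the same number of faces. Instead of computing the new orbits,
  the proof reaches the new permutations from simpler ones by transpositions, whose effect on the
  counts is known.\<close>

lemma expand_planar:
  assumes q: "q \<in> X" and d: "d \<in> B" and qd: "\<phi> q \<in> orbit (\<phi> \<circ> \<alpha>) d"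
    and xy: "x \<notin> B" "y \<notin> B" "x \<noteq> y"
  defines "\<phi>' \<equiv> \<phi>(q := x, x := y, y := \<phi> q)"
    and "\<alpha>' \<equiv> \<alpha>(d := y, y := d, \<alpha> d := x, x := \<alpha> d)"
  shows "planar_system \<phi>' (B \<union> {x, y}) \<alpha>' (X \<union> {x, y})"
    "orbit \<phi>' q = orbit \<phi> q \<union> {x, y}"
    "e \<in> B \<Longrightarrow> q \<notin> orbit \<phi> e \<Longrightarrow> orbit \<phi>' e = orbit \<phi> e \<and> cycle_from \<phi>' e = cycle_from \<phi> e"
proof -
  let ?B = "B \<union> {x, y}"
  \<comment> \<open>The starting point is the disjoint union with a sphere that carries the single
    edge \<open>{x, y}\<close>; it has two vertices and one face.\<close>
  define \<phi>0 where "\<phi>0 = \<phi>(x := y, y := x)"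
  define \<alpha>0 where "\<alpha>0 = \<alpha>(x := y, y := x)"
  have qB: "q \<in> B" using q outer_sub by auto
  have ad: "\<alpha> d \<in> B" "\<alpha> d \<noteq> d" "\<alpha> (\<alpha> d) = d" and aq: "\<alpha> q \<in> B" "\<alpha> q \<noteq> q" "\<alpha> (\<alpha> q) = q"
    using involution d qB by auto
  have eq0: "\<phi> e = \<phi>0 e" "(\<phi> \<circ> \<alpha>) e = (\<phi>0 \<circ> \<alpha>0) e" if "e \<in> B" for e
    using that xy involution[OF that] by (auto simp: \<phi>0_def \<alpha>0_def)
  have c0: "finite_perm \<phi>0 B" "\<And>e. e \<in> B \<Longrightarrow> orbit \<phi>0 e = orbit \<phi> e" "num_orbits \<phi>0 B = num_orbits \<phi> B"
    "\<And>e. e \<in> B \<Longrightarrow> cycle_from \<phi>0 e = cycle_from \<phi> e"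
    using finite_perm_cong[of \<phi> B \<phi>0, OF finite_perm_axioms] eq0(1) by blast+
  have cr: "finite_perm (\<phi>0 \<circ> \<alpha>0) B"
    "\<And>e. e \<in> B \<Longrightarrow> orbit (\<phi>0 \<circ> \<alpha>0) e = orbit (\<phi> \<circ> \<alpha>) e"
    "num_orbits (\<phi>0 \<circ> \<alpha>0) B = num_orbits (\<phi> \<circ> \<alpha>) B"
    using finite_perm_cong[of "\<phi> \<circ> \<alpha>" B "\<phi>0 \<circ> \<alpha>0", OF rot.finite_perm_axioms] eq0(2) by blast+
  have fxy: "finite_perm \<phi>0 {x, y}" "finite_perm (\<phi>0 \<circ> \<alpha>0) {x, y}"
    using xy by (auto simp: finite_perm_def \<phi>0_def \<alpha>0_def bij_betw_def inj_on_def)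
  have fp0: "finite_perm \<phi>0 ?B"
    using c0(1) fxy(1) xy bij_betw_combine[of \<phi>0 B B "{x, y}" "{x, y}"] by (simp add: finite_perm_def)
  have inv0: "\<alpha>0 e \<in> ?B \<and> \<alpha>0 e \<noteq> e \<and> \<alpha>0 (\<alpha>0 e) = e" if "e \<in> ?B" for e
  proof (cases "e \<in> {x, y}")
    case True
    then show ?thesis using xy by (auto simp: \<alpha>0_def)
  next
    case False
    then have e: "e \<in> B" using that by auto
    then have "\<alpha> e \<noteq> x" "\<alpha> e \<noteq> y" using involution[OF e] xy by metis+
    then show ?thesis using False involution[OF e] by (simp add: \<alpha>0_def)
  qed
  have ne: "x \<noteq> d" "y \<noteq> d" "x \<noteq> \<alpha> d" "y \<noteq> \<alpha> d" using xy d ad(1) by metis+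
  have v: "\<alpha>' x = \<alpha> d" "\<alpha>' y = d" "\<alpha>' d = y" "\<alpha>' (\<alpha> d) = x"
    using ne ne[symmetric] xy(3) ad(2) by (simp_all add: \<alpha>'_def)
  have inv': "\<alpha>' e \<in> ?B \<and> \<alpha>' e \<noteq> e \<and> \<alpha>' (\<alpha>' e) = e" if "e \<in> ?B" for e
  proof (cases "e \<in> {d, \<alpha> d, x, y}")
    case True
    then show ?thesis using d ad(1,2) ne v by auto
  next
    case False
    then have e: "e \<in> B" using that by auto
    then have "\<alpha> e \<noteq> d" "\<alpha> e \<noteq> \<alpha> d" "\<alpha> e \<noteq> x" "\<alpha> e \<noteq> y"
      using False involution[OF e] involution[OF d] xy by (metis insertCI)+
    then show ?thesis using e involution[OF e] False by (simp add: \<alpha>'_def)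
  qed
  interpret f0: finite_perm \<phi>0 ?B by (rule fp0)
  interpret r0: finite_perm "\<phi>0 \<circ> \<alpha>0" ?B by (rule genus_nonneg(1)[OF fp0 inv0])
  have disj: "B \<inter> {x, y} = {}" using xy by auto
  have "is_cycle \<phi>0 [x, y]" using xy by (auto simp: is_cycle_def \<phi>0_def)
  note cxy = orbit_cycle[OF this]
  have "num_orbits \<phi>0 {x, y} = 1" using cxy by (simp add: num_orbits_def)
  then have n0: "num_orbits \<phi>0 ?B = num_orbits \<phi> B + 1" using num_orbits_Un[OF c0(1) fxy(1) disj] c0(3) by simp
  have rxy: "orbit (\<phi>0 \<circ> \<alpha>0) x = {x}" "orbit (\<phi>0 \<circ> \<alpha>0) y = {y}"
    using xy by (auto simp: orbit_eq_singleton_iff \<phi>0_def \<alpha>0_def)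
  then have "num_orbits (\<phi>0 \<circ> \<alpha>0) {x, y} = 2" using xy by (simp add: num_orbits_def)
  then have nr0: "num_orbits (\<phi>0 \<circ> \<alpha>0) ?B = num_orbits (\<phi> \<circ> \<alpha>) B + 2"
    using num_orbits_Un[OF cr(1) fxy(2) disj] cr(3) by simp

  have phi': "\<phi>' = \<phi>0 \<circ> transpose q y"
    using xy qB by (auto simp: \<phi>'_def \<phi>0_def transpose_def fun_eq_iff)
  have y_q: "y \<notin> orbit \<phi>0 q" using c0(2)[OF qB] orbit_sub[OF qB] xy by auto
  have fp': "finite_perm \<phi>' ?B" unfolding phi' by (rule f0.finite_perm_transpose) (use qB in auto)
  have n': "num_orbits \<phi>' ?B = num_orbits \<phi> B"
    using f0.join_orbits(2)[of q y] y_q qB n0 unfolding phi' by simp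
  show oq: "orbit \<phi>' q = orbit \<phi> q \<union> {x, y}"
    using f0.join_orbits(1)[of q y] y_q qB cxy c0(2)[OF qB] unfolding phi' by auto
  show oe: "orbit \<phi>' e = orbit \<phi> e \<and> cycle_from \<phi>' e = cycle_from \<phi> e" if "e \<in> B" "q \<notin> orbit \<phi> e" for e
    using f0.transpose_other[of e q y] that c0(2,4)[OF that(1)] orbit_sub[OF that(1)] xy
    unfolding phi' by auto

  \<comment> \<open>On vertices three transpositions are needed: \<open>x\<close> joins the rotation
    at the corner of \<open>q\<close>, the resulting vertex splits between \<open>d\<close> and
    \<open>x\<close>, and \<open>y\<close> joins the far end of the edge. Of the two additional
    vertices one remains.\<close>
  let ?r1 = "(\<phi>0 \<circ> \<alpha>0) \<circ> transpose (\<alpha> q) x"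
  let ?r2 = "?r1 \<circ> transpose d x"
  let ?r3 = "?r2 \<circ> transpose y (\<alpha> d)"
  interpret r1: finite_perm ?r1 ?B by (rule r0.finite_perm_transpose) (use aq in auto)
  interpret r2: finite_perm ?r2 ?B by (rule r1.finite_perm_transpose) (use d in auto)
  have "x \<notin> orbit (\<phi>0 \<circ> \<alpha>0) (\<alpha> q)" using cr(2)[OF aq(1)] rot.orbit_sub[OF aq(1)] xy by auto
  note j1 = r0.join_orbits[OF _ _ this]
  have "d \<in> orbit (\<phi> \<circ> \<alpha>) (\<alpha> q)"
    using rot.orbit_eq[OF d qd] rot.orbit_eq[OF aq(1), of "\<phi> q"] aq orbit.base[of "\<phi> \<circ> \<alpha>" "\<alpha> q"]
      rot.self_orbit[OF d] by simp
  then have "d \<in> orbit ?r1 (\<alpha> q)" "x \<in> orbit ?r1 (\<alpha> q)" using j1(1) cr(2)[OF aq(1)] aq(1) rxy by auto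
  then have "x \<in> orbit ?r1 d" using r1.orbit_eq[of "\<alpha> q" d] aq(1) by auto
  then have n2: "num_orbits ?r2 ?B = num_orbits (\<phi>0 \<circ> \<alpha>0) ?B"
    using r1.split_orbits(2)[of d x] j1(2) aq(1) d xy by auto
  have "?r2 y = y" using xy d aq by (auto simp: transpose_def \<phi>0_def \<alpha>0_def)
  then have "\<alpha> d \<notin> orbit ?r2 y" using orbit_eq_singleton_iff[of ?r2 y] ad xy by auto
  then have n3: "num_orbits ?r2 ?B = Suc (num_orbits ?r3 ?B)" using r2.join_orbits(2)[of y "\<alpha> d"] ad by simp
  have eq3: "?r3 e = (\<phi>' \<circ> \<alpha>') e" if "e \<in> ?B" for e
  proof -
    have neq: "x \<noteq> q" "y \<noteq> q" "x \<noteq> \<alpha> q" "y \<noteq> \<alpha> q" using xy qB aq(1) by metis+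
    note F = ne ne[symmetric] neq neq[symmetric] xy(3) xy(3)[symmetric] ad(2,3) ad(2)[symmetric]
      aq(2,3) aq(2)[symmetric]
    note D = transpose_def \<phi>0_def \<alpha>0_def \<phi>'_def \<alpha>'_def
    consider "e = d" | "e = \<alpha> d" | "e = x" | "e = y" | "e \<in> B" "e \<noteq> d" "e \<noteq> \<alpha> d" using \<open>e \<in> ?B\<close> by blast
    then show ?thesis
    proof cases
      case 1
      then show ?thesis using F by (simp add: D)
    next
      case 2
      then show ?thesis using F by (simp add: D)
    next
      case 3
      show ?thesis
      proof (cases "d = \<alpha> q")
        case True
        then have "\<alpha> d = q" using aq by simp
        then show ?thesis using 3 F True by (simp add: D)
      next
        case False
        then have "\<alpha> d \<noteq> q" using ad by metis
        then show ?thesis using 3 F False by (simp add: D)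
      qed
    next
      case 4
      show ?thesis
      proof (cases "d = q")
        case False
        then have "\<alpha> d \<noteq> \<alpha> q" using ad aq by metis
        then show ?thesis using 4 F False by (simp add: D)
      qed (use 4 F in \<open>simp add: D\<close>)
    next
      case 5
      have e: "\<alpha> e \<in> B" "\<alpha> (\<alpha> e) = e" using involution[OF 5(1)] by auto
      have exy: "e \<noteq> x" "e \<noteq> y" "\<alpha> e \<noteq> x" "\<alpha> e \<noteq> y" using 5(1) e(1) xy by metis+
      show ?thesis
      proof (cases "e = \<alpha> q")
        case True
        then show ?thesis using 5 F exy by (simp add: D)
      next
        case False
        then have "\<alpha> e \<noteq> q" using e(2) by metis
        then show ?thesis using 5 F exy False by (simp add: D)
      qed
    qed
  qed
  have "finite_perm ?r3 ?B" by (rule r2.finite_perm_transpose) (use ad in auto)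
  from finite_perm_cong(3)[of ?r3 ?B "\<phi>' \<circ> \<alpha>'", OF this eq3]
  have nr': "num_orbits (\<phi>' \<circ> \<alpha>') ?B = num_orbits (\<phi> \<circ> \<alpha>) B + 1" using n2 n3 nr0 by simp

  let ?L = "links ?B \<alpha>' \<phi>'"
  have pl: "(e, \<phi>' e) \<in> eqv ?L" "(e, \<alpha>' e) \<in> eqv ?L" if "e \<in> ?B" for e
    using that by (auto simp: links_def fgraph_def intro!: eqv_base)
  have qx: "(q, x) \<in> eqv ?L" and xy': "(x, y) \<in> eqv ?L" and yq: "(y, \<phi> q) \<in> eqv ?L"
    and dy: "(d, y) \<in> eqv ?L" and ax: "(\<alpha> d, x) \<in> eqv ?L"
    using pl(1)[of q] pl(1)[of x] pl(1)[of y] pl(2)[of d] pl(2)[of "\<alpha> d"] qB d ad xy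
    by (auto simp: \<phi>'_def \<alpha>'_def split: if_splits)
  have dad: "(d, \<alpha> d) \<in> eqv ?L"
    using eqv_trans[OF dy eqv_trans[OF eqv_sym[OF xy'] eqv_sym[OF ax]]] .
  have "L \<subseteq> eqv ?L"
  proof
    fix z assume "z \<in> L"
    then obtain e where e: "e \<in> B" "z = (e, \<alpha> e) \<or> z = (e, \<phi> e)" by (auto simp: links_def fgraph_def)
    have "(e, \<alpha> e) \<in> eqv ?L"
    proof (cases "e = d \<or> e = \<alpha> d")
      case True
      then show ?thesis using dad eqv_sym[OF dad] ad by auto
    next
      case False
      moreover have "e \<noteq> x" "e \<noteq> y" using e(1) xy by auto
      ultimately have "\<alpha>' e = \<alpha> e" by (simp add: \<alpha>'_def)
      then show ?thesis using pl(2)[of e] e(1) by simp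
    qed
    moreover have "(e, \<phi> e) \<in> eqv ?L"
    proof (cases "e = q")
      case True
      then show ?thesis using eqv_trans[OF qx eqv_trans[OF xy' yq]] by simp
    next
      case False
      moreover have "e \<noteq> x" "e \<noteq> y" using e(1) xy by auto
      ultimately have "\<phi>' e = \<phi> e" by (simp add: \<phi>'_def)
      then show ?thesis using pl(1)[of e] e(1) by simp
    qed
    ultimately show "z \<in> eqv ?L" using e by auto
  qed
  then have sub: "eqv L \<subseteq> eqv ?L" by (rule eqv_subset)
  have "eqv ?L `` {x} = eqv ?L `` {q}" "eqv ?L `` {y} = eqv ?L `` {q}"
    unfolding eqv_class_eq using eqv_sym[OF qx] eqv_sym[OF eqv_trans[OF qx xy']] .
  then have "(\<lambda>e. eqv ?L `` {e}) ` ?B = (\<lambda>e. eqv ?L `` {e}) ` B" using qB by auto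
  then have num_classes': "num_classes ?L ?B \<le> num_classes L B"
    using num_classes_mono[OF finite_carrier sub] by (simp add: num_classes_def)

  \<comment> \<open>Sending both new darts back to \<open>q\<close> turns links of the new system
    into links of the old one, so that \<open>one_outer\<close> is inherited.\<close>
  define h where "h e = (if e = x \<or> e = y then q else e)" for e
  have dq: "(d, q) \<in> eqv L"
    using eqv_trans[OF rot_linked[OF d qd] eqv_sym[OF phi_link[OF qB]]] .
  have aqL: "(\<alpha> d, q) \<in> eqv L" using eqv_trans[OF eqv_sym[OF alpha_link[OF d]] dq] .
  have hL: "(h e, h (\<phi>' e)) \<in> eqv L \<and> (h e, h (\<alpha>' e)) \<in> eqv L" if "e \<in> ?B" for e
  proof -
    have hB: "h b = b" if "b \<in> B" for b using that xy by (auto simp: h_def)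
    have hx: "h x = q" "h y = q" by (simp_all add: h_def)
    have neq: "x \<noteq> q" "y \<noteq> q" using xy qB by auto
    have v': "\<phi>' q = x" "\<phi>' x = y" "\<phi>' y = \<phi> q" using neq xy(3) by (simp_all add: \<phi>'_def)
    consider "e = q" | "e = x" | "e = y" | "e \<in> B" "e \<noteq> q" "e \<noteq> x" "e \<noteq> y" using \<open>e \<in> ?B\<close> xy by blast
    then have "(h e, h (\<phi>' e)) \<in> eqv L"
    proof cases
      case 4
      then have "\<phi>' e = \<phi> e" by (simp add: \<phi>'_def)
      then show ?thesis using 4(1) hB closed phi_link by simp
    qed (use v' hx hB qB closed phi_link in simp_all)
    moreover
    consider "e = d" | "e = \<alpha> d" | "e = x" | "e = y" | "e \<in> B" "e \<noteq> d" "e \<noteq> \<alpha> d" "e \<noteq> x" "e \<noteq> y"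
      using \<open>e \<in> ?B\<close> xy by blast
    then have "(h e, h (\<alpha>' e)) \<in> eqv L"
    proof cases
      case 5
      then have "\<alpha>' e = \<alpha> e" by (simp add: \<alpha>'_def)
      then show ?thesis using 5(1) hB involution alpha_link by simp
    qed (use v hx hB d ad(1) dq aqL eqv_sym[OF dq] eqv_sym[OF aqL] in simp_all)
    ultimately show ?thesis by blast
  qed
  have hmap: "(h a, h b) \<in> eqv L" if "(a, b) \<in> eqv ?L" for a b
    by (rule eqv_map[OF that]) (use hL in \<open>auto simp: links_def fgraph_def\<close>)
  interpret f': finite_perm \<phi>' ?B by (rule fp')
  show "planar_system \<phi>' ?B \<alpha>' (X \<union> {x, y})"
  proof unfold_locales
    show "e \<in> X \<union> {x, y} \<Longrightarrow> \<phi>' e \<in> X \<union> {x, y}" for e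
      using outer_closed[of e] outer_closed[OF q] by (auto simp: \<phi>'_def)
    have "card ?B = card B + 2" using xy finite_carrier by simp
    then show "card ?B + 4 * num_classes ?L ?B \<le> 2 * (num_orbits (\<phi>' \<circ> \<alpha>') ?B + num_orbits \<phi>' ?B)"
      using euler num_classes' n' nr' by simp
    fix a b assume ab: "a \<in> X \<union> {x, y}" "b \<in> X \<union> {x, y}" "(a, b) \<in> eqv ?L"
    have hX: "h a \<in> X" "h b \<in> X" using ab q xy outer_sub by (auto simp: h_def)
    then have hB: "h a \<in> B" using outer_sub by auto
    have hab: "h b \<in> orbit \<phi> (h a)" using one_outer[OF hX] hmap[OF ab(3)] by blast
    show "b \<in> orbit \<phi>' a"
    proof (cases "h a \<in> orbit \<phi> q")
      case True
      then have "h b \<in> orbit \<phi> q" using hab orbit_eq[OF qB] by blast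
      with True have "a \<in> orbit \<phi>' q" "b \<in> orbit \<phi>' q" unfolding oq by (auto simp: h_def split: if_splits)
      then show ?thesis using f'.orbit_eq[of q a] qB by auto
    next
      case False
      then have nq: "q \<notin> orbit \<phi> (h a)" using orbit_eq[OF hB] self_orbit[OF hB] by blast
      then have "h a = a" "h b = b" using False hab self_orbit[OF qB] by (auto simp: h_def split: if_splits)
      then show ?thesis using oe[OF hB nq] hab by simp
    qed
  qed (use inv' outer_sub in auto)
qed

end

section \<open>Diagrams\<close>

lemma finite_perm_permutes: "finite S \<Longrightarrow> f permutes S \<Longrightarrow> finite_perm f S"
  by (simp add: finite_perm_def permutes_imp_bij)

locale diag =
  fixes D :: complex2
  assumes diagram: "diagram D"
begin

lemma fin: "finite (verts D)" "finite (darts D)"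
  and opp: "d \<in> darts D \<Longrightarrow> opp D d \<in> darts D" "d \<in> darts D \<Longrightarrow> opp D d \<noteq> d"
    "d \<in> darts D \<Longrightarrow> opp D (opp D d) = d"
  and nxt_in: "d \<in> darts D \<Longrightarrow> nxt D d \<in> darts D"
  and org_in: "d \<in> darts D \<Longrightarrow> org D d \<in> verts D"
  and org_eq_iff: "d \<in> darts D \<Longrightarrow> e \<in> darts D \<Longrightarrow> org D d = org D e \<longleftrightarrow> e \<in> orbit (rot D) d"
  and outer_faces: "darts D \<noteq> {} \<Longrightarrow> outer D \<in> faces D"
  and outer_empty: "darts D = {} \<Longrightarrow> outer D = {}"
  and connected: "connected_complex D"
  and euler: "euler_char D = 1"
  using diagram permutes_in_image[of "opp D" "darts D"] permutes_in_image[of "nxt D" "darts D"]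
  unfolding diagram_def by auto

sublocale nxt: finite_perm "nxt D" "darts D"
  using diagram fin(2) by (intro finite_perm_permutes) (auto simp: diagram_def)

lemma rot_permutes: "rot D permutes darts D"
  unfolding rot_def using diagram by (intro permutes_compose) (auto simp: diagram_def)

sublocale rot: finite_perm "rot D" "darts D"
  by (rule finite_perm_permutes[OF fin(2) rot_permutes])

lemma facesE: assumes "f \<in> faces D" obtains d where "d \<in> darts D" "f = orbit (nxt D) d"
  using assms unfolding faces_def by blast

lemma face_orbit: "f \<in> faces D \<Longrightarrow> d \<in> f \<Longrightarrow> orbit (nxt D) d = f"
  by (elim facesE) (simp add: nxt.orbit_eq)

lemma face_sub: "f \<in> faces D \<Longrightarrow> f \<subseteq> darts D"
  by (elim facesE) (simp add: nxt.orbit_sub)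

lemma face_ne: "f \<in> faces D \<Longrightarrow> f \<noteq> {}"
  by (elim facesE) (simp add: orbit_nonempty)

lemma outer_sub: "outer D \<subseteq> darts D"
  using outer_faces outer_empty face_sub by (cases "darts D = {}") auto

lemma orbit_outer: "d \<in> outer D \<Longrightarrow> orbit (nxt D) d = outer D"
  using outer_sub face_orbit[OF outer_faces] by blast

lemma orbit_cell: "f \<in> cells D \<Longrightarrow> d \<in> f \<Longrightarrow> orbit (nxt D) d = f"
  using face_orbit by (simp add: cells_def)

lemma cell_sub: "f \<in> cells D \<Longrightarrow> f \<subseteq> darts D"
  using face_sub by (simp add: cells_def)

lemma cell_outer: "f \<in> cells D \<Longrightarrow> d \<in> f \<Longrightarrow> d \<notin> outer D"
  using orbit_cell[of f d] orbit_outer[of d] unfolding cells_def by auto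

lemma cell_ne: "f \<in> cells D \<Longrightarrow> f \<noteq> {}"
  using face_ne by (simp add: cells_def)

lemma outer_ne: "darts D \<noteq> {} \<Longrightarrow> outer D \<noteq> {}"
  using face_ne outer_faces by simp

lemma orbit_nonouter: "d \<in> darts D \<Longrightarrow> d \<notin> outer D \<Longrightarrow> orbit (nxt D) d \<in> cells D"
  using nxt.self_orbit[of d] unfolding faces_def cells_def by auto

lemma nxt_outer: "d \<in> outer D \<Longrightarrow> nxt D d \<in> outer D"
  using orbit_outer[of d] orbit.base[of "nxt D" d] by auto

lemma nxt_cell: "f \<in> cells D \<Longrightarrow> d \<in> f \<Longrightarrow> nxt D d \<in> f"
  using orbit_cell[of f d] orbit.base[of "nxt D" d] by auto

lemma outer_eq: "outer D = darts D - \<Union>(cells D)"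
proof
  show "outer D \<subseteq> darts D - \<Union>(cells D)" using outer_sub cell_outer by blast
  show "darts D - \<Union>(cells D) \<subseteq> outer D"
    using orbit_nonouter nxt.self_orbit by blast
qed

lemma finite_cells: "finite (cells D)" unfolding cells_def faces_def using fin by simp

lemma org_rot: "d \<in> darts D \<Longrightarrow> org D (rot D d) = org D d"
  using org_eq_iff[of d "rot D d"] rot.closed[of d] orbit.base[of "rot D" d] by simp

lemma org_nxt: "d \<in> darts D \<Longrightarrow> org D (nxt D d) = org D (opp D d)"
  using org_rot[of "opp D d"] opp[of d] by (simp add: rot_def)

abbreviation "L \<equiv> links (darts D) (opp D) (nxt D)"

lemma same_org_linked: "d \<in> darts D \<Longrightarrow> e \<in> darts D \<Longrightarrow> org D d = org D e \<Longrightarrow> (d, e) \<in> eqv L"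
proof (rule rot.orbit_eqv)
  show "fgraph (rot D) (darts D) \<subseteq> eqv L"
  proof
    fix z assume "z \<in> fgraph (rot D) (darts D)"
    then obtain d where d: "d \<in> darts D" "z = (d, nxt D (opp D d))" by (auto simp: fgraph_def rot_def)
    have "(d, opp D d) \<in> L" "(opp D d, nxt D (opp D d)) \<in> L"
      using d opp by (auto simp: links_def fgraph_def)
    from eqv_trans[OF eqv_base[OF this(1)] eqv_base[OF this(2)]] show "z \<in> eqv L"
      unfolding d(2) .
  qed
qed (auto simp: org_eq_iff)

text \<open>A path of vertices lifts to links of darts: a step reverses a dart, and darts at a
  common vertex are linked through the rotation.\<close>

lemma darts_linked: assumes "d \<in> darts D" "e \<in> darts D" shows "(d, e) \<in> eqv L"
proof -
  have "\<forall>e\<in>darts D. org D e = v \<longrightarrow> (d, e) \<in> eqv L"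
    if "(org D d, v) \<in> {(org D d, org D (opp D d)) | d. d \<in> darts D}\<^sup>*" for v
    using that
  proof (induction rule: rtrancl_induct)
    case base
    then show ?case using same_org_linked[OF assms(1)] by simp
  next
    case (step u v)
    then obtain a where a: "a \<in> darts D" "u = org D a" "v = org D (opp D a)" by auto
    then have "(d, a) \<in> eqv L" using step.IH by auto
    moreover have "(a, opp D a) \<in> eqv L" using a by (intro eqv_base) (auto simp: links_def fgraph_def)
    ultimately have "(d, opp D a) \<in> eqv L" by (rule eqv_trans)
    then show ?case using same_org_linked[of "opp D a"] opp(1) a eqv_trans[of d "opp D a"] by auto
  qed
  moreover have "(org D d, org D e) \<in> {(org D d, org D (opp D d)) | d. d \<in> darts D}\<^sup>*"
    using connected assms org_in unfolding connected_complex_def by blast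
  ultimately show ?thesis using assms by blast
qed

lemma verts_eq: "darts D \<noteq> {} \<Longrightarrow> verts D = org D ` darts D"
proof
  assume "darts D \<noteq> {}"
  then obtain d where d: "d \<in> darts D" by blast
  show "verts D \<subseteq> org D ` darts D"
  proof
    fix v assume "v \<in> verts D"
    then have "(org D d, v) \<in> {(org D d, org D (opp D d)) | d. d \<in> darts D}\<^sup>*"
      using connected d org_in unfolding connected_complex_def by blast
    then show "v \<in> org D ` darts D" by (cases rule: rtranclE) (use d opp in auto)
  qed
qed (use org_in in blast)

lemma num_orbits_rot: "darts D \<noteq> {} \<Longrightarrow> num_orbits (rot D) (darts D) = card (verts D)"
proof -
  assume ne: "darts D \<noteq> {}"
  have "bij_betw (\<lambda>S. org D (SOME e. e \<in> S)) (orbit (rot D) ` darts D) (verts D)"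
  proof (rule bij_betw_byWitness[where f' = "\<lambda>v. {e \<in> darts D. org D e = v}"])
    have orb: "orbit (rot D) d = {e \<in> darts D. org D e = org D d}" if "d \<in> darts D" for d
    proof -
      have "e \<in> orbit (rot D) d \<longleftrightarrow> org D e = org D d" if "e \<in> darts D" for e
        using org_eq_iff[OF \<open>d \<in> darts D\<close> that] by metis
      then show ?thesis using rot.orbit_sub[OF that] by blast
    qed
    have some: "(SOME e. e \<in> orbit (rot D) d) \<in> orbit (rot D) d" if "d \<in> darts D" for d
      using rot.self_orbit[OF that] by (rule someI)
    have org: "org D (SOME e. e \<in> orbit (rot D) d) = org D d" if "d \<in> darts D" for d
      using some[OF that] orb[OF that] by auto
    show "\<forall>S\<in>orbit (rot D) ` darts D. {e \<in> darts D. org D e = org D (SOME e. e \<in> S)} = S"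
      using org orb by auto
    show "\<forall>v\<in>verts D. org D (SOME e. e \<in> {e \<in> darts D. org D e = v}) = v"
      unfolding verts_eq[OF ne] using org orb by auto
    show "(\<lambda>S. org D (SOME e. e \<in> S)) ` orbit (rot D) ` darts D \<subseteq> verts D"
      using org org_in by auto
    show "(\<lambda>v. {e \<in> darts D. org D e = v}) ` verts D \<subseteq> orbit (rot D) ` darts D"
      unfolding verts_eq[OF ne] using orb by auto
  qed
  then show ?thesis by (simp add: num_orbits_def bij_betw_same_card)
qed

lemma card_darts: "card (darts D) = 2 * card (edges D)"
proof -
  have "\<Union>(edges D) = darts D" unfolding edges_def using opp(1) by auto
  moreover have "card (\<Union>(edges D)) = 2 * card (edges D)"
  proof (subst card_Union_disjoint)
    show "pairwise disjnt (edges D)"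
      unfolding pairwise_def disjnt_def edges_def using opp
      by (auto simp: doubleton_eq_iff) (metis opp(3))
    have two: "card E = 2" if "E \<in> edges D" for E
    proof -
      from that obtain d where "d \<in> darts D" "E = {d, opp D d}" by (auto simp: edges_def)
      then show ?thesis using opp(2)[of d] by simp
    qed
    then show "finite E" if "E \<in> edges D" for E using that by (metis card.infinite zero_neq_numeral)
    show "sum card (edges D) = 2 * card (edges D)" using two by simp
  qed
  ultimately show ?thesis by simp
qed

lemma euler_nat: "card (verts D) + card (cells D) = card (edges D) + 1"
  using euler unfolding euler_char_def by linarith

lemma card_faces: "darts D \<noteq> {} \<Longrightarrow> num_orbits (nxt D) (darts D) = Suc (card (cells D))"
  unfolding num_orbits_def cells_def using outer_faces fin unfolding faces_def
  by (metis card_Suc_Diff1 finite_imageI)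

text \<open>Counting \<open>outer\<close> as a face raises the Euler characteristic to 2, and by
  connectedness there is one class of darts. A diagram without darts gives the empty map, for which
  all counts vanish.\<close>

lemma planar: "planar_system (nxt D) (darts D) (opp D) (outer D)"
proof unfold_locales
  show "card (darts D) + 4 * num_classes L (darts D)
    \<le> 2 * (num_orbits (nxt D \<circ> opp D) (darts D) + num_orbits (nxt D) (darts D))"
  proof (cases "darts D = {}")
    case True
    then show ?thesis by (simp add: num_classes_def)
  next
    case False
    then obtain d where d: "d \<in> darts D" by blast
    have "(\<lambda>e. eqv L `` {e}) ` darts D = {eqv L `` {d}}"
      using darts_linked d eqv_class_eq[of L _ d] by auto
    then have "num_classes L (darts D) = 1" by (simp add: num_classes_def)
    then show ?thesis
      using num_orbits_rot[OF False] card_faces[OF False] card_darts euler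
        euler_nat unfolding rot_def by simp
  qed
qed (use opp outer_sub nxt_outer orbit_outer in auto)

end

section \<open>The cost of shelling moves\<close>

lemma planar_system_cong:
  assumes "planar_system \<phi> B \<alpha> X" "\<And>e. e \<in> B \<Longrightarrow> \<alpha> e = \<alpha>' e"
  shows "planar_system \<phi> B \<alpha>' X"
proof -
  interpret planar_system \<phi> B \<alpha> X by fact
  have l: "links B \<alpha>' \<phi> = links B \<alpha> \<phi>" using assms(2) by (auto simp: links_def fgraph_def)
  have n: "num_orbits (\<phi> \<circ> \<alpha>') B = num_orbits (\<phi> \<circ> \<alpha>) B"
    by (rule finite_perm_cong(3)[OF rot.finite_perm_axioms]) (use assms(2) in simp)
  show ?thesis
  proof unfold_locales
    show "card B + 4 * num_classes (links B \<alpha>' \<phi>) B \<le> 2 * (num_orbits (\<phi> \<circ> \<alpha>') B + num_orbits \<phi> B)"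
      using euler l n by simp
    fix e assume e: "e \<in> B"
    then show "\<alpha>' e \<in> B \<and> \<alpha>' e \<noteq> e \<and> \<alpha>' (\<alpha>' e) = e" using involution[OF e] assms(2) by metis
  qed (use outer_sub outer_closed one_outer l in auto)
qed

lemma (in finite_perm) orbit_outside:
  assumes "p \<in> B" "e \<in> B" "e \<notin> orbit f p"
  shows "orbit f e \<inter> orbit f p = {}"
  using assms orbit_eq[of e] orbit_eq[of p] self_orbit[of e] by blast

lemma cycle_starting_at:
  assumes "is_cycle f xs" "e \<in> set xs"
  obtains u v where "xs = u @ e # v" "is_cycle f (e # v @ u)" "cycle_from f e = e # v @ u"
proof -
  obtain u v where uv: "xs = u @ e # v" using assms(2) by (auto simp: in_set_conv_decomp)
  with assms(1) is_cycle_rotate[of f u "e # v"] have "is_cycle f (e # v @ u)" by simp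
  then show ?thesis using that[OF uv] cycle_from_eq by force
qed

lemma first_return_self: "x \<in> E \<Longrightarrow> first_return E f x = x"
  by (simp add: first_return_def Least_eq_0)

section \<open>The cost of a family of circuits\<close>

context relators
begin

text \<open>The start of each boundary word is arbitrary, which is harmless by
  \<open>area_rotate\<close>.\<close>

definition cost :: "('d \<Rightarrow> 'd) \<Rightarrow> ('d \<Rightarrow> 'a letter) \<Rightarrow> 'd set \<Rightarrow> enat" where
  "cost \<phi> lab X = (\<Sum>\<beta>\<in>orbit \<phi> ` X. area (map lab (cycle_from \<phi> (SOME e. e \<in> \<beta>))))"

lemma cost_cycle: assumes "is_cycle \<phi> xs" shows "cost \<phi> lab (set xs) = area (map lab xs)"
proof -
  have "orbit \<phi> ` set xs = {set xs}"
    using orbit_cycle[OF assms] assms by (auto simp: is_cycle_def image_iff intro: hd_in_set)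
  moreover define e where "e = (SOME e. e \<in> set xs)"
  moreover have "e \<in> set xs"
    unfolding e_def by (rule someI[of _ "hd xs"]) (use assms in \<open>simp add: is_cycle_def\<close>)
  from cycle_starting_at[OF assms this] obtain u v where uv: "xs = u @ e # v" "cycle_from \<phi> e = e # v @ u"
    by metis
  have "area (map lab (cycle_from \<phi> e)) = area (map lab xs)"
    using area_rotate[of "map lab u" "map lab (e # v)"] uv by simp
  ultimately show ?thesis unfolding cost_def by simp
qed

lemma cost_Un:
  assumes "finite_perm \<phi> B" "Y \<subseteq> B" "Z \<subseteq> B" "Y \<inter> Z = {}"
    "\<And>e. e \<in> Y \<Longrightarrow> orbit \<phi> e \<subseteq> Y" "\<And>e. e \<in> Z \<Longrightarrow> orbit \<phi> e \<subseteq> Z"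
  shows "cost \<phi> lab (Y \<union> Z) = cost \<phi> lab Y + cost \<phi> lab Z"
proof -
  interpret finite_perm \<phi> B by fact
  have "orbit \<phi> ` Y \<inter> orbit \<phi> ` Z = {}"
  proof -
    have False if "y \<in> Y" "z \<in> Z" "orbit \<phi> y = orbit \<phi> z" for y z
      using self_orbit[of y] that assms(2,4) assms(5)[of y] assms(6)[of z] by blast
    then show ?thesis by blast
  qed
  moreover have "finite Y" "finite Z" using assms finite_carrier finite_subset by blast+
  ultimately show ?thesis unfolding cost_def image_Un by (intro sum.union_disjoint) auto
qed

lemma cost_cong:
  assumes "finite_perm \<phi> B" "Y \<subseteq> B" "\<And>e. e \<in> Y \<Longrightarrow> orbit \<phi> e \<subseteq> Y"
    "\<And>e. e \<in> Y \<Longrightarrow> orbit \<psi> e = orbit \<phi> e \<and> cycle_from \<psi> e = cycle_from \<phi> e" "\<And>e. e \<in> Y \<Longrightarrow> lab' e = lab e"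
  shows "cost \<psi> lab' Y = cost \<phi> lab Y"
proof -
  interpret finite_perm \<phi> B by fact
  have "orbit \<psi> ` Y = orbit \<phi> ` Y" using assms(4) by simp
  moreover have "map lab' (cycle_from \<psi> (SOME e. e \<in> \<beta>)) = map lab (cycle_from \<phi> (SOME e. e \<in> \<beta>))"
    if "\<beta> \<in> orbit \<phi> ` Y" for \<beta>
  proof -
    obtain y where y: "y \<in> Y" "\<beta> = orbit \<phi> y" using \<open>\<beta> \<in> _\<close> by blast
    let ?e = "SOME e. e \<in> \<beta>"
    have "y \<in> \<beta>" using self_orbit[of y] y assms(2) by blast
    then have "?e \<in> \<beta>" by (rule someI)
    then have e: "?e \<in> Y" using assms(3) y by blast
    then have "set (cycle_from \<phi> ?e) \<subseteq> Y" using cycle_from(3)[of ?e] assms(2,3) by blast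
    then have "lab' x = lab x" if "x \<in> set (cycle_from \<phi> ?e)" for x
      using subsetD[OF _ that] assms(5) by simp
    then have "map lab' (cycle_from \<phi> ?e) = map lab (cycle_from \<phi> ?e)" by simp
    then show ?thesis using assms(4)[OF e] by simp
  qed
  ultimately show ?thesis unfolding cost_def by (intro sum.cong) auto
qed

lemma cost_remove_orbit:
  assumes "finite_perm \<phi> B" "X \<subseteq> B" and cl: "\<And>e. e \<in> X \<Longrightarrow> orbit \<phi> e \<subseteq> X" and p: "p \<in> X"
  shows "cost \<phi> lab X = cost \<phi> lab (X - orbit \<phi> p) + cost \<phi> lab (orbit \<phi> p)"
proof -
  interpret finite_perm \<phi> B by fact
  have "p \<in> B" using p assms(2) by blast
  have "X = (X - orbit \<phi> p) \<union> orbit \<phi> p" using cl p by blast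
  also have "cost \<phi> lab \<dots> = cost \<phi> lab (X - orbit \<phi> p) + cost \<phi> lab (orbit \<phi> p)"
  proof (rule cost_Un[OF assms(1)])
    show "orbit \<phi> e \<subseteq> X - orbit \<phi> p" if "e \<in> X - orbit \<phi> p" for e
      using cl[of e] orbit_outside[OF \<open>p \<in> B\<close>, of e] that assms(2) by blast
    show "orbit \<phi> e \<subseteq> orbit \<phi> p" if "e \<in> orbit \<phi> p" for e using orbit_eq[OF \<open>p \<in> B\<close> that] by simp
  qed (use assms(2) orbit_sub[OF \<open>p \<in> B\<close>] in auto)
  finally show ?thesis .
qed

text \<open>Up to rotation, the boundary word is the concatenation of the two words that the cut
  produces, and area is subadditive.\<close>

lemma cost_split:
  assumes "finite_perm \<phi> B" "X \<subseteq> B" and cl: "\<And>e. e \<in> X \<Longrightarrow> orbit \<phi> e \<subseteq> X"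
    and pq: "p \<in> X" "q \<in> orbit \<phi> p" "p \<noteq> q"
  shows "cost \<phi> lab X \<le> cost (\<phi> \<circ> transpose p q) lab X"
proof -
  interpret finite_perm \<phi> B by fact
  let ?\<psi> = "\<phi> \<circ> transpose p q"
  let ?O = "orbit \<phi> p"
  have B: "p \<in> B" "q \<in> B" using pq assms(2) orbit_sub by auto
  interpret \<psi>: finite_perm ?\<psi> B by (rule finite_perm_transpose[OF B])
  obtain xs ys where c: "is_cycle \<phi> ((xs @ [p]) @ (ys @ [q]))" "set ((xs @ [p]) @ (ys @ [q])) = ?O"
    "is_cycle ?\<psi> (xs @ [p])" "is_cycle ?\<psi> (ys @ [q])" by (rule split_cycle[OF B(1) pq(2,3)])
  have X: "X = (X - ?O) \<union> ?O" using cl pq by blast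
  have out: "orbit \<phi> e \<subseteq> X - ?O \<and> p \<notin> orbit \<phi> e \<and> q \<notin> orbit \<phi> e" if "e \<in> X - ?O" for e
  proof -
    have eB: "e \<in> B" using that assms(2) by auto
    have "orbit \<phi> e \<inter> ?O = {}" using orbit_outside[OF B(1) eB] that by blast
    then show ?thesis using cl[of e] that pq(2) self_orbit[OF B(1)] by blast
  qed
  note same = transpose_other[of _ p q]
  have o: "orbit ?\<psi> e = orbit \<phi> e \<and> cycle_from ?\<psi> e = cycle_from \<phi> e" if "e \<in> X - ?O" for e
    using same[of e] out[OF that] that assms(2) by blast
  have "cost \<phi> lab X = cost \<phi> lab (X - ?O) + cost \<phi> lab ?O"
    by (rule cost_remove_orbit[OF assms(1,2) cl pq(1)])
  also have "cost \<phi> lab ?O \<le> area (map lab (xs @ [p])) + area (map lab (ys @ [q]))"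
    using cost_cycle[OF c(1), of lab] area_append[of "map lab (xs @ [p])" "map lab (ys @ [q])"]
    unfolding c(2) map_append by metis
  also have "cost \<phi> lab (X - ?O) = cost ?\<psi> lab (X - ?O)"
    using assms(2) out o by (intro cost_cong[symmetric, OF assms(1)]) auto
  also have "area (map lab (xs @ [p])) + area (map lab (ys @ [q])) =
      cost ?\<psi> lab (set (xs @ [p]) \<union> set (ys @ [q]))"
    unfolding cost_cycle[OF c(3), symmetric] cost_cycle[OF c(4), symmetric]
  proof (rule cost_Un[symmetric, OF \<psi>.finite_perm_axioms])
    show "set (xs @ [p]) \<inter> set (ys @ [q]) = {}" using c(1) unfolding is_cycle_def distinct_append by blast
    show "set (xs @ [p]) \<subseteq> B" "set (ys @ [q]) \<subseteq> B" using c(2) orbit_sub[OF B(1)] by auto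
  qed (use orbit_cycle[OF c(3)] orbit_cycle[OF c(4)] in simp_all)
  also have "cost ?\<psi> lab (X - ?O) + \<dots> = cost ?\<psi> lab X"
  proof -
    have O: "set (xs @ [p]) \<union> set (ys @ [q]) = ?O" using c(2) by auto
    have "orbit ?\<psi> e \<subseteq> ?O" if "e \<in> ?O" for e
      using that O orbit_cycle[OF c(3), of e] orbit_cycle[OF c(4), of e] by blast
    moreover have "orbit ?\<psi> e \<subseteq> X - ?O" if "e \<in> X - ?O" for e using out[OF that] o[OF that] by blast
    moreover have "X - ?O \<subseteq> B" "?O \<subseteq> B" using assms(2) orbit_sub[OF B(1)] by auto
    ultimately have "cost ?\<psi> lab ((X - ?O) \<union> ?O) = cost ?\<psi> lab (X - ?O) + cost ?\<psi> lab ?O"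
      by (intro cost_Un[OF \<psi>.finite_perm_axioms]) auto
    then show ?thesis unfolding O X[symmetric] by simp
  qed
  finally show ?thesis by (simp add: add_left_mono)
qed

end

text \<open>Along a cell of \<open>S\<close> the successor of a dart in \<open>D\<close> belongs to
  \<open>S\<close> again, so the first return is immediate.\<close>

lemma subcomplex_agree:
  assumes "subcomplex S D" "diagram S" "diagram D" "e \<in> darts S - outer S"
  shows "nxt S e = nxt D e" "e \<in> darts D - outer D" "orbit (nxt S) e = orbit (nxt D) e"
    "cycle_from (nxt S) e = cycle_from (nxt D) e"
proof -
  interpret S: diag S by unfold_locales fact
  interpret D: diag D by unfold_locales fact
  let ?f = "orbit (nxt S) e"
  have f: "?f \<in> cells S" using S.orbit_nonouter assms(4) by blast
  then have fD: "?f \<in> cells D" using assms(1) by (auto simp: subcomplex_def)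
  have e: "e \<in> ?f" using S.nxt.self_orbit assms(4) by blast
  have agree: "nxt S x = nxt D x" if "x \<in> ?f" for x
  proof -
    have "nxt D x \<in> darts S" using D.nxt_cell[OF fD that] S.cell_sub[OF f] by blast
    moreover have "x \<in> darts S" using that S.cell_sub[OF f] by blast
    ultimately show ?thesis using assms(1) first_return_self by (simp add: subcomplex_def)
  qed
  show "nxt S e = nxt D e" by (rule agree[OF e])
  show "e \<in> darts D - outer D" using D.cell_sub[OF fD] D.cell_outer[OF fD e] e by blast
  show "orbit (nxt S) e = orbit (nxt D) e" using D.orbit_cell[OF fD e] by simp
  have eS: "e \<in> darts S" using assms(4) by blast
  have "is_cycle (nxt D) (cycle_from (nxt S) e)"
    using is_cycle_cong[of "cycle_from (nxt S) e" "nxt S" "nxt D"] S.nxt.cycle_from(1,3)[OF eS] agree by blast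
  from cycle_from_eq[OF this] show "cycle_from (nxt S) e = cycle_from (nxt D) e" unfolding S.nxt.cycle_from(2)[OF eS] by simp
qed

section \<open>Labelled diagrams, cut systems and 1-dimensional moves\<close>

context relators
begin

text \<open>A cell may be read from any of its darts, as \<open>Q\<close> is closed under rotation;
  no base point of a cell has to be tracked.\<close>

definition labelled :: "complex2 \<Rightarrow> (nat \<Rightarrow> 'a letter) \<Rightarrow> bool" where
  "labelled D lab \<longleftrightarrow>
    (\<forall>d\<in>darts D. fst (lab d) \<in> A \<and> lab (opp D d) = inv_letter (lab d)) \<and>
    (\<forall>d\<in>darts D - outer D. map lab (cycle_from (nxt D) d) \<in> Q)"

text \<open>The permutation \<open>\<phi>\<close> describes the result of cutting \<open>D\<close> apart at some vertices on its boundary.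
  A fragmentation may distribute the branches at a vertex in an interleaved way, so that the two
  boundary words do not control the original one; after cutting at this vertex they do. No
  relation between the vertices of \<open>D\<close> and of the cut complex is recorded, since further cuts
  (\<open>colour_split\<close>) restore it whenever it is needed.\<close>

definition cut_system :: "complex2 \<Rightarrow> (nat \<Rightarrow> 'a letter) \<Rightarrow> (nat \<Rightarrow> nat) \<Rightarrow> bool" where
  "cut_system D lab \<phi> \<longleftrightarrow> diagram D \<and> labelled D lab \<and>
    planar_system \<phi> (darts D) (opp D) (outer D) \<and> (\<forall>e\<in>darts D - outer D. \<phi> e = nxt D e)"

lemma cut_system_nxt: "diagram D \<Longrightarrow> labelled D lab \<Longrightarrow> cut_system D lab (nxt D)"
  by (simp add: cut_system_def diag.planar diag.intro)

lemma cost_split_planar: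
  assumes "planar_system \<phi> B \<alpha> X" "p \<in> X" "q \<in> orbit \<phi> p" "p \<noteq> q"
  shows "cost \<phi> lab X \<le> cost (\<phi> \<circ> transpose p q) lab X"
proof -
  interpret planar_system \<phi> B \<alpha> X by fact
  show ?thesis by (rule cost_split[OF finite_perm_axioms outer_sub orbit_outer assms(2-4)])
qed

text \<open>Once the edge is cut off, its circuit reads a letter and its inverse. This word has area
  0, so the component can be discarded without changing the cost.\<close>

lemma remove_isolated_edge:
  assumes "planar_system \<phi> B \<alpha> X" "x \<in> X" "\<phi> x = \<alpha> x"
    and lab: "fst (lab x) \<in> A" "lab (\<alpha> x) = inv_letter (lab x)"
  shows "\<exists>\<psi>. planar_system \<psi> (B - {x, \<alpha> x}) \<alpha> (X - {x, \<alpha> x}) \<and> (\<forall>e\<in>B - X. \<psi> e = \<phi> e) \<and>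
    cost \<phi> lab X \<le> cost \<psi> lab (X - {x, \<alpha> x})"
proof -
  have "\<exists>\<psi>. planar_system \<psi> B \<alpha> X \<and> cost \<phi> lab X \<le> cost \<psi> lab X \<and> (\<forall>e\<in>B - X. \<psi> e = \<phi> e) \<and>
    \<psi> x = \<alpha> x \<and> \<psi> (\<alpha> x) = x"
    by (rule isolate_edge[OF assms(1) _ assms(2,3)]) (auto intro: order_trans cost_split_planar)
  then obtain \<psi> where \<psi>: "planar_system \<psi> B \<alpha> X" "cost \<phi> lab X \<le> cost \<psi> lab X"
    "\<forall>e\<in>B - X. \<psi> e = \<phi> e" "\<psi> x = \<alpha> x" "\<psi> (\<alpha> x) = x" by blast
  interpret planar_system \<psi> B \<alpha> X by (rule \<psi>(1))
  have xB: "x \<in> B" "\<alpha> x \<in> B" "\<alpha> x \<noteq> x" "\<alpha> (\<alpha> x) = x" using involution outer_sub assms(2) by auto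
  have inj: "inj_on \<psi> B" using bij by (simp add: bij_betw_def)
  let ?S = "B - {x, \<alpha> x}"
  have "planar_system \<psi> ?S \<alpha> (X \<inter> ?S)"
  proof (rule restrict_planar)
    fix e assume e: "e \<in> ?S"
    show "\<alpha> e \<in> ?S" using e involution[of e] xB by auto
    show "\<psi> e \<in> ?S" using e closed[of e] inj_onD[OF inj, of e x] inj_onD[OF inj, of e "\<alpha> x"] xB \<psi>(4,5)
      by auto
  qed auto
  moreover have "X \<inter> ?S = X - {x, \<alpha> x}" using outer_sub by auto
  moreover have "is_cycle \<psi> [x, \<alpha> x]" using xB \<psi>(4,5) by (auto simp: is_cycle_def)
  from cost_cycle[OF this] orbit_cycle[OF this, of x]
  have "cost \<psi> lab (orbit \<psi> x) = 0" "orbit \<psi> x = {x, \<alpha> x}" using area_pair[OF lab(1)] lab(2) by auto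
  with cost_remove_orbit[OF finite_perm_axioms outer_sub orbit_outer assms(2)]
  have "cost \<psi> lab X = cost \<psi> lab (X - {x, \<alpha> x})" by simp
  ultimately show ?thesis using \<psi> by auto
qed

lemma labelled_sub:
  assumes "subcomplex S D" "diagram S" "diagram D" "labelled D lab"
  shows "labelled S lab"
  unfolding labelled_def
proof (intro conjI ballI)
  fix d assume d: "d \<in> darts S"
  then have "d \<in> darts D" "opp S d = opp D d" using assms(1) by (auto simp: subcomplex_def)
  then show "fst (lab d) \<in> A" "lab (opp S d) = inv_letter (lab d)"
    using assms(4) by (simp_all add: labelled_def)
next
  fix d assume d: "d \<in> darts S - outer S"
  show "map lab (cycle_from (nxt S) d) \<in> Q"
    unfolding subcomplex_agree(4)[OF assms(1-3) d]
    using subcomplex_agree(2)[OF assms(1-3) d] assms(4) unfolding labelled_def by blast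
qed

lemma cut_system_sub:
  assumes "subcomplex S D" "diagram S" "cut_system D lab \<phi>"
    and "planar_system \<psi> (darts S) (opp D) (outer S)"
    and "\<And>e. e \<in> darts S - outer S \<Longrightarrow> \<psi> e = nxt D e"
  shows "cut_system S lab \<psi>"
  unfolding cut_system_def
proof (intro conjI ballI)
  show "labelled S lab" using labelled_sub assms by (auto simp: cut_system_def)
  show "planar_system \<psi> (darts S) (opp S) (outer S)"
    by (rule planar_system_cong[OF assms(4)]) (use assms(1) in \<open>auto simp: subcomplex_def\<close>)
  show "\<psi> e = nxt S e" if "e \<in> darts S - outer S" for e
    using assms(5)[OF that] subcomplex_agree(1)[OF assms(1,2) _ that] assms(3)
    by (simp add: cut_system_def)
qed (rule assms(2))

lemma collapse1_cost:
  assumes "cut_system D lab \<phi>" "diagram D'" "collapse1 D D'"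
  shows "\<exists>\<psi>. cut_system D' lab \<psi> \<and> cost \<phi> lab (outer D) \<le> cost \<psi> lab (outer D')"
proof -
  interpret D: diag D using assms(1) by unfold_locales (simp add: cut_system_def)
  interpret D': diag D' by unfold_locales fact
  have \<phi>: "planar_system \<phi> (darts D) (opp D) (outer D)" "\<And>e. e \<in> darts D - outer D \<Longrightarrow> \<phi> e = nxt D e"
    and lab: "labelled D lab" using assms(1) by (auto simp: cut_system_def)
  obtain d where "d \<in> outer D"
    "org D (opp D d) \<noteq> org D d \<and> (\<forall>e\<in>darts D. org D e = org D d \<longrightarrow> e = d) \<and> subcomplex D' D \<and>
      verts D' = verts D - {org D d} \<and> darts D' = darts D - {d, opp D d} \<and> cells D' = cells D"
    using assms(3) unfolding collapse1_def by (rule bexE)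
  then have d: "d \<in> outer D" "\<And>e. e \<in> darts D \<Longrightarrow> org D e = org D d \<Longrightarrow> e = d"
    and sub: "subcomplex D' D" and D': "darts D' = darts D - {d, opp D d}" "cells D' = cells D"
    by simp_all
  have dD: "d \<in> darts D" using d D.outer_sub by blast
  let ?x = "opp D d"
  have x: "?x \<in> darts D" "opp D ?x = d" using D.opp dD by auto
  \<comment> \<open>Colouring darts by their origin in \<open>D\<close> makes the cut system respect
    the vertices of \<open>D\<close>. Since \<open>d\<close> is the only dart at the leaf, it then
    has to follow \<open>opp D d\<close>.\<close>
  have "\<exists>\<psi>. planar_system \<psi> (darts D) (opp D) (outer D) \<and> cost \<phi> lab (outer D) \<le> cost \<psi> lab (outer D) \<and>
    (\<forall>e\<in>darts D - outer D. \<psi> e = \<phi> e) \<and> (\<forall>e\<in>darts D. org D (\<psi> e) = org D (opp D e))"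
    by (rule colour_split[OF \<phi>(1)])
      (use \<phi>(2) D.org_nxt in \<open>auto intro: order_trans cost_split_planar\<close>)
  then obtain \<psi> where \<psi>: "planar_system \<psi> (darts D) (opp D) (outer D)"
    "cost \<phi> lab (outer D) \<le> cost \<psi> lab (outer D)" "\<And>e. e \<in> darts D - outer D \<Longrightarrow> \<psi> e = \<phi> e"
    "\<And>e. e \<in> darts D \<Longrightarrow> org D (\<psi> e) = org D (opp D e)" by blast
  interpret planar_system \<psi> "darts D" "opp D" "outer D" by (rule \<psi>(1))
  have \<psi>x: "\<psi> ?x = d" using d(2)[of "\<psi> ?x"] \<psi>(4)[OF x(1)] closed[OF x(1)] x(2) by simp
  then have xo: "?x \<in> outer D" using outer_iff[OF x(1)] d(1) by simp
  have "fst (lab ?x) \<in> A" "lab (opp D ?x) = inv_letter (lab ?x)" using lab x by (auto simp: labelled_def)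
  from remove_isolated_edge[OF \<psi>(1) xo _ this] \<psi>x x
  obtain \<theta> where \<theta>: "planar_system \<theta> (darts D - {?x, d}) (opp D) (outer D - {?x, d})"
    "\<And>e. e \<in> darts D - outer D \<Longrightarrow> \<theta> e = \<psi> e" "cost \<psi> lab (outer D) \<le> cost \<theta> lab (outer D - {?x, d})"
    by auto
  have 1: "darts D - {?x, d} = darts D'" using D' by auto
  have 2: "outer D - {?x, d} = outer D'" unfolding D.outer_eq D'.outer_eq D' by auto
  have "cut_system D' lab \<theta>"
  proof (rule cut_system_sub[OF sub assms(2,1)])
    show "planar_system \<theta> (darts D') (opp D) (outer D')" using \<theta>(1) 1 2 by simp
    fix e assume "e \<in> darts D' - outer D'"
    then have "e \<in> darts D - outer D" using 1 2 by auto
    then show "\<theta> e = nxt D e" using \<theta>(2) \<psi>(3) \<phi>(2) by simp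
  qed
  then show ?thesis using \<theta>(3) \<psi>(2) 2 by (auto intro: order_trans)
qed

lemma fragmentation_cost:
  assumes "cut_system D lab \<phi>" "diagram D'" "diagram D''" "fragmentation D D' D''"
  shows "\<exists>\<psi>. cut_system D' lab \<psi> \<and> cut_system D'' lab \<psi> \<and>
    cost \<phi> lab (outer D) \<le> cost \<psi> lab (outer D') + cost \<psi> lab (outer D'')"
proof -
  interpret D: diag D using assms(1) by unfold_locales (simp add: cut_system_def)
  interpret D': diag D' by unfold_locales fact
  interpret D'': diag D'' by unfold_locales fact
  have \<phi>: "planar_system \<phi> (darts D) (opp D) (outer D)" "\<And>e. e \<in> darts D - outer D \<Longrightarrow> \<phi> e = nxt D e"
    using assms(1) by (auto simp: cut_system_def)
  have sub: "subcomplex D' D" "subcomplex D'' D" and F: "darts D' \<union> darts D'' = darts D"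
    "cells D' \<union> cells D'' = cells D" "darts D' \<inter> darts D'' = {}"
    using assms(4) unfolding fragmentation_def by auto
  have opp: "e \<in> darts D' \<Longrightarrow> opp D e \<in> darts D'" "e \<in> darts D'' \<Longrightarrow> opp D e \<in> darts D''" for e
    using sub D'.opp(1) D''.opp(1) by (auto simp: subcomplex_def)
  have col: "(\<phi> e \<in> darts D') = (opp D e \<in> darts D')" if e: "e \<in> darts D - outer D" for e
  proof -
    obtain f where f: "f \<in> cells D" "e \<in> f" using e D.outer_eq by auto
    have n: "\<phi> e \<in> f" using \<phi>(2)[OF e] D.nxt_cell[OF f] by simp
    from f(1) F(2) consider "f \<in> cells D'" | "f \<in> cells D''" by blast
    then show ?thesis
    proof cases
      case 1
      then show ?thesis using D'.cell_sub[OF 1] n f opp by blast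
    next
      case 2
      then show ?thesis using D''.cell_sub[OF 2] n f opp F(3) by blast
    qed
  qed
  \<comment> \<open>Membership in \<open>D'\<close> is the colour, so that afterwards no circuit
    passes from one piece to the other. Cells need no cut, because each belongs entirely to one
    piece.\<close>
  have "\<exists>\<psi>. planar_system \<psi> (darts D) (opp D) (outer D) \<and> cost \<phi> lab (outer D) \<le> cost \<psi> lab (outer D) \<and>
    (\<forall>e\<in>darts D - outer D. \<psi> e = \<phi> e) \<and>
    (\<forall>e\<in>darts D. (\<psi> e \<in> darts D') = (opp D e \<in> darts D'))"
    by (rule colour_split[OF \<phi>(1)]) (use col in \<open>auto intro: order_trans cost_split_planar\<close>)
  then obtain \<psi> where \<psi>: "planar_system \<psi> (darts D) (opp D) (outer D)"
    "cost \<phi> lab (outer D) \<le> cost \<psi> lab (outer D)" "\<And>e. e \<in> darts D - outer D \<Longrightarrow> \<psi> e = \<phi> e"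
    "\<And>e. e \<in> darts D \<Longrightarrow> (\<psi> e \<in> darts D') = (opp D e \<in> darts D')" by blast
  interpret planar_system \<psi> "darts D" "opp D" "outer D" by (rule \<psi>(1))
  have out: "outer D \<inter> darts D' = outer D'" "outer D \<inter> darts D'' = outer D''"
    unfolding D.outer_eq D'.outer_eq D''.outer_eq using F D'.cell_sub D''.cell_sub by blast+
  have cl: "\<psi> e \<in> darts D'" if "e \<in> darts D'" for e using that \<psi>(4)[of e] opp F(1) by blast
  have cl': "\<psi> e \<in> darts D''" if "e \<in> darts D''" for e
    using that \<psi>(4)[of e] opp(2)[of e] F(1,3) closed[of e] by blast
  have sys: "cut_system E lab \<psi>"
    if "subcomplex E D" "diagram E" "planar_system \<psi> (darts E) (opp D) (outer D \<inter> darts E)"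
      "outer D \<inter> darts E = outer E" for E
  proof (rule cut_system_sub[OF that(1,2) assms(1)])
    show "planar_system \<psi> (darts E) (opp D) (outer E)" using that by simp
    fix e assume "e \<in> darts E - outer E"
    then have "e \<in> darts D - outer D" using that(1,4) by (auto simp: subcomplex_def)
    then show "\<psi> e = nxt D e" using \<psi>(3) \<phi>(2) by simp
  qed
  have "cut_system D' lab \<psi>"
    by (rule sys[OF sub(1) assms(2) restrict_planar out(1)]) (use F(1) opp cl in auto)
  moreover have "cut_system D'' lab \<psi>"
    by (rule sys[OF sub(2) assms(3) restrict_planar out(2)]) (use F(1) opp cl' in auto)
  moreover have "cost \<psi> lab (outer D' \<union> outer D'') = cost \<psi> lab (outer D') + cost \<psi> lab (outer D'')"
  proof (rule cost_Un[OF finite_perm_axioms])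
    have c: "orbit \<psi> e \<subseteq> S" if "e \<in> S" "\<And>x. x \<in> S \<Longrightarrow> \<psi> x \<in> S" for e S
    proof
      fix y assume "y \<in> orbit \<psi> e"
      then show "y \<in> S" by induction (use that in auto)
    qed
    show "orbit \<psi> e \<subseteq> outer D'" if "e \<in> outer D'" for e
      using c[OF that] cl outer_closed out(1) by blast
    show "orbit \<psi> e \<subseteq> outer D''" if "e \<in> outer D''" for e
      using c[OF that] cl' outer_closed out(2) by blast
  qed (use out F(3) outer_sub in auto)
  moreover have "outer D = outer D' \<union> outer D''" using out F(1) outer_sub by blast
  ultimately show ?thesis using \<psi>(2) by auto
qed

end

lemma is_cycle_expand:
  assumes "is_cycle f (ys @ [q])" "x \<notin> set (ys @ [q])" "y \<notin> set (ys @ [q])" "x \<noteq> y"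
  shows "is_cycle (f(q := x, x := y, y := f q)) (ys @ [q, x, y])"
proof -
  define g where "g = f(q := x, x := y, y := f q)"
  have q: "q \<notin> set ys" using assms(1) by (simp add: is_cycle_def)
  have g: "g q = x" "g x = y" "g y = f q" using assms by (auto simp: g_def)
  have "successively (\<lambda>a b. g a = b) (ys @ [q]) = successively (\<lambda>a b. f a = b) (ys @ [q])"
    by (rule successively_fun_cong) (use assms q in \<open>auto simp: g_def\<close>)
  then have "successively (\<lambda>a b. g a = b) ((ys @ [q]) @ [x, y])"
    using assms(1) g by (subst successively_append_iff) (simp add: is_cycle_def)
  moreover have "hd (ys @ [q, x, y]) = f q" using assms(1) by (cases ys) (auto simp: is_cycle_def)
  ultimately show ?thesis using assms g unfolding g_def[symmetric] by (auto simp: is_cycle_def)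
qed

section \<open>Costs of 2-cell collapses and 1-cell expansions\<close>

context relators
begin

lemma collapse2_cost:
  assumes "cut_system D lab \<phi>" "diagram D'" "collapse2 D D'"
  shows "\<exists>\<psi>. cut_system D' lab \<psi> \<and> cost \<phi> lab (outer D) \<le> cost \<psi> lab (outer D') + 1"
proof -
  interpret D: diag D using assms(1) by unfold_locales (simp add: cut_system_def)
  interpret D': diag D' by unfold_locales fact
  have \<phi>: "planar_system \<phi> (darts D) (opp D) (outer D)" "\<And>e. e \<in> darts D - outer D \<Longrightarrow> \<phi> e = nxt D e"
    and lab: "labelled D lab" using assms(1) by (auto simp: cut_system_def)
  interpret planar_system \<phi> "darts D" "opp D" "outer D" by (rule \<phi>(1))
  obtain f where f: "f \<in> cells D" and "\<exists>d\<in>f. opp D d \<in> outer D \<and> subcomplex D' D \<and>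
      verts D' = verts D \<and> darts D' = darts D - {d, opp D d} \<and> cells D' = cells D - {f}"
    using assms(3) unfolding collapse2_def by (rule bexE)
  from this(2) obtain d where d: "d \<in> f" and
    "opp D d \<in> outer D \<and> subcomplex D' D \<and>
      verts D' = verts D \<and> darts D' = darts D - {d, opp D d} \<and> cells D' = cells D - {f}"
    by (rule bexE)
  then have xo: "opp D d \<in> outer D" and sub: "subcomplex D' D"
    and D': "darts D' = darts D - {d, opp D d}" "cells D' = cells D - {f}" by simp_all
  let ?x = "opp D d"
  have dD: "d \<in> darts D" "d \<notin> outer D" using d f D.cell_sub D.cell_outer by blast+
  have x: "?x \<in> darts D" "opp D ?x = d" "?x \<noteq> d" using D.opp dD by auto
  have fouter: "e \<in> darts D - outer D" if "e \<in> f" for e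
    using that D.cell_sub[OF f] D.cell_outer[OF f] by blast
  let ?zs = "cycle_from (nxt D) d"
  have zs: "is_cycle (nxt D) ?zs" "hd ?zs = d" "set ?zs = f"
    using D.nxt.cycle_from[OF dD(1)] D.orbit_cell[OF f d] by auto
  have "is_cycle \<phi> ?zs \<longleftrightarrow> is_cycle (nxt D) ?zs"
    by (rule is_cycle_cong) (use zs(3) fouter \<phi>(2) in auto)
  then have cz: "is_cycle \<phi> ?zs" using zs(1) by simp
  define p where "p = last ?zs"
  have ne: "?zs \<noteq> []" using cz by (simp add: is_cycle_def)
  have p: "p \<in> f" "\<phi> p = d" using cz zs ne last_in_set[OF ne] by (auto simp: p_def is_cycle_def)
  have pD: "p \<in> darts D" "p \<notin> outer D" using fouter[OF p(1)] by auto
  have orbp: "orbit \<phi> p = f" using orbit_cycle[OF cz] zs(3) p(1) by simp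
  obtain s where s: "?zs = d # s" using zs(2) ne by (cases ?zs) auto
  have rel: "inv_letter (lab ?x) # map lab s \<in> Q"
  proof -
    have "map lab ?zs \<in> Q" using lab dD by (simp add: labelled_def)
    moreover have "lab d = inv_letter (lab ?x)" using lab x unfolding labelled_def by metis
    ultimately show ?thesis by (simp add: s)
  qed
  have labx: "fst (lab ?x) \<in> A" "lab (opp D ?x) = inv_letter (lab ?x)" using lab x by (auto simp: labelled_def)

  \<comment> \<open>Opening the cell at the corner between \<open>p\<close> and \<open>d\<close>
    makes the outer circuit run around the whole cell and then along its old course. The edge to be
    removed is now a spike, traversed by \<open>opp D d\<close> and then \<open>d\<close>.\<close>
  let ?\<psi> = "\<phi> \<circ> transpose p ?x"
  let ?X = "outer D \<union> f"
  have "\<phi> p = opp D ?x" using p(2) x(2) by simp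
  note m = merge_planar[OF pD xo this]
  have \<psi>: "planar_system ?\<psi> (darts D) (opp D) ?X" using m(2) orbp by simp
  interpret \<psi>: planar_system ?\<psi> "darts D" "opp D" ?X by (rule \<psi>)
  obtain ys where ys: "is_cycle \<phi> (ys @ [?x])" "set (ys @ [?x]) = orbit \<phi> ?x" by (rule cycle_last[OF x(1)])
  have disj: "set ?zs \<inter> set (ys @ [?x]) = {}"
    unfolding ys(2) zs(3) using orbit_outer[OF xo] fouter by blast
  have c\<psi>: "is_cycle ?\<psi> (?zs @ (ys @ [?x]))"
    using is_cycle_transpose[of ?zs "ys @ [?x]" \<phi>] cz ys(1) disj ne
    by (auto simp: p_def is_cycle_def)
  have O: "orbit ?\<psi> ?x = f \<union> orbit \<phi> ?x"
    using orbit_cycle[OF c\<psi>, of ?x] zs(3) ys(2) by auto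
  have step: "cost \<phi> lab (outer D) \<le> cost ?\<psi> lab ?X + 1"
  proof -
    let ?Y = "outer D - orbit \<phi> ?x"
    have Y: "?X - orbit ?\<psi> ?x = ?Y" using O fouter by blast
    have "cost ?\<psi> lab ?Y = cost \<phi> lab ?Y"
    proof (rule cost_cong[OF finite_perm_axioms])
      fix e assume e: "e \<in> ?Y"
      then have eD: "e \<in> darts D" using outer_sub by blast
      have o: "orbit \<phi> e \<inter> orbit \<phi> ?x = {}" using orbit_outside[OF x(1) eD] e by blast
      then show "orbit \<phi> e \<subseteq> ?Y" using orbit_outer[of e] e by blast
      then have "p \<notin> orbit \<phi> e" "?x \<notin> orbit \<phi> e" using pD o self_orbit[OF x(1)] by blast+
      from transpose_other[OF eD this]
      show "orbit ?\<psi> e = orbit \<phi> e \<and> cycle_from ?\<psi> e = cycle_from \<phi> e" by simp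
    qed (use outer_sub in auto)
    moreover have "cost \<phi> lab (outer D) = cost \<phi> lab ?Y + area (map lab (ys @ [?x]))"
      using cost_remove_orbit[OF finite_perm_axioms outer_sub orbit_outer xo] cost_cycle[OF ys(1)] ys(2)
      by simp
    moreover have "cost ?\<psi> lab ?X = cost ?\<psi> lab ?Y + area (map lab (?zs @ ys @ [?x]))"
      using cost_remove_orbit[OF \<psi>.finite_perm_axioms \<psi>.outer_sub \<psi>.orbit_outer, of ?x lab]
        cost_cycle[OF c\<psi>, of lab] orbit_cycle[OF c\<psi>, of ?x] xo Y by simp
    \<comment> \<open>Rotated, the new word begins with the label of \<open>opp D d\<close> followed
      by its inverse. Deleting this pair leaves \<open>s\<close> in front of \<open>ys\<close>, and
      one cell replaces \<open>s\<close> by the single letter.\<close>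
    moreover have "area (map lab (ys @ [?x])) \<le> area (map lab (?zs @ ys @ [?x])) + 1"
    proof -
      let ?l = "lab ?x"
      have "lab d = inv_letter ?l" using labx(2) x(2) by simp
      then have "area (map lab s @ map lab ys) \<le> area ([?l] @ map lab ?zs @ map lab ys)"
        using area_delete_pair[of "map lab s @ map lab ys" ?l] s by simp
      also have "\<dots> = area (map lab (?zs @ ys @ [?x]))"
        using area_rotate[of "[?l]" "map lab ?zs @ map lab ys"] by simp
      finally have "area (?l # map lab ys) \<le> area (map lab (?zs @ ys @ [?x])) + 1"
        using area_cell[OF rel, of "map lab ys"] by (meson add_right_mono order_trans)
      then show ?thesis using area_rotate[of "[?l]" "map lab ys"] by simp
    qed
    ultimately show ?thesis by (simp add: add.assoc add_left_mono)
  qed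
  have x\<psi>: "?\<psi> ?x = opp D ?x" using p x by (simp add: transpose_def)
  have "?x \<in> ?X" using xo by blast
  from remove_isolated_edge[OF \<psi> this x\<psi> labx, unfolded x(2)]
  obtain \<theta> where \<theta>: "planar_system \<theta> (darts D - {?x, d}) (opp D) (?X - {?x, d})"
    "\<And>e. e \<in> darts D - ?X \<Longrightarrow> \<theta> e = ?\<psi> e" "cost ?\<psi> lab ?X \<le> cost \<theta> lab (?X - {?x, d})"
    by blast
  have 1: "darts D - {?x, d} = darts D'" using D' by auto
  have "outer D' = darts D' - \<Union>(cells D - {f})" using D'.outer_eq D' by simp
  also have "\<Union>(cells D - {f}) = \<Union>(cells D) - f"
    using D.orbit_cell f by blast
  finally have 2: "?X - {?x, d} = outer D'"
    unfolding D.outer_eq 1[symmetric] using D.cell_sub[OF f] f by blast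
  have "cut_system D' lab \<theta>"
  proof (rule cut_system_sub[OF sub assms(2,1)])
    show "planar_system \<theta> (darts D') (opp D) (outer D')" using \<theta>(1) 1 2 by simp
    fix e assume "e \<in> darts D' - outer D'"
    then have e: "e \<in> darts D - ?X" using 1 2 by auto
    then have "e \<noteq> p" "e \<noteq> ?x" using p xo by auto
    then show "\<theta> e = nxt D e" using \<theta>(2)[OF e] \<phi>(2)[of e] e by (simp add: transpose_def)
  qed
  moreover have "cost \<phi> lab (outer D) \<le> cost \<theta> lab (outer D') + 1"
    using step \<theta>(3) 2 by (metis add_right_mono order_trans)
  ultimately show ?thesis by blast
qed

lemma expansion1_cost:
  assumes "cut_system D lab \<phi>" "diagram D'" "expansion1 D D'"
  shows "\<exists>lab' \<psi>. cut_system D' lab' \<psi> \<and> cost \<phi> lab (outer D) \<le> cost \<psi> lab' (outer D')"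
proof -
  interpret D: diag D using assms(1) by unfold_locales (simp add: cut_system_def)
  interpret D': diag D' by unfold_locales fact
  have \<phi>: "planar_system \<phi> (darts D) (opp D) (outer D)" "\<And>e. e \<in> darts D - outer D \<Longrightarrow> \<phi> e = nxt D e"
    and lab: "labelled D lab" using assms(1) by (auto simp: cut_system_def)
  interpret planar_system \<phi> "darts D" "opp D" "outer D" by (rule \<phi>(1))
  obtain p c d x y v1 v2 where "p \<in> outer D" and
    "c = nxt D p \<and> d \<in> darts D \<and> org D d = org D c \<and>
        x \<notin> darts D \<and> y \<notin> darts D \<and> x \<noteq> y \<and>
        v1 \<noteq> v2 \<and> org D c \<in> {v1, v2} \<and> {v1, v2} \<inter> verts D = {org D c} \<and>
        verts D' = verts D \<union> {v1, v2} \<and>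
        darts D' = darts D \<union> {x, y} \<and>
        opp D' = (opp D)(d := y, y := d, opp D d := x, x := opp D d) \<and>
        nxt D' = (nxt D)(p := x, x := y, y := c) \<and>
        outer D' = outer D \<union> {x, y} \<and>
        (\<forall>e\<in>darts D. org D' e =
           (if org D e = org D c then if e \<in> orbit (rot D') d then v1 else v2 else org D e)) \<and>
        org D' x = v2 \<and> org D' y = org D' (opp D d)"
    using assms(3) unfolding expansion1_def by (elim bexE exE) rule
  then have p: "p \<in> outer D" "c = nxt D p" and d: "d \<in> darts D" "org D d = org D c"
    and xy: "x \<notin> darts D" "y \<notin> darts D" "x \<noteq> y" and D': "darts D' = darts D \<union> {x, y}"
      "opp D' = (opp D)(d := y, y := d, opp D d := x, x := opp D d)"
      "nxt D' = (nxt D)(p := x, x := y, y := c)" "outer D' = outer D \<union> {x, y}" by simp_all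
  have pD: "p \<in> darts D" "c \<in> darts D" using p D.outer_sub D.nxt_in by auto
  let ?O = "orbit (\<phi> \<circ> opp D) d"
  \<comment> \<open>The corner of \<open>p\<close> need not lie at the vertex of \<open>d\<close> in
    the cut system, so another outer corner there is used. If there were none, the rotation of the
    cut system at \<open>d\<close> would coincide with that of \<open>D\<close> and would reach the
    corner of \<open>p\<close>.\<close>
  have "\<exists>q\<in>outer D. \<phi> q \<in> ?O"
  proof (rule ccontr)
    assume no: "\<not> ?thesis"
    have stay: "e \<in> ?O" if "e \<in> orbit (rot D) d" for e
    proof -
      have st: "rot D e \<in> ?O" if "e \<in> ?O" for e
      proof -
        have e: "e \<in> darts D" using that rot.orbit_sub[OF d(1)] by blast
        have "\<phi> (opp D e) \<in> ?O" using orbit.step[OF that] by simp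
        then have "opp D e \<notin> outer D" using no by blast
        then have "\<phi> (opp D e) = rot D e" using \<phi>(2) D.opp(1)[OF e] by (simp add: rot_def)
        then show ?thesis using \<open>\<phi> (opp D e) \<in> ?O\<close> by simp
      qed
      show ?thesis using that
      proof induction
        case base
        show ?case by (rule st[OF rot.self_orbit[OF d(1)]])
      next
        case (step y)
        show ?case by (rule st[OF step.IH])
      qed
    qed
    let ?e = "opp D p"
    have e: "?e \<in> darts D" "rot D ?e = c" using D.opp[OF pD(1)] p by (auto simp: rot_def)
    have "c \<in> orbit (rot D) d" using D.org_eq_iff[OF d(1) pD(2)] d(2) by simp
    then have "?e \<in> orbit (rot D) d"
      using D.rot.orbit_eq[OF d(1), of c] D.rot.orbit_eq[OF e(1), of c] e orbit.base[of "rot D" ?e]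
        D.rot.self_orbit[OF e(1)] by simp
    then have "?e \<in> ?O" by (rule stay)
    then have "\<phi> (opp D ?e) \<in> ?O" using orbit.step[of ?e "\<phi> \<circ> opp D" d] by simp
    then show False using no p(1) D.opp(3)[OF pD(1)] by auto
  qed
  then obtain q where q: "q \<in> outer D" "\<phi> q \<in> ?O" by blast
  have qD: "q \<in> darts D" using q outer_sub by blast
  let ?\<psi> = "\<phi>(q := x, x := y, y := \<phi> q)"
  note ex = expand_planar[OF q(1) d(1) q(2) xy]
  \<comment> \<open>Both copies inherit the label of the edge. Hence a boundary word only gains a
    cancelling pair, and by \<open>area_delete_pair\<close> the cost does not drop.\<close>
  define lab' where "lab' = lab(x := lab d, y := inv_letter (lab d))"
  have lab_eq: "lab' e = lab e" if "e \<in> darts D" for e using that xy by (auto simp: lab'_def)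
  have neq: "p \<noteq> x" "p \<noteq> y" "q \<noteq> x" "q \<noteq> y" using pD qD xy by auto
  have non: "e \<in> darts D - outer D" "nxt D' e = nxt D e" "\<phi> e = nxt D e" "?\<psi> e = nxt D e"
    if "e \<in> darts D' - outer D'" for e
  proof -
    show e: "e \<in> darts D - outer D" using that D' by auto
    then have "e \<noteq> p" "e \<noteq> q" "e \<noteq> x" "e \<noteq> y" using p q xy by auto
    then show "nxt D' e = nxt D e" "\<phi> e = nxt D e" "?\<psi> e = nxt D e" using D' \<phi>(2)[OF e] by auto
  qed
  have "labelled D' lab'"
    unfolding labelled_def
  proof (intro conjI ballI)
    fix e assume e: "e \<in> darts D'"
    have ne: "d \<noteq> x" "d \<noteq> y" "opp D d \<noteq> x" "opp D d \<noteq> y" "opp D d \<noteq> d" "opp D (opp D d) = d"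
      using d D.opp[OF d(1)] xy by auto
    have lx: "lab' x = lab d" "lab' y = inv_letter (lab d)" using xy by (simp_all add: lab'_def)
    have L: "fst (lab b) \<in> A" "lab (opp D b) = inv_letter (lab b)" if "b \<in> darts D" for b
      using lab that by (auto simp: labelled_def)
    from e D'(1) consider "e = x" | "e = y" | "e \<in> darts D" by blast
    then show "fst (lab' e) \<in> A" by cases (use lx L d(1) lab_eq in simp_all)
    from e D'(1) consider "e = x" | "e = y" | "e = d" | "e = opp D d"
      | "e \<in> darts D" "e \<noteq> x" "e \<noteq> y" "e \<noteq> d" "e \<noteq> opp D d" using xy by blast
    then show "lab' (opp D' e) = inv_letter (lab' e)"
    proof cases
      case 5
      then have "opp D' e = opp D e" by (simp add: D')
      then show ?thesis using L(2)[OF 5(1)] lab_eq D.opp(1) 5(1) by simp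
    qed (use D'(2) ne ne[symmetric] xy(3) lx L[OF d(1)] lab_eq[OF d(1)] lab_eq[OF D.opp(1)[OF d(1)]] in simp_all)
  next
    fix e assume e: "e \<in> darts D' - outer D'"
    have eD: "e \<in> darts D" using non(1)[OF e] by blast
    have zs: "is_cycle (nxt D') (cycle_from (nxt D') e)" "hd (cycle_from (nxt D') e) = e"
      "set (cycle_from (nxt D') e) = orbit (nxt D') e" using D'.nxt.cycle_from e by auto
    have f: "orbit (nxt D') e \<in> cells D'" using D'.orbit_nonouter e by blast
    have inn: "a \<in> darts D' - outer D'" if "a \<in> orbit (nxt D') e" for a
      using D'.cell_sub[OF f] D'.cell_outer[OF f that] that by blast
    have "is_cycle (nxt D) (cycle_from (nxt D') e)"
      using zs is_cycle_cong[of "cycle_from (nxt D') e" "nxt D'" "nxt D"] non(2) inn by blast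
    from cycle_from_eq[OF this] have "cycle_from (nxt D) e = cycle_from (nxt D') e" unfolding zs(2) .
    moreover have "map lab' (cycle_from (nxt D') e) = map lab (cycle_from (nxt D') e)"
    proof (rule map_cong[OF HOL.refl])
      fix a assume "a \<in> set (cycle_from (nxt D') e)"
      then have "a \<in> darts D' - outer D'" using zs(3) inn by simp
      from non(1)[OF this] show "lab' a = lab a" using lab_eq by simp
    qed
    moreover have "map lab (cycle_from (nxt D) e) \<in> Q"
      using lab non(1)[OF e] unfolding labelled_def by blast
    ultimately show "map lab' (cycle_from (nxt D') e) \<in> Q" by metis
  qed
  then have "cut_system D' lab' ?\<psi>"
    using assms(2) ex(1) non(2,4) D' by (simp add: cut_system_def)
  moreover have "cost \<phi> lab (outer D) \<le> cost ?\<psi> lab' (outer D')"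
  proof -
    interpret \<psi>: planar_system ?\<psi> "darts D'" "opp D'" "outer D'" using ex(1) D' by simp
    let ?Y = "outer D - orbit \<phi> q"
    have Y: "outer D' - orbit ?\<psi> q = ?Y" unfolding D' ex(2) using outer_sub xy by blast
    obtain ys where ys: "is_cycle \<phi> (ys @ [q])" "set (ys @ [q]) = orbit \<phi> q" by (rule cycle_last[OF qD])
    have ysD: "set ys \<subseteq> darts D" "q \<notin> set ys" using ys orbit_sub[OF qD] by (auto simp: is_cycle_def)
    have cy: "is_cycle ?\<psi> (ys @ [q, x, y])"
      by (rule is_cycle_expand[OF ys(1) _ _ xy(3)]) (use ysD qD xy in auto)
    have "cost ?\<psi> lab' ?Y = cost \<phi> lab ?Y"
    proof (rule cost_cong[OF finite_perm_axioms])
      fix e assume e: "e \<in> ?Y"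
      then have eD: "e \<in> darts D" using outer_sub by blast
      show "lab' e = lab e" by (rule lab_eq[OF eD])
      have o: "orbit \<phi> e \<inter> orbit \<phi> q = {}" using orbit_outside[OF qD eD] e by blast
      then show "orbit \<phi> e \<subseteq> ?Y" using orbit_outer[of e] e by blast
      have "q \<notin> orbit \<phi> e" using o self_orbit[OF qD] by blast
      then show "orbit ?\<psi> e = orbit \<phi> e \<and> cycle_from ?\<psi> e = cycle_from \<phi> e" by (rule ex(3)[OF eD])
    qed (use outer_sub in auto)
    moreover have "cost \<phi> lab (outer D) = cost \<phi> lab ?Y + area (map lab (ys @ [q]))"
      using cost_remove_orbit[OF finite_perm_axioms outer_sub orbit_outer q(1)] cost_cycle[OF ys(1)] ys(2)
      by simp
    moreover have "cost ?\<psi> lab' (outer D') = cost ?\<psi> lab' ?Y + area (map lab' (ys @ [q, x, y]))"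
      using cost_remove_orbit[OF \<psi>.finite_perm_axioms \<psi>.outer_sub \<psi>.orbit_outer, of q lab']
        cost_cycle[OF cy, of lab'] orbit_cycle[OF cy, of q] q(1) Y D'(4) by simp
    moreover have "area (map lab (ys @ [q])) \<le> area (map lab' (ys @ [q, x, y]))"
    proof -
      have "map lab' ys = map lab ys" "lab' q = lab q" using ysD lab_eq qD by (auto simp: subset_iff)
      then have "map lab' (ys @ [q, x, y]) = map lab (ys @ [q]) @ [lab d, inv_letter (lab d)]"
        using xy by (simp add: lab'_def)
      then show ?thesis unfolding \<open>map lab' (ys @ [q, x, y]) = _\<close>
        using area_delete_pair[of "map lab (ys @ [q])" "lab d"]
          area_rotate[of "[lab d, inv_letter (lab d)]" "map lab (ys @ [q])"] by simp
    qed
    ultimately show ?thesis by (simp add: add_left_mono)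
  qed
  ultimately show ?thesis by blast
qed

lemma shelling_move_cost:
  assumes "cut_system D lab \<phi>" "diagram D'" "shelling_move D D'"
  shows "\<exists>lab' \<psi>. cut_system D' lab' \<psi> \<and> cost \<phi> lab (outer D) \<le> cost \<psi> lab' (outer D') + 1"
proof -
  have "a \<le> b \<Longrightarrow> a \<le> b + 1" for a b :: enat by (meson le_iff_add order_trans)
  with collapse1_cost[OF assms(1,2)] expansion1_cost[OF assms(1,2)] collapse2_cost[OF assms(1,2)]
    assms(3) show ?thesis unfolding shelling_move_def by blast
qed

end

section \<open>Area and fragmenting shellings\<close>

definition cyclic_relators :: "'a word set \<Rightarrow> 'a word set" where
  "cyclic_relators R = {rotate n r | n r. r \<in> R \<union> inv_word ` R}"

lemma relators_cyclic_relators: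
  assumes "R \<subseteq> words A" shows "relators A (cyclic_relators R)"
proof
  fix u v assume "u @ v \<in> cyclic_relators R"
  then obtain n r where r: "r \<in> R \<union> inv_word ` R" "u @ v = rotate n r" by (auto simp: cyclic_relators_def)
  have "v @ u = rotate (length u) (u @ v)" by (simp add: rotate_append)
  also have "\<dots> = rotate (length u + n) r" using r by (simp add: rotate_rotate)
  finally show "v @ u \<in> cyclic_relators R" using r(1) unfolding cyclic_relators_def by blast
next
  have "inv_word r \<in> words A" if "r \<in> words A" for r
    using that by (fastforce simp: inv_word_def words_def inv_letter_def)
  then have "r \<in> words A" if "r \<in> R \<union> inv_word ` R" for r using that assms by auto
  then show "cyclic_relators R \<subseteq> words A"
    by (auto simp: cyclic_relators_def words_def lists_eq_set; blast)
qed

text \<open>Without the exclusion of empty words there would be infinitely many lists of a given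
  total length.\<close>

definition word_lists :: "'a set \<Rightarrow> nat \<Rightarrow> 'a word list set" where
  "word_lists A l = {ws. [] \<notin> set ws \<and> set ws \<subseteq> words A \<and> length (concat ws) = l}"

text \<open>The first letter is one of \<open>2 * card A\<close>, and it either forms a word by
  itself or is continued by the next word; this gives the factor \<open>4 * card A\<close> per
  letter.\<close>

lemma card_word_lists:
  assumes "finite A" shows "finite (word_lists A l) \<and> card (word_lists A l) \<le> (4 * card A) ^ l"
proof (induction l)
  case 0
  have "word_lists A 0 = {[]}"
  proof -
    have "ws = []" if "ws \<in> word_lists A 0" for ws
      using that by (cases ws) (auto simp: word_lists_def)
    then show ?thesis by (auto simp: word_lists_def)
  qed
  then show ?case by simp
next
  case (Suc l)
  let ?f = "\<lambda>(x, b, ws). if b then [x] # ws else (x # hd ws) # tl ws"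
  let ?S = "(A \<times> (UNIV :: bool set)) \<times> (UNIV :: bool set) \<times> word_lists A l"
  have "word_lists A (Suc l) \<subseteq> ?f ` ?S"
  proof
    fix ws assume ws: "ws \<in> word_lists A (Suc l)"
    then obtain x u rest where e: "ws = (x # u) # rest"
      by (cases ws; cases "hd ws") (auto simp: word_lists_def)
    show "ws \<in> ?f ` ?S"
    proof (cases "u = []")
      case True
      then show ?thesis using ws e
        by (intro image_eqI[of _ _ "(x, True, rest)"]) (auto simp: word_lists_def words_def mem_Times_iff)
    next
      case False
      then show ?thesis using ws e
        by (intro image_eqI[of _ _ "(x, False, u # rest)"]) (auto simp: word_lists_def words_def mem_Times_iff)
    qed
  qed
  moreover have "finite ?S" using Suc assms by simp
  ultimately have "finite (word_lists A (Suc l))" "card (word_lists A (Suc l)) \<le> card ?S"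
    by (auto intro: finite_subset surj_card_le)
  moreover have "card ?S \<le> (4 * card A) ^ Suc l" using Suc by (simp add: card_cartesian_product)
  ultimately show ?case by simp
qed

text \<open>The stages of a shelling have different perimeters; admitting all of them up to
  \<open>L\<close> raises the base by one only.\<close>

lemma sum_powers_le: "(\<Sum>l\<le>L. c ^ l) \<le> (c + 1) ^ (L :: nat)" for c :: nat
proof (induction L)
  case (Suc L)
  have "c ^ L \<le> (c + 1) ^ L" by (simp add: power_mono)
  then have "c * c ^ L \<le> c * (c + 1) ^ L" by (rule mult_left_mono) simp
  from add_mono[OF this Suc] show ?case by (simp add: algebra_simps)
qed simp

section \<open>Counting costs along a fragmenting shelling\<close>

context relators
begin

definition cost_values :: "nat \<Rightarrow> enat set" where
  "cost_values l = (\<lambda>ws. \<Sum>w\<leftarrow>ws. area w) ` word_lists A l"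

lemma card_cost_values:
  assumes "finite A"
  shows "finite (\<Union>l\<le>L. cost_values l)" "card (\<Union>l\<le>L. cost_values l) \<le> (4 * card A + 1) ^ L"
proof -
  note c = card_word_lists[OF assms]
  show "finite (\<Union>l\<le>L. cost_values l)" using c by (auto simp: cost_values_def)
  have "card (\<Union>l\<le>L. cost_values l) \<le> (\<Sum>l\<le>L. card (cost_values l))" by (rule card_UN_le) simp
  also have "\<dots> \<le> (\<Sum>l\<le>L. (4 * card A) ^ l)"
  proof (rule sum_mono)
    fix l show "card (cost_values l) \<le> (4 * card A) ^ l"
      unfolding cost_values_def using c[of l] card_image_le order_trans by blast
  qed
  also have "\<dots> \<le> (4 * card A + 1) ^ L" by (rule sum_powers_le)
  finally show "card (\<Union>l\<le>L. cost_values l) \<le> (4 * card A + 1) ^ L" .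
qed

lemma cost_values_add: "u \<in> cost_values k \<Longrightarrow> v \<in> cost_values l \<Longrightarrow> u + v \<in> cost_values (k + l)"
proof -
  assume "u \<in> cost_values k" "v \<in> cost_values l"
  then obtain us vs where *: "us \<in> word_lists A k" "vs \<in> word_lists A l"
    "u = (\<Sum>w\<leftarrow>us. area w)" "v = (\<Sum>w\<leftarrow>vs. area w)" by (auto simp: cost_values_def)
  then show ?thesis unfolding cost_values_def
    by (intro image_eqI[of _ _ "us @ vs"]) (auto simp: word_lists_def)
qed

text \<open>A cut rearranges the outer darts into other circuits but keeps their number, so the
  boundary words together have length \<open>perimeter D\<close>.\<close>

lemma cost_in_values:
  assumes "cut_system D lab \<phi>"
  shows "cost \<phi> lab (outer D) \<in> cost_values (perimeter D)"
proof -
  have lab: "labelled D lab" and "planar_system \<phi> (darts D) (opp D) (outer D)"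
    using assms by (auto simp: cut_system_def)
  from this(2) interpret planar_system \<phi> "darts D" "opp D" "outer D" .
  let ?O = "orbit \<phi> ` outer D" and ?e = "\<lambda>\<beta>. SOME e. e \<in> \<beta>"
  let ?w = "\<lambda>\<beta>. map lab (cycle_from \<phi> (?e \<beta>))"
  have fin: "finite (outer D)" using finite_subset[OF outer_sub finite_carrier] .
  then have "finite ?O" by simp
  \<comment> \<open>Listing the orbits and not the words keeps multiplicities, as different orbits
    may read the same word.\<close>
  from finite_distinct_list[OF this] obtain bs where "set bs = ?O \<and> distinct bs" by (rule exE)
  then have bs: "set bs = ?O" "distinct bs" by simp_all
  have rep: "?e \<beta> \<in> outer D" "orbit \<phi> (?e \<beta>) = \<beta>" "\<beta> \<subseteq> outer D" if "\<beta> \<in> ?O" for \<beta>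
  proof -
    obtain e where e: "e \<in> outer D" "\<beta> = orbit \<phi> e" using \<open>\<beta> \<in> ?O\<close> by blast
    then have eB: "e \<in> darts D" using outer_sub by blast
    then have "e \<in> \<beta>" using self_orbit e by simp
    then have r: "?e \<beta> \<in> \<beta>" by (rule someI)
    show sub: "\<beta> \<subseteq> outer D" using orbit_outer e by simp
    then show "?e \<beta> \<in> outer D" using r by blast
    show "orbit \<phi> (?e \<beta>) = \<beta>" using orbit_eq[OF eB] r e(2) by simp
  qed
  have cycle_from': "set (cycle_from \<phi> (?e \<beta>)) = \<beta>" "cycle_from \<phi> (?e \<beta>) \<noteq> []" "length (cycle_from \<phi> (?e \<beta>)) = card \<beta>"
    if "\<beta> \<in> ?O" for \<beta>
  proof -
    have "?e \<beta> \<in> darts D" using rep(1)[OF that] outer_sub by blast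
    note c = cycle_from[OF this]
    show s: "set (cycle_from \<phi> (?e \<beta>)) = \<beta>" using c(3) rep(2)[OF that] by simp
    show "cycle_from \<phi> (?e \<beta>) \<noteq> []" using c(1) by (simp add: is_cycle_def)
    show "length (cycle_from \<phi> (?e \<beta>)) = card \<beta>" using c(1) distinct_card s unfolding is_cycle_def by metis
  qed
  have "cost \<phi> lab (outer D) = (\<Sum>\<beta>\<leftarrow>bs. area (?w \<beta>))"
    unfolding cost_def using sum.distinct_set_conv_list[OF bs(2)] bs(1) by metis
  moreover have "map ?w bs \<in> word_lists A (perimeter D)"
    unfolding word_lists_def
  proof (intro CollectI conjI)
    show "[] \<notin> set (map ?w bs)" using cycle_from'(2) bs(1) by auto
    show "set (map ?w bs) \<subseteq> words A"
    proof -
      have "?w \<beta> \<in> words A" if "\<beta> \<in> ?O" for \<beta>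
      proof -
        have "fst (lab e) \<in> A" if "e \<in> \<beta>" for e
          using that rep(3)[OF \<open>\<beta> \<in> ?O\<close>] outer_sub lab unfolding labelled_def by blast
        then have "lab e \<in> A \<times> UNIV" if "e \<in> set (cycle_from \<phi> (?e \<beta>))" for e
          using that cycle_from'(1)[OF \<open>\<beta> \<in> ?O\<close>] by (simp add: mem_Times_iff)
        then show ?thesis unfolding words_def in_lists_conv_set by auto
      qed
      then show ?thesis using bs(1) by auto
    qed
    have "length (concat (map ?w bs)) = (\<Sum>\<beta>\<leftarrow>bs. length (?w \<beta>))" by (simp add: length_concat comp_def)
    also have "\<dots> = (\<Sum>\<beta>\<in>?O. length (?w \<beta>))"
      using sum.distinct_set_conv_list[OF bs(2), of "\<lambda>\<beta>. length (?w \<beta>)"] bs(1) by simp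
    also have "\<dots> = (\<Sum>\<beta>\<in>?O. card \<beta>)" using cycle_from'(3) by (intro sum.cong) auto
    also have "\<dots> = card (\<Union>?O)"
    proof (rule card_Union_disjoint[symmetric])
      show "pairwise disjnt ?O"
      proof (rule pairwiseI)
        have orb: "orbit \<phi> x = \<beta>" if "\<beta> \<in> ?O" "x \<in> \<beta>" for x \<beta>
          using orbit_eq[of "?e \<beta>" x] rep(1,2)[OF that(1)] that(2) outer_sub by auto
        fix \<beta> \<gamma> assume "\<beta> \<in> ?O" "\<gamma> \<in> ?O" "\<beta> \<noteq> \<gamma>"
        then show "disjnt \<beta> \<gamma>" unfolding disjnt_def using orb[of \<beta>] orb[of \<gamma>] by blast
      qed
      show "finite \<beta>" if "\<beta> \<in> ?O" for \<beta> using rep(3)[OF that] fin finite_subset by blast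
    qed
    also have "\<Union>?O = outer D" using rep(3) self_orbit outer_sub by blast
    finally show "length (concat (map ?w bs)) = perimeter D" by (simp add: perimeter_def)
  qed
  ultimately show ?thesis unfolding cost_values_def
    by (intro image_eqI[of _ _ "map ?w bs"]) (simp_all add: comp_def)
qed

text \<open>Each diagram of a stage carries its own labelling and cuts, since the diagrams of a
  multiset may share dart names.\<close>

type_synonym (in -) 'b system = "complex2 \<times> (nat \<Rightarrow> 'b letter) \<times> (nat \<Rightarrow> nat)"

fun system_ok :: "'a system \<Rightarrow> bool" where
  "system_ok (D, lab, \<phi>) = cut_system D lab \<phi>"

fun system_cost :: "'a system \<Rightarrow> enat" where
  "system_cost (D, lab, \<phi>) = cost \<phi> lab (outer D)"

lemma total_cost_in_values:
  assumes "\<And>t. t \<in># N \<Longrightarrow> system_ok t"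
  shows "(\<Sum>t\<in>#N. system_cost t) \<in> cost_values (\<Sum>t\<in>#N. perimeter (fst t))"
  using assms
proof (induction N)
  case empty
  show ?case by (auto simp: cost_values_def word_lists_def intro!: image_eqI[of _ _ "[]"])
next
  case (add t N)
  obtain D lab \<phi> where t: "t = (D, lab, \<phi>)" by (cases t)
  have "system_cost t \<in> cost_values (perimeter (fst t))"
    using cost_in_values[of D lab \<phi>] add.prems[of t] t by simp
  then show ?case using cost_values_add add by simp
qed

lemma fragmenting_move_cost:
  assumes "fragmenting_move M M'" "\<And>E. E \<in># M' \<Longrightarrow> diagram E"
    and N: "image_mset fst N = M" "\<And>t. t \<in># N \<Longrightarrow> system_ok t"
  shows "\<exists>N'. image_mset fst N' = M' \<and> (\<forall>t\<in>#N'. system_ok t) \<and>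
    (\<Sum>t\<in>#N. system_cost t) \<le> (\<Sum>t\<in>#N'. system_cost t) + 1"
proof -
  have split: "\<exists>lab \<phi> N0. N = add_mset (D, lab, \<phi>) N0 \<and> image_mset fst N0 = K \<and> cut_system D lab \<phi>"
    if MK: "M = K + {#D#}" for D K
  proof -
    have "image_mset fst N = add_mset D K" using N(1) MK by simp
    from msed_map_invR[OF this] obtain t N0 where t: "N = add_mset t N0" "fst t = D" "image_mset fst N0 = K"
      by blast
    then have "system_ok t" using N(2) by simp
    then show ?thesis using t by (cases t) auto
  qed
  from assms(1) consider
    (move) K D D' where "M = K + {#D#}" "M' = K + {#D'#}" "shelling_move D D'"
  | (frag) K D D' D'' where "M = K + {#D#}" "M' = K + {#D', D''#}" "fragmentation D D' D''"
    unfolding fragmenting_move_def by blast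
  then show ?thesis
  proof cases
    case move
    from split[OF move(1)] obtain lab \<phi> N0 where
      n: "N = add_mset (D, lab, \<phi>) N0" "image_mset fst N0 = K" "cut_system D lab \<phi>" by blast
    from shelling_move_cost[OF n(3) _ move(3)] assms(2) move(2) obtain lab' \<psi> where
      s: "cut_system D' lab' \<psi>" "cost \<phi> lab (outer D) \<le> cost \<psi> lab' (outer D') + 1" by auto
    show ?thesis
    proof (intro exI[of _ "add_mset (D', lab', \<psi>) N0"] conjI ballI)
      show "(\<Sum>t\<in>#N. system_cost t) \<le> (\<Sum>t\<in>#add_mset (D', lab', \<psi>) N0. system_cost t) + 1"
        using add_right_mono[OF s(2), of "\<Sum>t\<in>#N0. system_cost t"] n(1) by (simp add: ac_simps)
    qed (use n s(1) N(2) move(2) in auto)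
  next
    case frag
    from split[OF frag(1)] obtain lab \<phi> N0 where
      n: "N = add_mset (D, lab, \<phi>) N0" "image_mset fst N0 = K" "cut_system D lab \<phi>" by blast
    from fragmentation_cost[OF n(3) _ _ frag(3)] assms(2) frag(2) obtain \<psi> where
      s: "cut_system D' lab \<psi>" "cut_system D'' lab \<psi>"
        "cost \<phi> lab (outer D) \<le> cost \<psi> lab (outer D') + cost \<psi> lab (outer D'')" by auto
    show ?thesis
    proof (intro exI[of _ "N0 + {#(D', lab, \<psi>), (D'', lab, \<psi>)#}"] conjI ballI)
      have "(\<Sum>t\<in>#N. system_cost t) \<le> (\<Sum>t\<in>#N0 + {#(D', lab, \<psi>), (D'', lab, \<psi>)#}. system_cost t)"
        using add_right_mono[OF s(3), of "\<Sum>t\<in>#N0. system_cost t"] n(1) by (simp add: ac_simps)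
      then show "(\<Sum>t\<in>#N. system_cost t) \<le> (\<Sum>t\<in>#N0 + {#(D', lab, \<psi>), (D'', lab, \<psi>)#}. system_cost t) + 1"
        by (meson le_iff_add order_trans)
    qed (use n s(1,2) N(2) frag(2) in auto)
  qed
qed

text \<open>The total cost drops by at most one in every move and ends at zero. Hence it attains all values
  between zero and its initial value.\<close>

lemma shelling_cost_values:
  assumes "Ms \<noteq> []" "successively fragmenting_move Ms" "\<And>M E. M \<in> set Ms \<Longrightarrow> E \<in># M \<Longrightarrow> diagram E"
    and "\<And>E. E \<in># last Ms \<Longrightarrow> single_vertex E"
    and "\<And>M. M \<in> set Ms \<Longrightarrow> (\<Sum>E\<in>#M. perimeter E) \<le> L"
    and "image_mset fst N = hd Ms" "\<And>t. t \<in># N \<Longrightarrow> system_ok t"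
  shows "\<exists>n. (\<Sum>t\<in>#N. system_cost t) = enat n \<and> (\<forall>k\<le>n. enat k \<in> (\<Union>l\<le>L. cost_values l))"
  using assms
proof (induction Ms arbitrary: N)
  case (Cons M Ms)
  have "image_mset fst N = M" using Cons.prems(6) by simp
  then have "(\<Sum>t\<in>#N. perimeter (fst t)) = (\<Sum>E\<in>#M. perimeter E)" by (auto simp: image_mset.compositionality comp_def)
  then have val: "(\<Sum>t\<in>#N. system_cost t) \<in> (\<Union>l\<le>L. cost_values l)"
  proof -
    have "(\<Sum>t\<in>#N. system_cost t) \<in> cost_values (\<Sum>t\<in>#N. perimeter (fst t))"
      by (rule total_cost_in_values) (rule Cons.prems(7))
    then show ?thesis
      unfolding \<open>(\<Sum>t\<in>#N. perimeter (fst t)) = _\<close> using Cons.prems(5)[of M] by auto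
  qed
  show ?case
  proof (cases "Ms = []")
    case True
    have "system_cost t = 0" if "t \<in># N" for t
    proof -
      obtain D lab \<phi> where t: "t = (D, lab, \<phi>)" by (cases t)
      have "D \<in># M" using that t \<open>image_mset fst N = M\<close> by force
      then have "single_vertex D" "diagram D" using Cons.prems(3,4) True by auto
      then have "outer D = {}" by (auto simp: single_vertex_def diagram_def)
      then show ?thesis by (simp add: t cost_def)
    qed
    then have "image_mset system_cost N = image_mset (\<lambda>_. 0) N" by (intro image_mset_cong)
    then have "(\<Sum>t\<in>#N. system_cost t) = 0" by simp
    then show ?thesis using val by (auto simp: zero_enat_def)
  next
    case False
    then have "fragmenting_move M (hd Ms)" "successively fragmenting_move Ms"
      using Cons.prems(2) by (auto simp: successively_Cons)
    from fragmenting_move_cost[OF this(1) _ \<open>image_mset fst N = M\<close> Cons.prems(7)] Cons.prems(3) False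
    obtain N' where N': "image_mset fst N' = hd Ms" "\<forall>t\<in>#N'. system_ok t"
      "(\<Sum>t\<in>#N. system_cost t) \<le> (\<Sum>t\<in>#N'. system_cost t) + 1" by (metis hd_in_set list.set_intros(2))
    have "\<exists>n. (\<Sum>t\<in>#N'. system_cost t) = enat n \<and> (\<forall>k\<le>n. enat k \<in> (\<Union>l\<le>L. cost_values l))"
      by (rule Cons.IH) (use False \<open>successively fragmenting_move Ms\<close> Cons.prems N' in auto)
    then obtain n where n: "(\<Sum>t\<in>#N'. system_cost t) = enat n" "\<forall>k\<le>n. enat k \<in> (\<Union>l\<le>L. cost_values l)" by blast
    then have le: "(\<Sum>t\<in>#N. system_cost t) \<le> enat (Suc n)" using N'(3) by (simp add: one_enat_def)
    then obtain m where m: "(\<Sum>t\<in>#N. system_cost t) = enat m" "m \<le> Suc n"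
      by (cases "\<Sum>t\<in>#N. system_cost t") auto
    have "enat k \<in> (\<Union>l\<le>L. cost_values l)" if "k \<le> m" for k
    proof (cases "k \<le> n")
      case False
      then have "k = m" using that m(2) by simp
      then show ?thesis using val m(1) by simp
    qed (use n(2) in blast)
    then show ?thesis using m(1) by blast
  qed
qed simp

lemma fragmenting_shelling_area:
  assumes "finite A" "full_fragmenting_shelling D Ms" "labelled D lab" "diagram D"
  shows "\<exists>n. cost (nxt D) lab (outer D) = enat n \<and> Suc n \<le> (4 * card A + 1) ^ fragmenting_length Ms"
proof -
  let ?L = "fragmenting_length Ms"
  let ?N = "{#(D, lab, nxt D)#}"
  have Ms: "Ms \<noteq> []" "hd Ms = {#D#}" "\<forall>M\<in>set Ms. \<forall>E\<in>#M. diagram E" "successively fragmenting_move Ms"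
    "\<forall>E\<in>#last Ms. single_vertex E" using assms(2) by (auto simp: full_fragmenting_shelling_def)
  have "\<exists>n. (\<Sum>t\<in>#?N. system_cost t) = enat n \<and> (\<forall>k\<le>n. enat k \<in> (\<Union>l\<le>?L. cost_values l))"
  proof (rule shelling_cost_values[OF Ms(1,4)])
    show "(\<Sum>E\<in>#M. perimeter E) \<le> ?L" if "M \<in> set Ms" for M
      unfolding fragmenting_length_def by (rule Max_ge) (use that in auto)
    show "t \<in># ?N \<Longrightarrow> system_ok t" for t using cut_system_nxt assms(3,4) by simp
  qed (use Ms in auto)
  then obtain n where n: "cost (nxt D) lab (outer D) = enat n" "\<forall>k\<le>n. enat k \<in> (\<Union>l\<le>?L. cost_values l)"
    by auto
  have "Suc n = card (enat ` {..n})" by (subst card_image) (auto simp: inj_on_def)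
  also have "\<dots> \<le> card (\<Union>l\<le>?L. cost_values l)"
    by (rule card_mono[OF card_cost_values(1)[OF assms(1)]]) (use n(2) in blast)
  also have "\<dots> \<le> (4 * card A + 1) ^ ?L" by (rule card_cost_values(2)[OF assms(1)])
  finally show ?thesis using n(1) by blast
qed

end

lemma circuit_word_cycle_from: "circuit_word D lab d = map lab (cycle_from (nxt D) d)"
  by (simp add: circuit_word_def cycle_from_def)

text \<open>A van Kampen diagram provides one dart per cell from which a relator or its inverse is
  read; rotation supplies the others.\<close>

lemma van_kampen_labelled:
  assumes "van_kampen A R w D v lab" "R \<subseteq> words A"
  shows "relators.labelled A (cyclic_relators R) D lab"
proof -
  interpret relators A "cyclic_relators R" by (rule relators_cyclic_relators[OF assms(2)])
  interpret D: diag D using assms(1) by unfold_locales (simp add: van_kampen_def)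
  show ?thesis unfolding labelled_def
  proof (intro conjI ballI)
    fix d assume "d \<in> darts D"
    then show "fst (lab d) \<in> A" "lab (opp D d) = inv_letter (lab d)"
      using assms(1) by (auto simp: van_kampen_def)
  next
    fix d assume d: "d \<in> darts D - outer D"
    let ?f = "orbit (nxt D) d"
    have f: "?f \<in> cells D" "d \<in> ?f" using D.orbit_nonouter D.nxt.self_orbit d by auto
    then obtain e where e: "e \<in> ?f" "circuit_word D lab e \<in> R \<union> inv_word ` R"
      using assms(1) by (auto simp: van_kampen_def)
    have eD: "e \<in> darts D" using e(1) f(1) D.cell_sub by blast
    have "d \<in> set (cycle_from (nxt D) e)" using D.nxt.cycle_from(3)[OF eD] D.nxt.orbit_eq[of d e] e(1) f(2) d by simp
    from cycle_starting_at[OF D.nxt.cycle_from(1)[OF eD] this] obtain u v where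
      uv: "cycle_from (nxt D) e = u @ d # v" "cycle_from (nxt D) d = d # v @ u" by metis
    have "map lab u @ map lab (d # v) = rotate 0 (circuit_word D lab e)"
      unfolding circuit_word_cycle_from uv(1) by simp
    then have "map lab u @ map lab (d # v) \<in> cyclic_relators R"
      using e(2) unfolding cyclic_relators_def by blast
    from rotate_relator[OF this] show "map lab (cycle_from (nxt D) d) \<in> cyclic_relators R" unfolding uv(2) by simp
  qed
qed

lemma fillable_of_shelling:
  assumes "finite A" "R \<subseteq> words A" "van_kampen A R w D v lab" "full_fragmenting_shelling D Ms"
  shows "\<exists>n. fillable A (cyclic_relators R) n w \<and> Suc n \<le> (4 * card A + 1) ^ fragmenting_length Ms"
proof -
  interpret relators A "cyclic_relators R" by (rule relators_cyclic_relators[OF assms(2)])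
  have D: "diagram D" using assms(3) by (simp add: van_kampen_def)
  interpret D: diag D by unfold_locales (rule D)
  have "area w = cost (nxt D) lab (outer D)"
  proof (cases "outer D = {}")
    case True
    then show ?thesis using assms(3) by (simp add: van_kampen_def cost_def)
  next
    case False
    then obtain d where d: "d \<in> outer D" "circuit_word D lab d = w"
      using assms(3) by (auto simp: van_kampen_def)
    have "d \<in> darts D" using d(1) D.outer_sub by blast
    from cost_cycle[OF D.nxt.cycle_from(1)[OF this], of lab] D.nxt.cycle_from(3)[OF this] D.orbit_outer[OF d(1)] d(2)
    show ?thesis by (simp add: circuit_word_cycle_from)
  qed
  then show ?thesis
    using fragmenting_shelling_area[OF assms(1,4) van_kampen_labelled[OF assms(3,2)] D] area_enatD by metis
qed

section \<open>Van Kampen diagrams of fillable words\<close>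

definition vertex_steps :: "complex2 \<Rightarrow> (nat \<times> nat) set" where
  "vertex_steps D = {(org D d, org D (opp D d)) | d. d \<in> darts D}"

lemma connected_complex_steps: "connected_complex D \<longleftrightarrow>
    verts D \<noteq> {} \<and> (\<forall>u\<in>verts D. \<forall>v\<in>verts D. (u, v) \<in> (vertex_steps D)\<^sup>*)"
  unfolding connected_complex_def vertex_steps_def ..

lemma vertex_stepI: "d \<in> darts D \<Longrightarrow> (org D d, org D (opp D d)) \<in> vertex_steps D"
  unfolding vertex_steps_def by blast

lemma rtrancl_map:
  assumes "(x, y) \<in> r\<^sup>*" "\<And>a b. (a, b) \<in> r \<Longrightarrow> (h a, h b) \<in> s\<^sup>*"
  shows "(h x, h y) \<in> s\<^sup>*"
  using assms(1) by (induction rule: rtrancl_induct) (auto intro: rtrancl_trans assms(2))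

lemma permutes_comp_transpose: "f permutes S \<Longrightarrow> S \<subseteq> T \<Longrightarrow> a \<in> T \<Longrightarrow> b \<in> T \<Longrightarrow> (f \<circ> transpose a b) permutes T"
  by (meson permutes_compose permutes_subset permutes_swap_id)

lemma orbit_rot_fibre:
  "diagram D \<Longrightarrow> d \<in> darts D \<Longrightarrow> orbit (rot D) d = {e \<in> darts D. org D e = org D d}"
proof -
  assume "diagram D" and d: "d \<in> darts D"
  then interpret diag D by unfold_locales
  have "e \<in> orbit (rot D) d \<longleftrightarrow> org D e = org D d" if "e \<in> darts D" for e
    using org_eq_iff[OF d that] by metis
  then show ?thesis using rot.orbit_sub[OF d] by blast
qed

lemma cells_eq: "diagram D \<Longrightarrow> cells D = orbit (nxt D) ` (darts D - outer D)"
proof -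
  assume "diagram D"
  then interpret diag D by unfold_locales
  show ?thesis
  proof
    show "cells D \<subseteq> orbit (nxt D) ` (darts D - outer D)"
    proof
      fix f assume f: "f \<in> cells D"
      then obtain d where d: "d \<in> f" using cell_ne by blast
      have "orbit (nxt D) d = f" "d \<in> darts D - outer D"
        using orbit_cell[OF f d] cell_sub[OF f] cell_outer[OF f d] d by auto
      then show "f \<in> orbit (nxt D) ` (darts D - outer D)" by blast
    qed
  qed (use orbit_nonouter in blast)
qed

section \<open>Attaching an edge with a free end\<close>

locale spike =
  fixes D :: complex2 and v a b m :: nat and cs :: "nat list"
  assumes D: "diagram D"
    and v: "v \<in> verts D" and new: "a \<notin> darts D" "b \<notin> darts D" "a \<noteq> b" "m \<notin> verts D"
    and cs: "if outer D = {} then cs = []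
      else is_cycle (nxt D) cs \<and> set cs = outer D \<and> org D (hd cs) = v"
begin

text \<open>Writing the maps as products with transpositions makes the permutation properties
  immediate. As \<open>nxt D\<close> and \<open>opp D\<close> fix the new darts, the effect is to
  insert \<open>a\<close> and \<open>b\<close> after \<open>last cs\<close>. For empty
  \<open>cs\<close> the second transposition is trivial and \<open>a\<close>, \<open>b\<close> form
  the whole circuit.\<close>

definition S :: complex2 where
  "S = \<lparr>verts = insert m (verts D), darts = insert a (insert b (darts D)),
    org = (org D)(a := v, b := m), opp = opp D \<circ> transpose a b,
    nxt = nxt D \<circ> transpose a b \<circ> transpose (if cs = [] then b else last cs) b,
    outer = set (a # b # cs)\<rparr>"

sublocale diag D by unfold_locales (rule D)

lemma S_simps [simp]: "verts S = insert m (verts D)" "darts S = insert a (insert b (darts D))"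
    "outer S = set (a # b # cs)" "org S = (org D)(a := v, b := m)"
  by (simp_all add: S_def)

lemma nxt_fix: "nxt D a = a" "nxt D b = b" and opp_fix: "opp D a = a" "opp D b = b"
  using D new unfolding diagram_def by (auto intro: permutes_not_in)

lemma opp_S: "opp S a = b" "opp S b = a" "e \<in> darts D \<Longrightarrow> opp S e = opp D e"
  using new opp_fix by (auto simp: S_def transpose_def)

lemma cs_darts: "set cs \<subseteq> darts D" using cs outer_sub by (auto split: if_splits)

lemma nxt_S: "nxt S a = b" "e \<in> darts D \<Longrightarrow> e \<notin> outer D \<Longrightarrow> nxt S e = nxt D e"
  and nxt_S_Nil: "cs = [] \<Longrightarrow> nxt S b = a"
  and nxt_S_last: "cs \<noteq> [] \<Longrightarrow> nxt S (last cs) = a" "cs \<noteq> [] \<Longrightarrow> nxt S b = hd cs"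
  and nxt_S_other: "e \<in> darts D \<Longrightarrow> e \<noteq> last cs \<Longrightarrow> nxt S e = nxt D e"
proof -
  have l: "last cs \<in> darts D" "last cs \<in> outer D" "nxt D (last cs) = hd cs" if "cs \<noteq> []"
    using that cs cs_darts by (auto simp: is_cycle_def split: if_splits)
  then have "last cs \<noteq> a" "last cs \<noteq> b" if "cs \<noteq> []" using that new by auto
  note F = this l new new(3)[symmetric] nxt_fix
  have S: "nxt S = nxt D \<circ> transpose a b \<circ> transpose (if cs = [] then b else last cs) b"
    by (simp add: S_def)
  show "nxt S a = b" unfolding S using F by (cases "cs = []") (simp_all add: transpose_def)
  show "e \<in> darts D \<Longrightarrow> e \<notin> outer D \<Longrightarrow> nxt S e = nxt D e"
    unfolding S using F by (cases "cs = []") (auto simp: transpose_def)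
  show "cs = [] \<Longrightarrow> nxt S b = a" unfolding S using F by (simp add: transpose_def)
  show "cs \<noteq> [] \<Longrightarrow> nxt S (last cs) = a" unfolding S using F by (simp add: transpose_def)
  show "cs \<noteq> [] \<Longrightarrow> nxt S b = hd cs" unfolding S using F by (simp add: transpose_def)
  show "e \<in> darts D \<Longrightarrow> e \<noteq> last cs \<Longrightarrow> nxt S e = nxt D e"
    unfolding S using F by (cases "cs = []") (auto simp: transpose_def)
qed

lemma cycle_S: "is_cycle (nxt S) (a # b # cs)"
proof (cases "cs = []")
  case True
  then show ?thesis using new nxt_S(1) nxt_S_Nil by (simp add: is_cycle_def)
next
  case False
  then have c: "is_cycle (nxt D) cs" using cs by (auto split: if_splits)
  have "successively (\<lambda>x y. nxt S x = y) cs = successively (\<lambda>x y. nxt D x = y) cs"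
  proof (rule successively_fun_cong)
    fix x assume x: "x \<in> set (butlast cs)"
    then have "x \<noteq> last cs" using c last_notin_butlast by (auto simp: is_cycle_def)
    then show "nxt S x = nxt D x" using nxt_S_other cs_darts in_set_butlastD[OF x] by blast
  qed
  then show ?thesis using c new cs_darts nxt_S(1) nxt_S_last[OF False] False
    by (cases cs) (auto simp: is_cycle_def)
qed

lemma nxt_permutes: "nxt S permutes darts S"
proof -
  have p: "(if cs = [] then b else last cs) \<in> darts S" using subsetD[OF cs_darts last_in_set] by simp
  have "nxt D permutes darts D" using D by (simp add: diagram_def)
  then have f: "(nxt D \<circ> transpose a b) permutes darts S" by (rule permutes_comp_transpose) auto
  have S: "nxt S = nxt D \<circ> transpose a b \<circ> transpose (if cs = [] then b else last cs) b"
    by (simp add: S_def)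
  show ?thesis unfolding S by (rule permutes_comp_transpose[OF f subset_refl p]) simp
qed

lemma opp_permutes: "opp S permutes darts S"
proof -
  have "opp D permutes darts D" using D by (simp add: diagram_def)
  then have "(opp D \<circ> transpose a b) permutes darts S" by (rule permutes_comp_transpose) auto
  then show ?thesis by (simp add: S_def)
qed

lemma rot_S_b: "rot S b = b" using opp_S nxt_S by (simp add: rot_def)

lemma rot_S_other: assumes "e \<in> darts D" "org D e \<noteq> v" shows "rot S e = rot D e"
proof -
  have "opp D e \<noteq> last cs \<or> cs = []"
  proof (rule ccontr)
    assume *: "\<not> ?thesis"
    then have "org D (nxt D (opp D e)) = v" using cs by (auto simp: is_cycle_def split: if_splits)
    then show False using org_rot[OF assms(1)] assms(2) by (simp add: rot_def)
  qed
  moreover have "outer D = {}" if "cs = []" using that cs by (auto simp: is_cycle_def split: if_splits)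
  ultimately have "nxt S (opp D e) = nxt D (opp D e)"
    using nxt_S(2) nxt_S_other opp(1)[OF assms(1)] by blast
  then show ?thesis using opp_S(3)[OF assms(1)] by (simp add: rot_def)
qed

text \<open>The dart \<open>a\<close> enters the rotation at \<open>v\<close> in the outer corner,
  between \<open>opp D (last cs)\<close> and \<open>hd cs\<close>.\<close>

lemma rot_S_cycle: "\<exists>zs. is_cycle (rot S) (a # zs) \<and> set zs = {e \<in> darts D. org D e = v}"
proof (cases "cs = []")
  case True
  then have "outer D = {}" using cs by (auto simp: is_cycle_def split: if_splits)
  then have "darts D = {}" using outer_ne by blast
  moreover have "rot S a = a" using opp_S nxt_S_Nil[OF True] by (simp add: rot_def)
  ultimately show ?thesis by (intro exI[of _ "[]"]) (simp add: is_cycle_def)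
next
  case False
  then have c: "is_cycle (nxt D) cs" "set cs = outer D" "org D (hd cs) = v" using cs by (auto split: if_splits)
  let ?c = "hd cs" and ?p = "last cs"
  have cp: "?c \<in> darts D" "?p \<in> darts D" "nxt D ?p = ?c" using c False cs_darts by (auto simp: is_cycle_def)
  have rp: "opp D ?p \<in> darts D" "rot D (opp D ?p) = ?c" using cp opp by (auto simp: rot_def)
  obtain zs where zs: "is_cycle (rot D) (zs @ [opp D ?p])" "set (zs @ [opp D ?p]) = orbit (rot D) (opp D ?p)"
    by (rule rot.cycle_last[OF rp(1)])
  have hz: "hd (zs @ [opp D ?p]) = ?c" using zs(1) rp(2) by (simp add: is_cycle_def)
  have "org D (opp D ?p) = v" using org_nxt[OF cp(2)] cp(3) c(3) by simp
  then have set_zs: "set (zs @ [opp D ?p]) = {e \<in> darts D. org D e = v}"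
    unfolding zs(2) orbit_rot_fibre[OF D rp(1)] by simp
  have "successively (\<lambda>x y. rot S x = y) (zs @ [opp D ?p]) = successively (\<lambda>x y. rot D x = y) (zs @ [opp D ?p])"
  proof (rule successively_fun_cong)
    fix x assume x: "x \<in> set (butlast (zs @ [opp D ?p]))"
    then have "x \<in> darts D" "x \<noteq> opp D ?p" using set_zs zs(1) by (auto simp: is_cycle_def)
    then have "opp D x \<noteq> ?p" "opp D x \<in> darts D" using opp(1,3)[of x] by metis+
    then show "rot S x = rot D x" using nxt_S_other opp_S(3)[OF \<open>x \<in> darts D\<close>] by (simp add: rot_def)
  qed
  moreover have "rot S a = ?c" "rot S (opp D ?p) = a"
    using opp_S(1) opp_S(3)[OF rp(1)] nxt_S_last[OF False] opp(3)[OF cp(2)] by (simp_all add: rot_def)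
  moreover have "a \<notin> set (zs @ [opp D ?p])" using set_zs new(1) by auto
  ultimately have "is_cycle (rot S) (a # zs @ [opp D ?p])"
    using zs(1) hz unfolding is_cycle_def by (auto simp: successively_Cons)
  then show ?thesis using set_zs by blast
qed

lemma org_S: "d \<in> darts S \<Longrightarrow> e \<in> darts S \<Longrightarrow> org S d = org S e \<longleftrightarrow> e \<in> orbit (rot S) d"
proof -
  have fib: "orbit (rot S) d = {e \<in> darts S. org S e = org S d}" if d: "d \<in> darts S" for d
  proof -
    obtain zs where zs: "is_cycle (rot S) (a # zs)" "set zs = {e \<in> darts D. org D e = v}"
      using rot_S_cycle by blast
    have "m \<noteq> v" "b \<noteq> a" using v new by auto
    have om: "org D e \<noteq> m" if "e \<in> darts D" for e using org_in[OF that] new(4) by auto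
    have dn: "e \<noteq> a \<and> e \<noteq> b" if "e \<in> darts D" for e using that new by auto
    consider "d = b" | "d \<in> set (a # zs)" | "d \<in> darts D" "org D d \<noteq> v" using d zs(2) by auto
    then show ?thesis
    proof cases
      case 1
      then show ?thesis using rot_S_b orbit_eq_singleton_iff[of "rot S" b] om \<open>m \<noteq> v\<close> \<open>b \<noteq> a\<close> by auto
    next
      case 2
      have "set (a # zs) = {e \<in> darts S. org S e = v}" using zs(2) dn \<open>m \<noteq> v\<close> new(3) by auto
      moreover have "org S d = v" using 2 calculation by blast
      ultimately show ?thesis using orbit_cycle[OF zs(1) 2] by simp
    next
      case 3
      have "is_cycle (rot S) (cycle_from (rot D) d)"
        using is_cycle_cong[of "cycle_from (rot D) d" "rot S" "rot D"] rot.cycle_from[OF 3(1)] rot_S_other 3(2)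
          orbit_rot_fibre[OF D 3(1)] by auto
      from orbit_cycle[OF this, of d] have "orbit (rot S) d = orbit (rot D) d"
        using rot.cycle_from(3)[OF 3(1)] rot.self_orbit[OF 3(1)] by simp
      then show ?thesis using orbit_rot_fibre[OF D 3(1)] om[OF 3(1)] 3 dn by auto
    qed
  qed
  assume "d \<in> darts S" "e \<in> darts S"
  then show ?thesis using fib[of d] by auto
qed

lemma orbit_S: "e \<in> darts D - outer D \<Longrightarrow> orbit (nxt S) e = orbit (nxt D) e \<and> cycle_from (nxt S) e = cycle_from (nxt D) e"
proof -
  assume e: "e \<in> darts D - outer D"
  then have eD: "e \<in> darts D" by simp
  have "x \<in> darts D - outer D" if "x \<in> orbit (nxt D) e" for x
    using that e orbit_nonouter cell_sub cell_outer by blast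
  then have "is_cycle (nxt S) (cycle_from (nxt D) e)"
    using is_cycle_cong[of "cycle_from (nxt D) e" "nxt S" "nxt D"] nxt.cycle_from[OF eD] nxt_S(2) by auto
  from orbit_cycle[OF this, of e] cycle_from_eq[OF this] show ?thesis
    unfolding nxt.cycle_from(2,3)[OF eD] using nxt.self_orbit[OF eD] by simp
qed

lemma darts_S: "darts S = outer S \<union> (darts D - outer D)"
  using cs outer_sub by (auto split: if_splits)

lemma cells_S: "cells S = cells D"
proof -
  have e: "orbit (nxt S) ` outer S = {outer S}" "orbit (nxt S) ` (darts D - outer D) = cells D"
    using orbit_cycle[OF cycle_S] orbit_S cells_eq[OF D] by auto
  have "faces S = insert (outer S) (cells D)"
    unfolding faces_def darts_S image_Un e by blast
  moreover have "outer S \<notin> cells D" using cell_sub new(1) by auto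
  ultimately show ?thesis by (simp add: cells_def)
qed

lemma diagram_S: "diagram S"
  unfolding diagram_def
proof (intro conjI ballI)
  show "finite (verts S)" "finite (darts S)" using fin by simp_all
  show "opp S permutes darts S" "nxt S permutes darts S" by (rule opp_permutes nxt_permutes)+
  show "opp S d \<noteq> d" "opp S (opp S d) = d" if "d \<in> darts S" for d
    using that opp_S opp new(3) by auto
  show "org S ` darts S \<subseteq> verts S" using org_in v new by auto
  show "org S d = org S e \<longleftrightarrow> e \<in> orbit (rot S) d" if "d \<in> darts S" "e \<in> darts S" for d e
    by (rule org_S[OF that])
  show "if darts S = {} then outer S = {} else outer S \<in> faces S"
    using orbit_cycle[OF cycle_S, of a] by (auto simp: faces_def intro!: image_eqI[of _ _ a])
  have sub: "vertex_steps D \<subseteq> vertex_steps S"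
  proof
    fix z assume "z \<in> vertex_steps D"
    then obtain d where d: "d \<in> darts D" "z = (org D d, org D (opp D d))" by (auto simp: vertex_steps_def)
    then have "org S d = org D d" "org S (opp S d) = org D (opp D d)" "d \<in> darts S"
      using opp_S(3)[OF d(1)] opp(1)[OF d(1)] new by auto
    then show "z \<in> vertex_steps S" using vertex_stepI[of d S] d(2) by metis
  qed
  have vm: "(v, m) \<in> vertex_steps S" "(m, v) \<in> vertex_steps S"
    using vertex_stepI[of a S] vertex_stepI[of b S] opp_S new(3) by simp_all
  have old: "(u, w) \<in> (vertex_steps S)\<^sup>*" if "u \<in> verts D" "w \<in> verts D" for u w
    using that connected rtrancl_mono[OF sub] by (auto simp: connected_complex_steps)
  have mv: "(u, v) \<in> (vertex_steps S)\<^sup>*" "(v, u) \<in> (vertex_steps S)\<^sup>*" if "u \<in> verts S" for u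
    using that old[OF _ v] old[OF v] r_into_rtrancl[OF vm(1)] r_into_rtrancl[OF vm(2)]
    by (cases "u = m"; simp)+
  show "connected_complex S"
    unfolding connected_complex_steps using rtrancl_trans[OF mv(1) mv(2)] by simp
  have "edges S = insert {a, b} (edges D)"
    unfolding edges_def using opp_S by (auto simp: insert_commute)
  moreover have "{a, b} \<notin> edges D" unfolding edges_def using new opp by (auto simp: doubleton_eq_iff)
  moreover have "finite (edges D)" unfolding edges_def using fin by simp
  ultimately show "euler_char S = 1" using euler new(4) fin cells_S by (simp add: euler_char_def)
qed

end

section \<open>Closing off a 2-cell\<close>

locale closing =
  fixes D :: complex2 and a b :: nat and s t :: "nat list"
  assumes D: "diagram D"
    and cycle: "is_cycle (nxt D) (a # b # s @ t)" and outer: "set (a # b # s @ t) = outer D"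
    and ab: "opp D a = b"
begin

sublocale diag D by unfold_locales (rule D)

definition z :: nat where "z = last (b # s)"
definition w :: nat where "w = nxt D z"

text \<open>The free end \<open>org D b\<close> of the spike is bent round to the end of the segment
  \<open>s\<close>, so that \<open>b # s\<close> encloses a new cell and \<open>a # t\<close> stays
  outside. The transposition does this by sending \<open>z\<close> to \<open>b\<close> and
  \<open>a\<close> to \<open>w\<close>. One vertex is lost and one cell is gained.\<close>

definition K :: complex2 where
  "K = \<lparr>verts = verts D - {org D b}, darts = darts D, org = (org D)(b := org D w), opp = opp D,
    nxt = nxt D \<circ> transpose z a, outer = set (a # t)\<rparr>"

lemma K_simps [simp]: "verts K = verts D - {org D b}" "darts K = darts D" "opp K = opp D"
    "org K = (org D)(b := org D w)" "nxt K = nxt D \<circ> transpose z a" "outer K = set (a # t)"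
  by (simp_all add: K_def)

lemma distinct_outer: "distinct (a # b # s @ t)" using cycle by (simp add: is_cycle_def)

lemma z_in: "z \<in> set (b # s)" unfolding z_def by (rule last_in_set) simp

lemma dart_in: "a \<in> darts D" "b \<in> darts D" "z \<in> darts D" "w \<in> darts D"
proof -
  show "a \<in> darts D" "b \<in> darts D" using outer outer_sub by auto
  show z: "z \<in> darts D" using z_in outer outer_sub by auto
  show "w \<in> darts D" unfolding w_def by (rule nxt_in[OF z])
qed

lemma z_neq: "z \<noteq> a" using z_in distinct_outer by auto

lemma opp_b: "opp D b = a" using ab opp(3)[OF dart_in(1)] by simp

lemma opp_z: "opp D z \<noteq> b" "opp D z \<in> darts D" "org D (opp D z) = org D w"
  using opp_b opp(3)[OF dart_in(3)] z_neq opp(1)[OF dart_in(3)] org_nxt[OF dart_in(3)]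
  by (auto simp: w_def)

lemma rot_b: "rot D b = b" using cycle opp_b by (simp add: rot_def is_cycle_def)

lemma org_b_iff: "e \<in> darts D \<Longrightarrow> org D e = org D b \<longleftrightarrow> e = b"
  using orbit_rot_fibre[OF D dart_in(2)] orbit_eq_singleton_iff[of "rot D" b] rot_b by auto

lemma org_w: "org D w \<noteq> org D b" using org_b_iff[OF opp_z(2)] opp_z by simp

lemma org_K: "e \<in> darts D \<Longrightarrow> org K e = (if org D e = org D b then org D w else org D e)"
  using org_b_iff by auto

lemma rot_K:
  assumes "e \<in> darts D"
  shows "rot K e = (rot D \<circ> transpose b (opp D z)) e"
proof -
  have "opp D (transpose b (opp D z) e) = transpose z a (opp D e)"
    using opp_b opp(3)[OF assms] opp(3)[OF dart_in(3)] opp(3)[OF dart_in(1)] ab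
    by (auto simp: transpose_def)
  then show ?thesis by (simp add: rot_def)
qed

lemma orbit_K: "d \<in> darts K \<Longrightarrow> orbit (rot K) d = {e \<in> darts K. org K e = org K d}"
proof -
  assume "d \<in> darts K"
  then have d: "d \<in> darts D" by simp
  have ob: "orbit (rot D) b = {b}" using rot_b orbit_eq_singleton_iff[of "rot D" b] by simp
  let ?r = "rot D \<circ> transpose b (opp D z)"
  interpret r: finite_perm ?r "darts D" by (rule rot.finite_perm_transpose[OF dart_in(2) opp_z(2)])
  have r: "orbit (rot K) d = orbit ?r d"
    by (rule finite_perm_cong(2)[OF r.finite_perm_axioms _ d]) (rule rot_K[symmetric])
  have "opp D z \<notin> orbit (rot D) b" using ob opp_z(1) by simp
  then have j: "orbit ?r b = {b} \<union> orbit (rot D) (opp D z)"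
    using rot.join_orbits(1)[OF dart_in(2) opp_z(2)] ob by simp
  have fib: "orbit (rot D) (opp D z) = {e \<in> darts D. org D e = org D w}"
    using orbit_rot_fibre[OF D opp_z(2)] opp_z(3) by simp
  show ?thesis
  proof (cases "d \<in> orbit ?r b")
    case True
    then have "orbit (rot K) d = insert b {e \<in> darts D. org D e = org D w}"
      using r r.orbit_eq[OF dart_in(2) True] j fib by simp
    moreover have "org K d = org D w" using True j fib by auto
    ultimately show ?thesis using org_K org_b_iff dart_in(2) by auto
  next
    case False
    then have dd: "d \<noteq> b" "org D d \<noteq> org D w" using j fib d by auto
    have "b \<notin> orbit (rot D) d" "opp D z \<notin> orbit (rot D) d"
      using orbit_rot_fibre[OF D d] dd org_b_iff[OF d] opp_z(3) by auto
    then have "orbit (rot K) d = {e \<in> darts D. org D e = org D d}"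
      using rot.transpose_other(1)[OF d] r orbit_rot_fibre[OF D d] by simp
    moreover have "org D d \<noteq> org D b" using org_b_iff[OF d] dd(1) by simp
    then have "org K e = org K d \<longleftrightarrow> org D e = org D d" if "e \<in> darts D" for e
      unfolding org_K[OF that] org_K[OF d] using dd(2) by auto
    ultimately show ?thesis unfolding K_simps(2) by blast
  qed
qed

lemma cycles_K: "is_cycle (nxt K) (b # s)" "is_cycle (nxt K) (t @ [a])"
proof -
  have c: "is_cycle (nxt D) ((b # s) @ (t @ [a]))" using is_cycle_rotate[of _ "[a]" "b # s @ t"] cycle by simp
  then have d: "distinct ((b # s) @ (t @ [a]))" unfolding is_cycle_def by blast
  have "nxt D = nxt K \<circ> transpose z a" by (simp add: comp_assoc)
  with is_cycle_transpose[OF _ _ d, of "nxt K"] c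
  show "is_cycle (nxt K) (b # s)" "is_cycle (nxt K) (t @ [a])" by (simp_all add: z_def del: K_simps)
qed

lemma cycle_outer_K: "is_cycle (nxt K) (a # t)"
  using is_cycle_rotate[of _ t "[a]"] cycles_K(2) by simp

lemma other_K:
  assumes "e \<in> darts D - outer D"
  shows "orbit (nxt K) e = orbit (nxt D) e" "cycle_from (nxt K) e = cycle_from (nxt D) e"
proof -
  have e: "e \<in> darts D" using assms by simp
  have "x \<notin> outer D" if "x \<in> orbit (nxt D) e" for x
    using that assms orbit_nonouter[of e] cell_outer by blast
  moreover have "z \<in> outer D" "a \<in> outer D" using outer z_in by auto
  ultimately have "z \<notin> orbit (nxt D) e" "a \<notin> orbit (nxt D) e" by blast+
  from nxt.transpose_other[OF e this]
  show "orbit (nxt K) e = orbit (nxt D) e" "cycle_from (nxt K) e = cycle_from (nxt D) e" by simp_all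
qed

lemma darts_K: "darts D = set (b # s) \<union> set (a # t) \<union> (darts D - outer D)"
  using outer outer_sub by auto

lemma cells_K: "cells K = insert (set (b # s)) (cells D)"
proof -
  have e: "orbit (nxt K) ` set (b # s) = {set (b # s)}" "orbit (nxt K) ` set (a # t) = {set (a # t)}"
    "orbit (nxt K) ` (darts D - outer D) = cells D"
    using orbit_cycle[OF cycles_K(1)] orbit_cycle[OF cycle_outer_K] other_K(1) cells_eq[OF D]
    by (auto simp del: K_simps)
  have "faces K = orbit (nxt K) ` (set (b # s) \<union> set (a # t) \<union> (darts D - outer D))"
    unfolding faces_def K_simps(2) using darts_K by metis
  then have "faces K = {set (b # s)} \<union> {set (a # t)} \<union> cells D"
    unfolding image_Un e .
  moreover have "a \<notin> set (b # s)" using distinct_outer by auto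
  moreover have "set (a # t) \<notin> cells D" using cell_outer[of "set (a # t)" a] outer by auto
  ultimately show ?thesis unfolding cells_def K_simps(6) by auto
qed

lemma new_cell: "set (b # s) \<notin> cells D"
  using cell_outer[of "set (b # s)" b] outer by auto

lemma diagram_K: "diagram K"
  unfolding diagram_def
proof (intro conjI ballI)
  show "finite (verts K)" "finite (darts K)" using fin by simp_all
  show "opp K permutes darts K" using D by (simp add: diagram_def)
  have "nxt D permutes darts D" using D by (simp add: diagram_def)
  from permutes_comp_transpose[OF this subset_refl dart_in(3,1)] show "nxt K permutes darts K" by simp
  show "opp K d \<noteq> d" "opp K (opp K d) = d" if "d \<in> darts K" for d using that opp by simp_all
  show "org K ` darts K \<subseteq> verts K"
  proof
    fix u assume "u \<in> org K ` darts K"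
    then obtain e where e: "e \<in> darts D" "u = org K e" by auto
    then show "u \<in> verts K"
      using org_K[OF e(1)] org_w org_in[OF e(1)] org_in[OF dart_in(4)] by (cases "org D e = org D b") simp_all
  qed
  show "org K d = org K e \<longleftrightarrow> e \<in> orbit (rot K) d" if "d \<in> darts K" "e \<in> darts K" for d e
    unfolding orbit_K[OF that(1)] using that(2) by auto
  have "outer K = orbit (nxt K) a" using orbit_cycle[OF cycle_outer_K, of a] by (simp del: K_simps) simp
  then show "if darts K = {} then outer K = {} else outer K \<in> faces K"
    using dart_in(1) by (auto simp: faces_def)
  show "connected_complex K"
    unfolding connected_complex_steps
  proof (intro conjI ballI)
    show "verts K \<noteq> {}" using org_in[OF dart_in(4)] org_w by auto
    \<comment> \<open>The identification of the two vertices carries paths of \<open>D\<close> to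
      paths of \<open>K\<close>.\<close>
    let ?h = "\<lambda>u. if u = org D b then org D w else u"
    fix u v assume uv: "u \<in> verts K" "v \<in> verts K"
    then have "(u, v) \<in> (vertex_steps D)\<^sup>*" using connected by (simp add: connected_complex_steps)
    then have "(?h u, ?h v) \<in> (vertex_steps K)\<^sup>*"
    proof (rule rtrancl_map)
      fix x y assume "(x, y) \<in> vertex_steps D"
      then obtain e where e: "e \<in> darts D" "x = org D e" "y = org D (opp D e)" by (auto simp: vertex_steps_def)
      then have "(?h x, ?h y) = (org K e, org K (opp K e))"
        using org_K[OF e(1)] org_K[OF opp(1)[OF e(1)]] by simp
      then show "(?h x, ?h y) \<in> (vertex_steps K)\<^sup>*" using vertex_stepI[of e K] e(1) by (metis K_simps(2) r_into_rtrancl)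
    qed
    then show "(u, v) \<in> (vertex_steps K)\<^sup>*" using uv by simp
  qed
  have "card (verts D) = Suc (card (verts K))"
    using card_Suc_Diff1[OF fin(1) org_in[OF dart_in(2)]] by simp
  moreover have "card (cells K) = Suc (card (cells D))" unfolding cells_K using new_cell finite_cells by simp
  moreover have "edges K = edges D" by (simp add: edges_def)
  ultimately show "euler_char K = 1" using euler by (simp add: euler_char_def)
qed

end

section \<open>Building diagrams from fillings\<close>

context relators
begin

text \<open>The boundary circuit is kept as a list and no base vertex is fixed, so that words can be
  rotated freely.\<close>

definition fills :: "nat \<Rightarrow> 'a word \<Rightarrow> bool" where
  "fills n w \<longleftrightarrow> (\<exists>D lab cs. diagram D \<and> labelled D lab \<and> card (cells D) \<le> n \<and> map lab cs = w \<and>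
    (if outer D = {} then cs = [] else is_cycle (nxt D) cs \<and> set cs = outer D))"

lemma fills_Nil: "fills n []"
proof -
  define D where "D = \<lparr>verts = {0}, darts = {}, org = id, opp = id, nxt = id, outer = {}\<rparr>"
  have "faces D = {}" "edges D = {}" by (simp_all add: D_def faces_def edges_def)
  then have "diagram D" "cells D = {}"
    by (auto simp: D_def diagram_def connected_complex_def euler_char_def cells_def permutes_id)
  moreover have "labelled D lab" for lab by (simp add: labelled_def D_def)
  ultimately show ?thesis unfolding fills_def by (intro exI[of _ D] exI[of _ "[]"]) (simp add: D_def)
qed

lemma fills_mono: "fills n w \<Longrightarrow> n \<le> m \<Longrightarrow> fills m w"
  unfolding fills_def by (elim exE conjE, intro exI conjI) (assumption | erule order_trans)+

lemma fills_rotate: assumes "fills n (u @ v)" shows "fills n (v @ u)"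
proof -
  obtain D lab cs where D: "diagram D" "labelled D lab" "card (cells D) \<le> n" "map lab cs = u @ v"
    "if outer D = {} then cs = [] else is_cycle (nxt D) cs \<and> set cs = outer D"
    using assms unfolding fills_def by blast
  then obtain us vs where "cs = us @ vs" "map lab us = u" "map lab vs = v"
    by (auto simp: map_eq_append_conv)
  then show ?thesis unfolding fills_def
    using D is_cycle_rotate[of "nxt D" us vs]
    by (intro exI[of _ D] exI[of _ lab] exI[of _ "vs @ us"]) (auto split: if_splits)
qed

lemma fills_spike:
  assumes "fills n w" "fst x \<in> A"
  shows "\<exists>D lab a b cs. diagram D \<and> labelled D lab \<and> card (cells D) \<le> n \<and> map lab cs = w \<and>
    lab a = x \<and> lab b = inv_letter x \<and> opp D a = b \<and>
    is_cycle (nxt D) (a # b # cs) \<and> set (a # b # cs) = outer D"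
proof -
  obtain D lab cs where D: "diagram D" "labelled D lab" "card (cells D) \<le> n" "map lab cs = w"
    and cs: "if outer D = {} then cs = [] else is_cycle (nxt D) cs \<and> set cs = outer D"
    using assms unfolding fills_def by blast
  interpret D: diag D by unfold_locales (rule D)
  obtain v0 where v0: "v0 \<in> verts D" using D.connected by (auto simp: connected_complex_def)
  define v where "v = (if outer D = {} then v0 else org D (hd cs))"
  have "hd cs \<in> darts D" if "outer D \<noteq> {}"
    using that cs D.outer_sub hd_in_set[of cs] by (auto simp: is_cycle_def)
  then have v: "v \<in> verts D" using v0 D.org_in by (simp add: v_def)
  obtain a where a: "a \<notin> darts D" using ex_new_if_finite[OF infinite_UNIV_nat D.fin(2)] by blast
  obtain b where b: "b \<notin> insert a (darts D)"
    using ex_new_if_finite[OF infinite_UNIV_nat, of "insert a (darts D)"] D.fin(2) by blast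
  obtain m where m: "m \<notin> verts D" using ex_new_if_finite[OF infinite_UNIV_nat D.fin(1)] by blast
  interpret sp: spike D v a b m cs
    using D(1) v a b m cs by unfold_locales (auto simp: v_def)
  define lab' where "lab' = lab(a := x, b := inv_letter x)"
  have lab': "lab' e = lab e" if "e \<in> darts D" for e using that a b by (auto simp: lab'_def)
  have lab_ab: "lab' a = x" "lab' b = inv_letter x" using b by (auto simp: lab'_def)
  have "labelled sp.S lab'"
    unfolding labelled_def
  proof (intro conjI ballI)
    fix d assume "d \<in> darts sp.S"
    then consider "d = a" | "d = b" | "d \<in> darts D" by auto
    then show "fst (lab' d) \<in> A" "lab' (opp sp.S d) = inv_letter (lab' d)"
      using lab_ab assms(2) sp.opp_S lab' D.opp(1) D(2) by (cases; auto simp: labelled_def)+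
  next
    fix d assume "d \<in> darts sp.S - outer sp.S"
    then have d: "d \<in> darts D - outer D" using cs by (auto split: if_splits)
    then have dD: "d \<in> darts D" by simp
    have "map lab' (cycle_from (nxt D) d) = map lab (cycle_from (nxt D) d)"
      using D.nxt.cycle_from(3)[OF dD] D.nxt.orbit_sub[OF dD] lab' by auto
    moreover have "map lab (cycle_from (nxt D) d) \<in> Q" using D(2) d unfolding labelled_def by blast
    ultimately show "map lab' (cycle_from (nxt sp.S) d) \<in> Q" using sp.orbit_S[OF d] by metis
  qed
  moreover have "map lab' cs = w" using sp.cs_darts lab' D(4) by (auto simp: subset_iff)
  ultimately show ?thesis
    using sp.diagram_S D(3) sp.cells_S lab_ab sp.opp_S(1) sp.cycle_S sp.S_simps(3) by metis
qed

lemma fills_pair: "fills n w \<Longrightarrow> fst x \<in> A \<Longrightarrow> fills n (x # inv_letter x # w)"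
proof -
  assume "fills n w" "fst x \<in> A"
  from fills_spike[OF this] obtain D lab a b cs where *: "diagram D" "labelled D lab" "card (cells D) \<le> n"
    "map lab cs = w" "lab a = x" "lab b = inv_letter x" "is_cycle (nxt D) (a # b # cs)"
    "set (a # b # cs) = outer D" by blast
  then have "outer D \<noteq> {}" by auto
  with * show ?thesis unfolding fills_def
    by (intro exI[of _ D] exI[of _ lab] exI[of _ "a # b # cs"]) simp
qed

text \<open>A spike reading \<open>x\<close> is grown at the start of the boundary, and bending its
  free end to the end of \<open>s\<close> encloses the cell.\<close>

lemma fills_cell:
  assumes "fills n (s @ u)" "inv_letter x # s \<in> Q"
  shows "fills (Suc n) (x # u)"
proof -
  have "fst x \<in> A" using fst_relator_letter[OF assms(2), of "inv_letter x"] by simp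
  from fills_spike[OF assms(1) this] obtain D lab a b cs where
    D: "diagram D" "labelled D lab" "card (cells D) \<le> n" and
    cs: "map lab cs = s @ u" "lab a = x" "lab b = inv_letter x" "opp D a = b"
      "is_cycle (nxt D) (a # b # cs)" "set (a # b # cs) = outer D" by blast
  obtain s' t where st: "cs = s' @ t" "map lab s' = s" "map lab t = u"
    using cs(1) by (auto simp: map_eq_append_conv)
  interpret cl: closing D a b s' t
    using D(1) cs st(1) by unfold_locales simp_all
  have "labelled cl.K lab"
    unfolding labelled_def
  proof (intro conjI ballI)
    show "fst (lab d) \<in> A" "lab (opp cl.K d) = inv_letter (lab d)" if "d \<in> darts cl.K" for d
      using that D(2) by (auto simp: labelled_def)
    fix d assume d: "d \<in> darts cl.K - outer cl.K"
    then consider "d \<in> set (b # s')" | "d \<in> darts D - outer D"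
      using cs(6) st(1) by auto
    then show "map lab (cycle_from (nxt cl.K) d) \<in> Q"
    proof cases
      case 1
      from cycle_starting_at[OF cl.cycles_K(1) this] obtain p q where
        pq: "b # s' = p @ d # q" "cycle_from (nxt cl.K) d = d # q @ p" by metis
      have "map lab p @ map lab (d # q) = map lab (b # s')" unfolding pq(1) by simp
      also have "\<dots> \<in> Q" using assms(2) cs(3) st(2) by simp
      finally have "map lab (d # q) @ map lab p \<in> Q" by (rule rotate_relator)
      then show ?thesis unfolding pq(2) by simp
    next
      case 2
      then show ?thesis using cl.other_K(2)[OF 2] D(2) unfolding labelled_def by metis
    qed
  qed
  moreover have "card (cells cl.K) \<le> Suc n"
    unfolding cl.cells_K using D(3) cl.new_cell cl.finite_cells by simp
  moreover have "map lab (a # t) = x # u" using cs(2) st(3) by simp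
  moreover have "outer cl.K = set (a # t)" by simp
  ultimately show ?thesis unfolding fills_def
    using cl.diagram_K cl.cycle_outer_K by (intro exI[of _ cl.K] exI[of _ lab] exI[of _ "a # t"]) simp
qed

text \<open>Inserting \<open>w\<close> into an arbitrary boundary word spares gluing two diagrams at
  a vertex. For the edge rule, \<open>v\<close> is inserted first, then a spike is grown in front of
  it, and \<open>u\<close> is inserted at the tip.\<close>

lemma fills_insert: "fill n w \<Longrightarrow> fills m (p @ q) \<Longrightarrow> fills (n + m) (p @ w @ q)"
proof (induction arbitrary: m p q rule: fillable.induct)
  case (fill_Nil n)
  then show ?case using fills_mono by simp
next
  case (fill_Cell n s u x)
  from fill_Cell.IH[OF fill_Cell.prems] have "fills (n + m) (s @ (u @ q @ p))"
    using fills_rotate[of "n + m" p "s @ u @ q"] by simp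
  from fills_cell[OF this fill_Cell.hyps(2)] have "fills (Suc (n + m)) (x # u @ q @ p)" .
  then show ?case using fills_rotate[of _ "x # u @ q" p] by simp
next
  case (fill_Edge n u k v x)
  from fill_Edge.IH(2)[OF fill_Edge.prems] have "fills (k + m) (v @ q @ p)"
    using fills_rotate[of "k + m" p "v @ q"] by simp
  from fills_pair[OF this fill_Edge.hyps(3)]
  have "fills (k + m) ((p @ [x]) @ inv_letter x # v @ q)"
    using fills_rotate[of "k + m" "x # inv_letter x # v @ q" p] by simp
  from fill_Edge.IH(1)[OF this] show ?case by (simp add: ac_simps)
qed

end

lemma van_kampen_of_fillable:
  assumes "R \<subseteq> words A" "fillable A (cyclic_relators R) n w"
  shows "\<exists>D v lab. van_kampen A R w D v lab \<and> card (cells D) \<le> n"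
proof -
  interpret relators A "cyclic_relators R" by (rule relators_cyclic_relators[OF assms(1)])
  have "fills n w" using fills_insert[OF assms(2), of 0 "[]" "[]"] fills_Nil by simp
  then obtain D lab cs where D: "diagram D" "labelled D lab" "card (cells D) \<le> n" "map lab cs = w"
    and cs: "if outer D = {} then cs = [] else is_cycle (nxt D) cs \<and> set cs = outer D"
    unfolding fills_def by blast
  interpret D: diag D by unfold_locales (rule D)
  have cell: "\<exists>d\<in>f. circuit_word D lab d \<in> R \<union> inv_word ` R" if f: "f \<in> cells D" for f
  proof -
    obtain d where d: "d \<in> f" using D.cell_ne[OF f] by blast
    then have dD: "d \<in> darts D - outer D" using D.cell_sub[OF f] D.cell_outer[OF f] by blast
    let ?ds = "cycle_from (nxt D) d"
    have ds: "is_cycle (nxt D) ?ds" "set ?ds = f"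
      using D.nxt.cycle_from[of d] dD D.orbit_cell[OF f d] by auto
    have "map lab ?ds \<in> cyclic_relators R" using D(2) dD unfolding labelled_def by blast
    then obtain k r where r: "r \<in> R \<union> inv_word ` R" "map lab ?ds = rotate k r"
      unfolding cyclic_relators_def mem_Collect_eq by metis
    have len: "length ?ds = length r" using r(2) by (metis length_map length_rotate)
    \<comment> \<open>The labels of the cell, read from \<open>d\<close>, are a relator or its
      inverse rotated by \<open>k\<close>. Rotating by \<open>?j\<close> completes a full turn and
      finds the dart from which that word itself is read.\<close>
    let ?j = "length r - k mod length r"
    have "r = rotate ?j (map lab ?ds)"
    proof -
      have ne: "length r > 0" using len ds(1) by (auto simp: is_cycle_def)
      then have "(?j + k) mod length r = 0"
        by (metis le_add_diff_inverse2 less_imp_le mod_add_right_eq mod_less_divisor mod_self)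
      then have "rotate (?j + k) r = r" by (rule rotate_id)
      then show ?thesis unfolding r(2) rotate_rotate by simp
    qed
    then have r': "map lab (rotate ?j ?ds) = r" unfolding rotate_map by (rule HOL.sym)
    have "is_cycle (nxt D) (rotate ?j ?ds)"
      unfolding rotate_drop_take by (rule is_cycle_rotate) (simp add: ds(1))
    from cycle_from_eq[OF this] have "circuit_word D lab (hd (rotate ?j ?ds)) = map lab (rotate ?j ?ds)"
      unfolding circuit_word_cycle_from by (rule arg_cong)
    then have "circuit_word D lab (hd (rotate ?j ?ds)) = r" using r' by (rule HOL.trans)
    then have "circuit_word D lab (hd (rotate ?j ?ds)) \<in> R \<union> inv_word ` R" using r(1) by metis
    moreover have "hd (rotate ?j ?ds) \<in> f"
      using ds hd_in_set[of "rotate ?j ?ds"] by (auto simp: is_cycle_def)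
    ultimately show ?thesis by (rule bexI)
  qed
  obtain v where v: "v \<in> verts D" "outer D \<noteq> {} \<Longrightarrow> v = org D (hd cs)"
  proof (cases "outer D = {}")
    case True
    then show ?thesis using that D.connected by (auto simp: connected_complex_def)
  next
    case False
    then have "hd cs \<in> darts D" using cs D.outer_sub hd_in_set[of cs] by (auto simp: is_cycle_def)
    then show ?thesis using that D.org_in by blast
  qed
  have "if outer D = {} then w = [] else \<exists>d\<in>outer D. org D d = v \<and> circuit_word D lab d = w"
  proof (cases "outer D = {}")
    case False
    then have c: "is_cycle (nxt D) cs" "set cs = outer D" using cs by auto
    then have "hd cs \<in> outer D" using hd_in_set[of cs] by (auto simp: is_cycle_def)
    moreover have "circuit_word D lab (hd cs) = w" unfolding circuit_word_cycle_from cycle_from_eq[OF c(1)] by (rule D(4))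
    ultimately show ?thesis using False v(2) by auto
  qed (use cs D(4) in simp)
  then have "van_kampen A R w D v lab"
    unfolding van_kampen_def using D(1,2) v(1) cell by (simp add: labelled_def)
  then show ?thesis using D(3) by blast
qed

section \<open>Existence of shellings\<close>

lemma first_return_1: "x \<notin> S \<Longrightarrow> f x \<in> S \<Longrightarrow> first_return S f x = f x"
proof -
  assume "x \<notin> S" "f x \<in> S"
  then have "(LEAST k. (f ^^ k) x \<in> S) = 1"
    by (intro Least_equality) (auto simp: not_less_eq_eq, metis One_nat_def Suc_leI funpow_0 neq0_conv)
  then show ?thesis by (simp add: first_return_def)
qed

lemma first_return_step: "x \<notin> S \<Longrightarrow> \<exists>k. (f ^^ k) x \<in> S \<Longrightarrow> first_return S f x = first_return S f (f x)"
proof -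
  assume x: "x \<notin> S" and "\<exists>k. (f ^^ k) x \<in> S"
  then obtain n where "(f ^^ n) x \<in> S" by blast
  with x have "(LEAST k. (f ^^ k) x \<in> S) = Suc (LEAST k. (f ^^ Suc k) x \<in> S)"
    by (intro Least_Suc[of "\<lambda>k. (f ^^ k) x \<in> S" n]) simp_all
  then show ?thesis by (simp add: first_return_def funpow_swap1)
qed

section \<open>First-return maps of permutations\<close>

context finite_perm
begin

text \<open>The first-return map of \<open>f\<close> to \<open>S\<close>. The search starts at
  \<open>f e\<close>, whereas \<open>first_return\<close> may stop at its own argument; applied to
  the rotation, it is the rotation of a subcomplex.\<close>

definition induced :: "'a set \<Rightarrow> 'a \<Rightarrow> 'a" where
  "induced S e = (f ^^ (LEAST k. (f ^^ k) (f e) \<in> S)) (f e)"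

text \<open>The returns visit every element of the orbit in \<open>S\<close>, since none is passed
  over between two consecutive returns.\<close>

lemma induced:
  assumes S: "S \<subseteq> B" and e: "e \<in> S"
  shows "orbit (induced S) e = orbit f e \<inter> S"
proof -
  have step: "\<exists>k. induced S e = (f ^^ Suc k) e \<and> induced S e \<in> S \<and> (\<forall>n. 0 < n \<longrightarrow> (f ^^ n) e \<in> S \<longrightarrow> k < n)"
    if e: "e \<in> S" for e
  proof -
    let ?P = "\<lambda>k. (f ^^ k) (f e) \<in> S"
    have "e \<in> orbit f e" using self_orbit S e by blast
    then obtain n where n: "0 < n" "(f ^^ n) e = e" by (auto simp: orbit_altdef)
    then have "?P (n - 1)" using e by (metis Suc_pred' funpow_Suc_right comp_apply)
    then have P: "?P (LEAST k. ?P k)" by (rule LeastI)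
    show ?thesis
    proof (intro exI[of _ "LEAST k. ?P k"] conjI allI impI)
      show "induced S e = (f ^^ Suc (LEAST k. ?P k)) e" by (simp add: induced_def funpow_swap1)
      show "induced S e \<in> S" using P by (simp add: induced_def)
      fix n :: nat assume "0 < n" "(f ^^ n) e \<in> S"
      then have "?P (n - 1)" by (metis Suc_pred' funpow_Suc_right comp_apply)
      from Least_le[of ?P, OF this] show "(LEAST k. ?P k) < n" using \<open>0 < n\<close> by linarith
    qed
  qed
  have in_orbit: "induced S e \<in> orbit f e \<inter> S" if e: "e \<in> S" for e
  proof -
    obtain k where k: "induced S e = (f ^^ Suc k) e" "induced S e \<in> S" using step[OF e] by blast
    have "(f ^^ Suc k) e \<in> orbit f e" unfolding orbit_altdef by blast
    then show ?thesis using k by simp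
  qed
  show ?thesis
  proof (intro equalityI subsetI)
    fix y assume "y \<in> orbit (induced S) e"
    then show "y \<in> orbit f e \<inter> S"
    proof induction
      case base
      show ?case by (rule in_orbit[OF e])
    next
      case (step y)
      then show ?case using in_orbit[of y] orbit_trans[of "induced S y" f y e] by blast
    qed
  next
    have "(f ^^ n) e \<in> S \<Longrightarrow> e \<in> S \<Longrightarrow> 0 < n \<Longrightarrow> (f ^^ n) e \<in> orbit (induced S) e" for n e
    proof (induction n arbitrary: e rule: less_induct)
      case (less n)
      obtain k where k: "induced S e = (f ^^ Suc k) e" "induced S e \<in> S" "k < n"
        using step[OF less.prems(2)] less.prems(1,3) by blast
      show ?case
      proof (cases "n = Suc k")
        case True
        then show ?thesis using orbit.base[of "induced S" e] k(1) by simp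
      next
        case False
        then have n: "n = (n - Suc k) + Suc k" "0 < n - Suc k" using k(3) by auto
        then have "(f ^^ n) e = (f ^^ (n - Suc k)) (induced S e)"
          unfolding k(1) by (metis comp_apply funpow_add)
        moreover have "\<dots> \<in> orbit (induced S) (induced S e)"
          by (rule less.IH) (use n k less.prems calculation in auto)
        ultimately show ?thesis using orbit_trans[OF _ orbit.base, of _ "induced S" e] by simp
      qed
    qed
    then show "y \<in> orbit (induced S) e" if "y \<in> orbit f e \<inter> S" for y
      using that e by (auto simp: orbit_altdef[of f])
  qed
qed

lemma finite_perm_induced: assumes S: "S \<subseteq> B" shows "finite_perm (induced S) S"
proof
  show fin: "finite S" using S finite_carrier finite_subset by blast
  have into: "induced S e \<in> S" if "e \<in> S" for e
    using induced[OF S that] orbit.base[of "induced S" e] by blast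
  have "S \<subseteq> induced S ` S"
  proof
    fix e assume e: "e \<in> S"
    then have "e \<in> orbit (induced S) e" using induced[OF S e] self_orbit[of e] S by blast
    then show "e \<in> induced S ` S" by cases (use e induced[OF S e] in auto)
  qed
  then have "induced S ` S = S" using into by blast
  then show "bij_betw (induced S) S S" using fin by (simp add: bij_betw_def finite_surj_inj)
qed

end

section \<open>Deleting an edge from a diagram\<close>

locale edge_removal = diag +
  fixes d :: nat
  assumes dart: "d \<in> darts D"
begin

definition rest :: "nat set" where "rest = darts D - {d, opp D d}"

text \<open>Both kinds of collapse delete one edge; they differ in the remaining vertices
  \<open>V\<close> and in the new outer circuit \<open>X\<close>. Outside \<open>rest\<close> the
  maps are the identity, as \<open>permutes\<close> demands.\<close>

definition removed :: "nat set \<Rightarrow> nat set \<Rightarrow> complex2" where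
  "removed V X = \<lparr>verts = V, darts = rest, org = org D,
    opp = (\<lambda>e. if e \<in> rest then opp D e else e),
    nxt = (\<lambda>e. if e \<in> rest then first_return rest (rot D) (nxt D e) else e), outer = X\<rparr>"

lemma removed_simps [simp]: "verts (removed V X) = V" "darts (removed V X) = rest"
    "org (removed V X) = org D" "outer (removed V X) = X"
    "e \<in> rest \<Longrightarrow> opp (removed V X) e = opp D e"
    "e \<in> rest \<Longrightarrow> nxt (removed V X) e = first_return rest (rot D) (nxt D e)"
  by (simp_all add: removed_def)

lemma rest_sub: "rest \<subseteq> darts D" by (auto simp: rest_def)

lemma opp_rest: "e \<in> rest \<Longrightarrow> opp D e \<in> rest"
proof -
  assume "e \<in> rest"
  then have e: "e \<in> darts D" "e \<noteq> d" "e \<noteq> opp D d" by (auto simp: rest_def)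
  then have "opp D e \<noteq> d" "opp D e \<noteq> opp D d" using opp(3)[OF e(1)] opp(3)[OF dart] by metis+
  then show ?thesis using opp(1)[OF e(1)] by (simp add: rest_def)
qed

lemma nxt_removed: "e \<in> rest \<Longrightarrow> nxt D e \<in> rest \<Longrightarrow> nxt (removed V X) e = nxt D e"
  by (simp add: first_return_self)

lemma nxt_removed_induced: "e \<in> rest \<Longrightarrow> nxt (removed V X) e = rot.induced rest (opp D e)"
proof -
  assume e: "e \<in> rest"
  then have "rot D (opp D e) = nxt D e" using opp(3)[of e] rest_sub by (auto simp: rot_def)
  then show ?thesis using e by (simp add: rot.induced_def first_return_def)
qed

lemma rot_removed: "e \<in> rest \<Longrightarrow> rot (removed V X) e = rot.induced rest e"
  using nxt_removed_induced[OF opp_rest] opp(3)[of e] rest_sub by (auto simp: rot_def)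

lemma opp_permutes: "opp (removed V X) permutes rest"
proof (rule bij_imp_permutes)
  show "bij_betw (opp (removed V X)) rest rest"
    by (rule bij_betw_byWitness[where f' = "opp D"]) (use opp_rest opp(3) rest_sub in auto)
qed (simp add: removed_def)

lemma nxt_permutes: "nxt (removed V X) permutes rest"
proof (rule bij_imp_permutes)
  have "bij_betw (opp D) rest rest"
    by (rule bij_betw_byWitness[where f' = "opp D"]) (use opp_rest opp(3) rest_sub in auto)
  moreover have "bij_betw (rot.induced rest) rest rest"
    using rot.finite_perm_induced[OF rest_sub] by (simp add: finite_perm_def)
  ultimately have "bij_betw (rot.induced rest \<circ> opp D) rest rest" by (rule bij_betw_trans)
  then show "bij_betw (nxt (removed V X)) rest rest"
    using nxt_removed_induced by (subst bij_betw_cong) auto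
qed (simp add: removed_def)

lemma org_removed:
  assumes "a \<in> rest" "b \<in> rest"
  shows "org D a = org D b \<longleftrightarrow> b \<in> orbit (rot (removed V X)) a"
proof -
  have "finite_perm (rot.induced rest) rest" by (rule rot.finite_perm_induced[OF rest_sub])
  then have "orbit (rot (removed V X)) a = orbit (rot.induced rest) a"
    by (rule finite_perm_cong(2)) (use rot_removed assms(1) in auto)
  also have "\<dots> = orbit (rot D) a \<inter> rest" by (rule rot.induced[OF rest_sub assms(1)])
  finally show ?thesis using org_eq_iff[of a b] assms rest_sub by blast
qed

lemma card_edges_removed: "card (edges D) = Suc (card (edges (removed V X)))"
proof -
  have "edges (removed V X) = edges D - {{d, opp D d}}"
  proof -
    have "{e, opp D e} \<noteq> {d, opp D d}" if "e \<in> rest" for e using that by (auto simp: rest_def doubleton_eq_iff)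
    then have "edges (removed V X) \<subseteq> edges D - {{d, opp D d}}" using rest_sub by (auto simp: edges_def)
    moreover have "edges D - {{d, opp D d}} \<subseteq> edges (removed V X)"
    proof
      fix E assume "E \<in> edges D - {{d, opp D d}}"
      then obtain e where e: "e \<in> darts D" "E = {e, opp D e}" "E \<noteq> {d, opp D d}" by (auto simp: edges_def)
      then have "e \<in> rest" using opp(3)[OF dart] by (auto simp: rest_def)
      then show "E \<in> edges (removed V X)" using e(2) by (auto simp: edges_def)
    qed
    ultimately show ?thesis by blast
  qed
  moreover have "{d, opp D d} \<in> edges D" using dart by (auto simp: edges_def)
  moreover have "finite (edges D)" using fin by (simp add: edges_def)
  ultimately show ?thesis by (simp add: card_Suc_Diff1 del: card_Diff_insert)
qed

text \<open>The last assumption is the Euler condition of the smaller complex, which has one edge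
  less than \<open>D\<close>.\<close>

lemma diagram_removed:
  assumes "V \<subseteq> verts D" "org D ` rest \<subseteq> V"
    and "if rest = {} then X = {} else X \<in> faces (removed V X)"
    and "connected_complex (removed V X)"
    and "card V + card (cells (removed V X)) = card (edges D)"
  shows "diagram (removed V X)"
  unfolding diagram_def
proof (intro conjI ballI)
  show "finite (verts (removed V X))" "finite (darts (removed V X))"
    using assms(1) rest_sub fin finite_subset by auto
  show "opp (removed V X) permutes darts (removed V X)" "nxt (removed V X) permutes darts (removed V X)"
    using opp_permutes nxt_permutes by simp_all
  show "opp (removed V X) e \<noteq> e" "opp (removed V X) (opp (removed V X) e) = e"
    if "e \<in> darts (removed V X)" for e
    using that opp_rest opp rest_sub by auto
  show "org (removed V X) a = org (removed V X) b \<longleftrightarrow> b \<in> orbit (rot (removed V X)) a"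
    if "a \<in> darts (removed V X)" "b \<in> darts (removed V X)" for a b
    using org_removed that by simp
  show "euler_char (removed V X) = 1"
    using assms(5) card_edges_removed[of V X] by (simp add: euler_char_def)
qed (use assms(2-4) in simp_all)

lemma subcomplex_removed:
  "V \<subseteq> verts D \<Longrightarrow> cells (removed V X) \<subseteq> cells D \<Longrightarrow> subcomplex (removed V X) D"
  using rest_sub by (simp add: subcomplex_def)

end

section \<open>Existence of collapses\<close>

context diag
begin

text \<open>By finiteness \<open>T\<close> is also closed under predecessors, hence is a union of
  classes of \<open>L\<close>, and there is only one class.\<close>

lemma closed_darts:
  assumes T: "T \<subseteq> darts D" "T \<noteq> {}" "\<And>e. e \<in> T \<Longrightarrow> opp D e \<in> T" "\<And>e. e \<in> T \<Longrightarrow> nxt D e \<in> T"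
  shows "T = darts D"
proof -
  obtain d where d: "d \<in> T" using T(2) by blast
  have inj: "inj_on (nxt D) (darts D)" using nxt.bij by (simp add: bij_betw_def)
  have "nxt D ` T = T"
    by (rule endo_inj_surj[OF finite_subset[OF T(1) fin(2)] _ inj_on_subset[OF inj T(1)]]) (use T(4) in blast)
  have pre: "z \<in> T" if "z \<in> darts D" "nxt D z \<in> T" for z
  proof -
    have "nxt D z \<in> nxt D ` T" using that(2) \<open>nxt D ` T = T\<close> by simp
    then obtain t where t: "t \<in> T" "nxt D t = nxt D z" by (metis imageE)
    then have "t = z" using inj_onD[OF inj, of t z] that(1) T(1) by blast
    then show ?thesis using t(1) by simp
  qed
  have "e \<in> T" if "e \<in> darts D" for e
    using darts_linked[OF subsetD[OF T(1) d] that, unfolded eqv_def]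
  proof (induction rule: rtrancl_induct)
    case (step y z)
    from step(2) consider "z = opp D y" | "z = nxt D y" | "z \<in> darts D" "y = opp D z" | "z \<in> darts D" "y = nxt D z"
      by (auto simp: links_def fgraph_def)
    then show ?case
    proof cases
      case 3
      then show ?thesis using T(3)[OF step.IH] opp(3)[of z] by simp
    qed (use step.IH T(3,4) pre in auto)
  qed (rule d)
  then show ?thesis using T(1) by blast
qed

text \<open>The circuits \<open>d # fs\<close> of the cell and \<open>x # os\<close> of the outer
  region merge into \<open>fs @ os\<close>. The edges of the cell thus pass from the second summand
  of the bound to the first, and the two deleted darts are lost.\<close>

lemma collapse2_exists:
  assumes "cells D \<noteq> {}"
  shows "\<exists>D'. diagram D' \<and> collapse2 D D' \<and> verts D' = verts D \<and> card (darts D') < card (darts D) \<and>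
    perimeter D' + (\<Sum>f\<in>cells D'. card f) \<le> perimeter D + (\<Sum>f\<in>cells D. card f)"
proof -
  have "darts D \<noteq> {}" using assms by (auto simp: cells_def faces_def)
  \<comment> \<open>Otherwise the outer circuit would be closed under \<open>opp\<close> and, the
    diagram being connected, leave no dart for a cell.\<close>
  have "\<exists>o'\<in>outer D. opp D o' \<notin> outer D"
  proof (rule ccontr)
    assume "\<not> ?thesis"
    then have "outer D = darts D"
      using closed_darts[OF outer_sub outer_ne[OF \<open>darts D \<noteq> {}\<close>]] nxt_outer by blast
    then show False using assms cell_ne cell_sub cell_outer by blast
  qed
  then obtain x where x: "x \<in> outer D" "opp D x \<notin> outer D" by blast
  define d where "d = opp D x"
  have xD: "x \<in> darts D" using x outer_sub by blast
  have d: "d \<in> darts D" "d \<notin> outer D" "opp D d = x" "d \<noteq> x" using opp[OF xD] x by (auto simp: d_def)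
  define f where "f = orbit (nxt D) d"
  have f: "f \<in> cells D" "d \<in> f" using orbit_nonouter d nxt.self_orbit by (auto simp: f_def)
  interpret edge_removal D d by unfold_locales (rule d(1))
  obtain fs where fs: "cycle_from (nxt D) d = d # fs"
    using nxt.cycle_from(1,2)[OF d(1)] by (cases "cycle_from (nxt D) d") (auto simp: is_cycle_def)
  obtain os where os: "cycle_from (nxt D) x = x # os"
    using nxt.cycle_from(1,2)[OF xD] by (cases "cycle_from (nxt D) x") (auto simp: is_cycle_def)
  have cf: "is_cycle (nxt D) (d # fs)" "set (d # fs) = f" using nxt.cycle_from[OF d(1)] fs by (auto simp: f_def)
  have co: "is_cycle (nxt D) (x # os)" "set (x # os) = outer D"
    using nxt.cycle_from[OF xD] os orbit_outer[OF x(1)] by auto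
  have disj: "f \<inter> outer D = {}" using cell_outer[OF f(1)] by blast
  define X where "X = set (fs @ os)"
  let ?E = "removed (verts D) X"
  have dist: "distinct (d # fs)" "distinct (x # os)" using cf co by (auto simp: is_cycle_def)
  have X: "X = (f \<union> outer D) - {d, x}" using cf(2) co(2) dist disj f(2) x(1) by (auto simp: X_def)
  have rest: "rest = darts D - {d, x}" by (simp add: rest_def d(3))
  have Xrest: "X \<subseteq> rest" unfolding X rest using cell_sub[OF f(1)] outer_sub by blast
  have rest_split: "rest = X \<union> (darts D - outer D - f)"
    unfolding X rest using cell_sub[OF f(1)] outer_sub f(2) x(1) by blast
  have rd: "rot D d = nxt D x" and rx: "rot D x = nxt D d" using d by (simp_all add: rot_def d_def)
  have hd_last: "nxt D (last (d # fs)) = d" "nxt D (last (x # os)) = x"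
    using cf(1) co(1) by (simp_all add: is_cycle_def)
  have sf: "nxt D d = hd fs \<and> successively (\<lambda>a b. nxt D a = b) fs" if "fs \<noteq> []"
    using cf(1) that by (cases fs) (auto simp: is_cycle_def)
  have so: "nxt D x = hd os \<and> successively (\<lambda>a b. nxt D a = b) os" if "os \<noteq> []"
    using co(1) that by (cases os) (auto simp: is_cycle_def)
  have nx: "nxt D x = x" if "os = []" using hd_last(2) that by simp
  have nd: "nxt D d = d" if "fs = []" using hd_last(1) that by simp
  have notin: "d \<notin> rest" "x \<notin> rest" by (auto simp: rest)
  have hd_fs: "hd fs \<in> rest" if "fs \<noteq> []" using Xrest hd_in_set[OF that] by (auto simp: X_def)
  have hd_os: "hd os \<in> rest" if "os \<noteq> []" using Xrest hd_in_set[OF that] by (auto simp: X_def)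
  \<comment> \<open>If \<open>x\<close> is a loop that forms the whole outer circuit, the rotation
    meets \<open>x\<close> right after \<open>d\<close>, and the search goes on for one more step.
    The case of \<open>x\<close> below is symmetric.\<close>
  have ret_d: "first_return rest (rot D) d = hd (os @ fs)" if "fs @ os \<noteq> []"
  proof (cases "os = []")
    case True
    then have "fs \<noteq> []" using that by simp
    have "rot D d = x" "rot D x = hd fs" using True rd rx nx sf[OF \<open>fs \<noteq> []\<close>] by auto
    moreover then have "(rot D ^^ 2) d \<in> rest" using hd_fs[OF \<open>fs \<noteq> []\<close>] by (simp add: numeral_2_eq_2)
    ultimately show ?thesis
      using first_return_step[OF notin(1), of "rot D"] first_return_1[OF notin(2), of "rot D"]
        hd_fs[OF \<open>fs \<noteq> []\<close>] True by auto
  next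
    case False
    then show ?thesis using first_return_1[OF notin(1), of "rot D"] rd so hd_os by simp
  qed
  have ret_x: "first_return rest (rot D) x = hd (fs @ os)" if "fs @ os \<noteq> []"
  proof (cases "fs = []")
    case True
    then have "os \<noteq> []" using that by simp
    have "rot D x = d" "rot D d = hd os" using True rd rx nd so[OF \<open>os \<noteq> []\<close>] by auto
    moreover then have "(rot D ^^ 2) x \<in> rest" using hd_os[OF \<open>os \<noteq> []\<close>] by (simp add: numeral_2_eq_2)
    ultimately show ?thesis
      using first_return_step[OF notin(2), of "rot D"] first_return_1[OF notin(1), of "rot D"]
        hd_os[OF \<open>os \<noteq> []\<close>] True by auto
  next
    case False
    then show ?thesis using first_return_1[OF notin(2), of "rot D"] rx sf hd_fs by simp
  qed
  have succ: "successively (\<lambda>a b. nxt ?E a = b) ys"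
    if "successively (\<lambda>a b. nxt D a = b) ys" "set ys \<subseteq> rest" for ys
    using that
  proof (induction ys)
    case (Cons a ys)
    then show ?case using nxt_removed[of a] by (cases ys) auto
  qed simp
  have cE: "is_cycle (nxt ?E) (fs @ os)" if ne: "fs @ os \<noteq> []"
  proof -
    have lf: "nxt ?E (last fs) = hd (os @ fs)" if "fs \<noteq> []"
    proof -
      have "last fs \<in> rest" using Xrest last_in_set[OF that] by (auto simp: X_def)
      then show ?thesis using hd_last(1) ret_d[OF ne] that by simp
    qed
    have lo: "nxt ?E (last os) = hd (fs @ os)" if "os \<noteq> []"
    proof -
      have "last os \<in> rest" using Xrest last_in_set[OF that] by (auto simp: X_def)
      then show ?thesis using hd_last(2) ret_x[OF ne] that by simp
    qed
    have sub: "set fs \<subseteq> rest" "set os \<subseteq> rest" using Xrest by (auto simp: X_def)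
    have "successively (\<lambda>a b. nxt D a = b) fs" using sf by (cases "fs = []") simp_all
    moreover have "successively (\<lambda>a b. nxt D a = b) os" using so by (cases "os = []") simp_all
    ultimately have "successively (\<lambda>a b. nxt ?E a = b) fs" "successively (\<lambda>a b. nxt ?E a = b) os"
      using succ sub by blast+
    moreover have "distinct (fs @ os)" using dist disj cf(2) co(2) by auto
    ultimately show ?thesis
      using ne lf lo by (cases "fs = []"; cases "os = []") (simp_all add: is_cycle_def successively_append_iff)
  qed
  have other: "orbit (nxt ?E) e = orbit (nxt D) e" if e: "e \<in> darts D - outer D - f" for e
  proof -
    let ?g = "orbit (nxt D) e"
    have eD: "e \<in> darts D" using e by simp
    have g: "?g \<in> cells D" "e \<in> ?g" using orbit_nonouter e nxt.self_orbit by auto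
    have "?g \<inter> f = {}" using orbit_cell[OF g(1)] orbit_cell[OF f(1)] g(2) e by blast
    then have sub: "?g \<subseteq> rest" unfolding rest using cell_sub[OF g(1)] cell_outer[OF g(1)] f(2) x(1) by blast
    have "nxt ?E a = nxt D a" if "a \<in> ?g" for a
      using nxt_removed[of a] that sub nxt_cell[OF g(1) that] by blast
    then have "is_cycle (nxt ?E) (cycle_from (nxt D) e)"
      using is_cycle_cong[of "cycle_from (nxt D) e" "nxt ?E" "nxt D"] nxt.cycle_from[OF eD] by blast
    from orbit_cycle[OF this, of e] show ?thesis using nxt.cycle_from(3)[OF eD] g(2) by simp
  qed
  have "orbit (nxt D) ` (darts D - outer D - f) = cells D - {f}"
  proof
    show "orbit (nxt D) ` (darts D - outer D - f) \<subseteq> cells D - {f}"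
      using orbit_nonouter nxt.self_orbit by blast
    show "cells D - {f} \<subseteq> orbit (nxt D) ` (darts D - outer D - f)"
    proof
      fix g assume g: "g \<in> cells D - {f}"
      then obtain e where e: "e \<in> g" using cell_ne by blast
      have "e \<notin> f" using g e orbit_cell[of g e] orbit_cell[OF f(1), of e] by auto
      then have "e \<in> darts D - outer D - f" "orbit (nxt D) e = g"
        using g e cell_sub[of g] cell_outer[of g e] orbit_cell[of g e] by auto
      then show "g \<in> orbit (nxt D) ` (darts D - outer D - f)" by blast
    qed
  qed
  then have facesE: "faces ?E = orbit (nxt ?E) ` X \<union> (cells D - {f})"
    unfolding faces_def removed_simps(2) using other by (subst rest_split) (simp add: image_Un)
  \<comment> \<open>If both circuits consist of one dart, the deleted loop is the only edge, and a
    single vertex remains.\<close>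
  have empty: "fs @ os = [] \<Longrightarrow> rest = {}"
  proof -
    assume *: "fs @ os = []"
    have "{d, x} = darts D"
      by (rule closed_darts) (use d xD nx nd * in \<open>auto simp: d_def\<close>)
    then show "rest = {}" by (simp add: rest)
  qed
  have cellsE: "cells ?E = cells D - {f}"
  proof (cases "fs @ os = []")
    case True
    then have "rest = {}" by (rule empty)
    then have "darts D - outer D - f = {}" "faces ?E = {}" using rest_split by (auto simp: faces_def)
    then have "cells D - {f} = {}"
      using \<open>orbit (nxt D) ` (darts D - outer D - f) = cells D - {f}\<close> by (metis image_empty)
    then show ?thesis using \<open>faces ?E = {}\<close> by (simp add: cells_def)
  next
    case False
    have "orbit (nxt ?E) ` X = (\<lambda>_. X) ` X"
      using orbit_cycle[OF cE[OF False]] unfolding X_def by (rule image_cong[OF HOL.refl])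
    moreover have "X \<noteq> {}" using False by (simp add: X_def)
    ultimately have "orbit (nxt ?E) ` X = {X}" by (simp add: image_constant_conv)
    moreover have "X \<notin> cells D - {f}"
    proof
      assume X': "X \<in> cells D - {f}"
      then obtain e where e: "e \<in> X" using cell_ne by blast
      then have "e \<in> f" using X cell_outer[of X e] X' by blast
      then show False using X' orbit_cell[of X e] orbit_cell[OF f(1), of e] e by simp
    qed
    ultimately show ?thesis using facesE by (auto simp: cells_def)
  qed
  have stepE: "(org D e, org D (opp D e)) \<in> vertex_steps ?E" if "e \<in> rest" for e
    using vertex_stepI[of e ?E] that by simp
  \<comment> \<open>The rest of the boundary of \<open>f\<close> is a detour around the deleted
    edge; it keeps the complex connected.\<close>
  have around: "(org D x, org D y) \<in> (vertex_steps ?E)\<^sup>*" if "y \<in> f" for y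
  proof -
    have od: "org D (nxt D d) = org D x" using org_nxt[OF d(1)] d(3) by simp
    have "y \<in> orbit (nxt D) d" using that by (simp add: f_def)
    then show ?thesis
    proof induction
      case base
      show ?case unfolding od by simp
    next
      case (step y)
      show ?case
      proof (cases "y = d")
        case True
        then show ?thesis using od by simp
      next
        case False
        have y: "y \<in> f" using step(1) by (simp add: f_def)
        then have "y \<in> darts D" "y \<noteq> x" using cell_sub[OF f(1)] disj x(1) by auto
        then have "y \<in> rest" "org D (nxt D y) = org D (opp D y)" using False org_nxt by (auto simp: rest)
        then show ?thesis using stepE[of y] step.IH by (metis rtrancl.rtrancl_into_rtrancl)
      qed
    qed
  qed
  have "sym (vertex_steps ?E)"
  proof (rule symI)
    fix u v assume "(u, v) \<in> vertex_steps ?E"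
    then obtain e where "e \<in> rest" "u = org D e" "v = org D (opp D e)" by (auto simp: vertex_steps_def)
    then show "(v, u) \<in> vertex_steps ?E" using stepE[OF opp_rest, of e] opp(3)[of e] rest_sub by auto
  qed
  then have symE: "sym ((vertex_steps ?E)\<^sup>*)" by (rule sym_rtrancl)
  have conn: "connected_complex ?E"
    unfolding connected_complex_steps removed_simps(1)
  proof (intro conjI ballI)
    show "verts D \<noteq> {}" using connected by (simp add: connected_complex_steps)
    fix u v assume "u \<in> verts D" "v \<in> verts D"
    then have "(u, v) \<in> (vertex_steps D)\<^sup>*" using connected by (simp add: connected_complex_steps)
    then show "(u, v) \<in> (vertex_steps ?E)\<^sup>*"
    proof (rule rtrancl_map[where h = "\<lambda>u. u"])
      fix a b assume "(a, b) \<in> vertex_steps D"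
      then obtain e where e: "e \<in> darts D" "a = org D e" "b = org D (opp D e)" by (auto simp: vertex_steps_def)
      have xd: "(org D x, org D d) \<in> (vertex_steps ?E)\<^sup>*" by (rule around[OF f(2)])
      consider "e = d" | "e = x" | "e \<in> rest" using e(1) by (auto simp: rest)
      then show "(a, b) \<in> (vertex_steps ?E)\<^sup>*"
      proof cases
        case 1
        then show ?thesis using e d(3) symD[OF symE xd] by simp
      next
        case 2
        then show ?thesis using e xd by (simp add: d_def)
      next
        case 3
        then show ?thesis using e stepE[OF 3] by auto
      qed
    qed
  qed
  have dE: "diagram ?E"
  proof (rule diagram_removed)
    show "org D ` rest \<subseteq> verts D" using org_in rest_sub by auto
    show "if rest = {} then X = {} else X \<in> faces ?E"
    proof (cases "fs @ os = []")
      case True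
      then show ?thesis using empty by (simp add: X_def)
    next
      case False
      then have "hd (fs @ os) \<in> X" unfolding X_def by (rule hd_in_set)
      then have "orbit (nxt ?E) (hd (fs @ os)) = X" "hd (fs @ os) \<in> rest"
        using orbit_cycle[OF cE[OF False]] Xrest by (auto simp: X_def)
      then show ?thesis by (auto simp: faces_def)
    qed
    show "card (verts D) + card (cells ?E) = card (edges D)"
      using euler_nat card_Suc_Diff1[OF finite_cells f(1)] cellsE by simp
  qed (use conn in auto)
  have "collapse2 D ?E"
    unfolding collapse2_def
  proof (intro bexI conjI)
    show "f \<in> cells D" "d \<in> f" by (rule f)+
    show "subcomplex ?E D" using subcomplex_removed[of "verts D" X] cellsE by auto
  qed (use x(1) d(3) cellsE rest in simp_all)
  moreover have "card rest < card (darts D)"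
    using psubset_card_mono[OF fin(2), of rest] rest_sub d(1) notin by blast
  moreover have "perimeter ?E + (\<Sum>g\<in>cells ?E. card g) \<le> perimeter D + (\<Sum>g\<in>cells D. card g)"
  proof -
    have "card X \<le> length (fs @ os)" unfolding X_def by (rule card_length)
    moreover have "card (outer D) = length (x # os)" "card f = length (d # fs)"
      using distinct_card[OF dist(2)] distinct_card[OF dist(1)] co(2) cf(2) by metis+
    moreover have "(\<Sum>g\<in>cells D. card g) = card f + (\<Sum>g\<in>cells D - {f}. card g)"
      by (rule sum.remove[OF finite_cells f(1)])
    ultimately show ?thesis unfolding perimeter_def cellsE by simp
  qed
  ultimately show ?thesis using dE by (intro exI[of _ ?E]) simp
qed

text \<open>Without cells the diagram is a tree, and its degrees sum to 2V - 2. If every vertex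
  other than \<open>v\<close> had degree at least two, the sum would be at least 2V - 1. Excluding
  \<open>v\<close> is what keeps the base vertex alive in a shelling.\<close>

lemma leaf_exists:
  assumes "cells D = {}" "darts D \<noteq> {}"
  shows "\<exists>d\<in>darts D. org D d \<noteq> v \<and> (\<forall>e\<in>darts D. org D e = org D d \<longrightarrow> e = d)"
proof (rule ccontr)
  assume no: "\<not> ?thesis"
  let ?n = "\<lambda>u. card {e \<in> darts D. org D e = u}"
  have fin': "finite {e \<in> darts D. org D e = u}" for u using fin by simp
  have two: "2 \<le> ?n u" if u: "u \<in> verts D - {v}" for u
  proof -
    obtain d where d: "d \<in> darts D" "u = org D d" using u verts_eq[OF assms(2)] by blast
    then obtain e where e: "e \<in> darts D" "org D e = org D d" "e \<noteq> d" using no u by blast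
    have "card {d, e} \<le> ?n u" by (rule card_mono[OF fin']) (use d e in auto)
    then show ?thesis using e(3) by simp
  qed
  have one: "1 \<le> ?n u" if u: "u \<in> verts D" for u
  proof -
    obtain d where d: "d \<in> darts D" "u = org D d" using u verts_eq[OF assms(2)] by blast
    have "card {d} \<le> ?n u" by (rule card_mono[OF fin']) (use d in auto)
    then show ?thesis by simp
  qed
  have "card (darts D) = (\<Sum>u\<in>verts D. ?n u)"
    unfolding card_eq_sum
    by (rule sum.group[OF fin(2,1), symmetric]) (use org_in in blast)
  moreover have "2 * card (verts D) \<le> (\<Sum>u\<in>verts D. ?n u) + 1"
  proof (cases "v \<in> verts D")
    case True
    have "(\<Sum>u\<in>verts D. ?n u) = ?n v + (\<Sum>u\<in>verts D - {v}. ?n u)" by (rule sum.remove[OF fin(1) True])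
    moreover have "(\<Sum>u\<in>verts D - {v}. 2) \<le> (\<Sum>u\<in>verts D - {v}. ?n u)" by (rule sum_mono) (rule two)
    ultimately show ?thesis using one[OF True] card_Suc_Diff1[OF fin(1) True] by simp
  next
    case False
    then have "(\<Sum>u\<in>verts D. 2) \<le> (\<Sum>u\<in>verts D. ?n u)" by (intro sum_mono two) auto
    then show ?thesis by simp
  qed
  ultimately show False using card_darts euler_nat assms(1) by simp
qed

lemma collapse1_exists:
  assumes "cells D = {}" "darts D \<noteq> {}" "v \<in> verts D"
  shows "\<exists>D'. diagram D' \<and> collapse1 D D' \<and> v \<in> verts D' \<and> cells D' = {} \<and>
    card (darts D') < card (darts D) \<and> perimeter D' \<le> perimeter D"
proof -
  obtain d where d: "d \<in> darts D" "org D d \<noteq> v" "\<And>e. e \<in> darts D \<Longrightarrow> org D e = org D d \<Longrightarrow> e = d"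
    using leaf_exists[OF assms(1,2)] by blast
  define x where "x = opp D d"
  have x: "x \<in> darts D" "opp D x = d" "x \<noteq> d" using opp[OF d(1)] by (auto simp: x_def)
  interpret edge_removal D d by unfold_locales (rule d(1))
  have out: "outer D = darts D" using outer_eq assms(1) by simp
  have rot_d: "rot D d = d" using d(3)[of "rot D d"] rot.closed[OF d(1)] org_rot[OF d(1)] by simp
  have nx: "nxt D x = d" using rot_d by (simp add: rot_def x_def)
  have rx: "rot D x = nxt D d" using x(2) by (simp add: rot_def)
  obtain zs where zs: "cycle_from (nxt D) x = x # zs"
    using nxt.cycle_from(1,2)[OF x(1)] by (cases "cycle_from (nxt D) x") (auto simp: is_cycle_def)
  have c: "is_cycle (nxt D) (x # zs)" "set (x # zs) = darts D"
    using nxt.cycle_from[OF x(1)] zs orbit_outer[of x] x(1) out by auto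
  \<comment> \<open>The circuit runs along \<open>x\<close> into the leaf and straight back along
    \<open>d\<close>.\<close>
  obtain os where "zs = d # os"
    using c nx x(3) d(1) by (cases zs) (auto simp: is_cycle_def)
  then have co: "is_cycle (nxt D) (x # d # os)" "set (x # d # os) = darts D" using c by auto
  have dist: "distinct (x # d # os)" using co(1) by (simp add: is_cycle_def)
  have rest: "rest = darts D - {d, x}" by (simp add: rest_def x_def)
  have set_os: "set os = rest" using co(2) dist by (auto simp: rest)
  define V where "V = verts D - {org D d}"
  let ?E = "removed V (set os)"
  have cE: "is_cycle (nxt ?E) os" if ne: "os \<noteq> []"
  proof -
    have s: "nxt D d = hd os" "successively (\<lambda>a b. nxt D a = b) os" "nxt D (last os) = x"
      using co(1) ne by (auto simp: is_cycle_def successively_Cons)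
    have r: "first_return rest (rot D) x = hd os"
      using first_return_1[of x rest "rot D"] rx s(1) hd_in_set[OF ne] set_os by (simp add: rest)
    have "successively (\<lambda>a b. nxt ?E a = b) ys"
      if "successively (\<lambda>a b. nxt D a = b) ys" "set ys \<subseteq> rest" for ys
      using that
    proof (induction ys)
      case (Cons a ys)
      then show ?case using nxt_removed[of a] by (cases ys) auto
    qed simp
    then have "successively (\<lambda>a b. nxt ?E a = b) os" using s(2) set_os by blast
    moreover have "nxt ?E (last os) = hd os" using r s(3) last_in_set[OF ne] set_os by simp
    ultimately show ?thesis using ne dist by (simp add: is_cycle_def)
  qed
  have facesE: "faces ?E = (if rest = {} then {} else {set os})"
  proof (cases "rest = {}")
    case False
    then have ne: "os \<noteq> []" using set_os by auto
    have "orbit (nxt ?E) ` set os = (\<lambda>_. set os) ` set os"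
      using orbit_cycle[OF cE[OF ne]] by (rule image_cong[OF HOL.refl])
    then show ?thesis using False set_os by (simp add: faces_def image_constant_conv)
  qed (simp add: faces_def)
  then have cellsE: "cells ?E = {}" by (auto simp: cells_def split: if_splits)
  have xd: "org D x \<noteq> org D d" using d(3)[OF x(1)] x(3) by auto
  have stepE: "(org D e, org D (opp D e)) \<in> vertex_steps ?E" if "e \<in> rest" for e
    using vertex_stepI[of e ?E] that by simp
  have conn: "connected_complex ?E"
    unfolding connected_complex_steps removed_simps(1)
  proof (intro conjI ballI)
    show "V \<noteq> {}" using assms(3) d(2) by (auto simp: V_def)
    \<comment> \<open>Retracting the leaf onto its neighbour turns paths of \<open>D\<close> into
      paths that avoid the edge.\<close>
    let ?h = "\<lambda>u. if u = org D d then org D x else u"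
    fix u w assume uw: "u \<in> V" "w \<in> V"
    then have "(u, w) \<in> (vertex_steps D)\<^sup>*" using connected by (simp add: connected_complex_steps V_def)
    then have "(?h u, ?h w) \<in> (vertex_steps ?E)\<^sup>*"
    proof (rule rtrancl_map)
      fix a b assume "(a, b) \<in> vertex_steps D"
      then obtain e where e: "e \<in> darts D" "a = org D e" "b = org D (opp D e)" by (auto simp: vertex_steps_def)
      consider "e = d" | "e = x" | "e \<in> rest" using e(1) by (auto simp: rest)
      then show "(?h a, ?h b) \<in> (vertex_steps ?E)\<^sup>*"
      proof cases
        case 3
        then have "org D e \<noteq> org D d" "org D (opp D e) \<noteq> org D d"
          using d(3)[of e] d(3)[of "opp D e"] opp_rest[OF 3] rest_sub by (auto simp: rest)
        then show ?thesis using e stepE[OF 3] by auto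
      qed (use e x xd in \<open>auto simp: x_def\<close>)
    qed
    then show "(u, w) \<in> (vertex_steps ?E)\<^sup>*" using uw by (simp add: V_def)
  qed
  have dE: "diagram ?E"
  proof (rule diagram_removed)
    show "org D ` rest \<subseteq> V"
    proof
      fix u assume "u \<in> org D ` rest"
      then obtain e where "e \<in> rest" "u = org D e" by blast
      then show "u \<in> V" using d(3)[of e] org_in[of e] rest_sub by (auto simp: V_def rest)
    qed
    show "card V + card (cells ?E) = card (edges D)"
      using euler_nat assms(1) card_Suc_Diff1[OF fin(1) org_in[OF d(1)]] cellsE by (simp add: V_def)
    show "if rest = {} then set os = {} else set os \<in> faces ?E" using facesE set_os by simp
  qed (use conn in \<open>auto simp: V_def\<close>)
  have "collapse1 D ?E"
    unfolding collapse1_def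
  proof (intro bexI conjI)
    show "d \<in> outer D" using out d(1) by simp
    show "subcomplex ?E D" using subcomplex_removed[of V "set os"] cellsE by (auto simp: V_def)
    show "org D (opp D d) \<noteq> org D d" using xd by (simp add: x_def)
    show "\<forall>e\<in>darts D. org D e = org D d \<longrightarrow> e = d" using d(3) by blast
    show "verts ?E = verts D - {org D d}" by (simp add: V_def)
    show "darts ?E = darts D - {d, opp D d}" by (simp add: rest_def)
    show "cells ?E = cells D" using cellsE assms(1) by simp
  qed
  moreover have "card rest < card (darts D)"
    using psubset_card_mono[OF fin(2), of rest] rest_sub d(1) by (auto simp: rest)
  moreover have "card (set os) \<le> card (outer D)" using set_os rest_sub out fin(2) by (simp add: card_mono)
  ultimately show ?thesis using dE cellsE assms(3) d(2)
    by (intro exI[of _ ?E]) (simp add: perimeter_def V_def)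
qed

end

text \<open>The perimeter plus the lengths of all cells bounds the perimeter and does not grow under
  the chosen collapses. No collapse removes \<open>v\<close>: those of 2-cells keep all vertices,
  and the leaves are chosen different from \<open>v\<close>.\<close>

lemma full_shelling_exists:
  assumes "diagram D" "v \<in> verts D"
  shows "\<exists>Ds. full_shelling_to D v Ds \<and>
    (\<forall>E\<in>set Ds. perimeter E \<le> perimeter D + (\<Sum>f\<in>cells D. card f))"
  using assms
proof (induction "card (darts D)" arbitrary: D rule: less_induct)
  case less
  interpret diag D by unfold_locales (rule less.prems(1))
  show ?case
  proof (cases "darts D = {}")
    case True
    then have "card (verts D) = 1" using euler_nat by (simp add: cells_def faces_def edges_def)
    then have "single_vertex D" using True by (auto simp: single_vertex_def card_1_singleton_iff)
    then show ?thesis using less.prems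
      by (intro exI[of _ "[D]"]) (simp add: full_shelling_to_def full_shelling_def)
  next
    case False
    have "\<exists>D'. diagram D' \<and> shelling_move D D' \<and> v \<in> verts D' \<and> card (darts D') < card (darts D) \<and>
      perimeter D' + (\<Sum>f\<in>cells D'. card f) \<le> perimeter D + (\<Sum>f\<in>cells D. card f)"
    proof (cases "cells D = {}")
      case True
      from collapse1_exists[OF True False less.prems(2)] show ?thesis
        using True by (auto simp: shelling_move_def)
    next
      case False
      from collapse2_exists[OF this] show ?thesis
        using less.prems(2) by (auto simp: shelling_move_def)
    qed
    then obtain D' where D': "diagram D'" "shelling_move D D'" "v \<in> verts D'" "card (darts D') < card (darts D)"
      "perimeter D' + (\<Sum>f\<in>cells D'. card f) \<le> perimeter D + (\<Sum>f\<in>cells D. card f)" by blast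
    from less.hyps[OF D'(4,1,3)] obtain Ds where Ds: "full_shelling_to D' v Ds"
      "\<forall>E\<in>set Ds. perimeter E \<le> perimeter D' + (\<Sum>f\<in>cells D'. card f)" by blast
    then have "full_shelling_to D v (D # Ds)"
      using less.prems D'(2) by (auto simp: full_shelling_to_def full_shelling_def successively_Cons)
    moreover have "\<forall>E\<in>set (D # Ds). perimeter E \<le> perimeter D + (\<Sum>f\<in>cells D. card f)"
      using Ds(2) D'(5) by (auto intro: order_trans)
    ultimately show ?thesis by blast
  qed
qed

section \<open>Filling functions\<close>

lemma Inf_nat_le: "k \<in> S \<Longrightarrow> Inf S \<le> (k :: nat)"
  by (simp add: cInf_lower)

lemma diagram_FL_attained:
  assumes "diagram D" "v \<in> verts D"
  obtains Ds where "full_shelling_to D v Ds" "diagram_FL D v = shelling_length Ds"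
proof -
  have "{shelling_length Ds | Ds. full_shelling_to D v Ds} \<noteq> {}" using full_shelling_exists[OF assms] by blast
  from Inf_nat_def1[OF this] show ?thesis using that unfolding diagram_FL_def by blast
qed

lemma diagram_FFL_le_FL:
  assumes "diagram D" "v \<in> verts D" shows "diagram_FFL D \<le> diagram_FL D v"
proof -
  obtain Ds where "full_shelling_to D v Ds" "diagram_FL D v = shelling_length Ds"
    using diagram_FL_attained[OF assms] .
  then show ?thesis unfolding diagram_FFL_def by (intro Inf_nat_le) (auto simp: full_shelling_to_def)
qed

lemma fragmenting_shelling_singletons:
  assumes "full_shelling D Ds"
  shows "full_fragmenting_shelling D (map (\<lambda>E. {#E#}) Ds)"
    "fragmenting_length (map (\<lambda>E. {#E#}) Ds) = shelling_length Ds"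
proof -
  have "fragmenting_move {#E#} {#E'#}" if "shelling_move E E'" for E E'
    using that unfolding fragmenting_move_def by (intro disjI1 exI[of _ "{#}"]) auto
  then have "successively fragmenting_move (map (\<lambda>E. {#E#}) Ds)"
    using assms unfolding full_shelling_def successively_map
    by (auto intro: successively_mono)
  then show "full_fragmenting_shelling D (map (\<lambda>E. {#E#}) Ds)"
    using assms by (auto simp: full_shelling_def full_fragmenting_shelling_def hd_map last_map)
  show "fragmenting_length (map (\<lambda>E. {#E#}) Ds) = shelling_length Ds"
    by (simp add: fragmenting_length_def shelling_length_def image_image)
qed

lemma diagram_FFFL_le_FFL:
  assumes "diagram D" shows "diagram_FFFL D \<le> diagram_FFL D"
proof -
  obtain v where "v \<in> verts D" using assms by (auto simp: diagram_def connected_complex_def)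
  from full_shelling_exists[OF assms this]
  have "{shelling_length Ds | Ds. full_shelling D Ds} \<noteq> {}" by (auto simp: full_shelling_to_def)
  from Inf_nat_def1[OF this] obtain Ds where "full_shelling D Ds" "diagram_FFL D = shelling_length Ds"
    unfolding diagram_FFL_def by blast
  with fragmenting_shelling_singletons[of D Ds] show ?thesis
    unfolding diagram_FFFL_def by (metis (mono_tags, lifting) Inf_nat_le mem_Collect_eq)
qed

lemma diagram_FFFL_attained:
  assumes "diagram D"
  obtains Ms where "full_fragmenting_shelling D Ms" "diagram_FFFL D = fragmenting_length Ms"
proof -
  obtain v where "v \<in> verts D" using assms by (auto simp: diagram_def connected_complex_def)
  from full_shelling_exists[OF assms this] obtain Ds where "full_shelling D Ds"
    by (auto simp: full_shelling_to_def)
  from fragmenting_shelling_singletons(1)[OF this]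
  have "{fragmenting_length Ms | Ms. full_fragmenting_shelling D Ms} \<noteq> {}" by blast
  from Inf_nat_def1[OF this] show ?thesis using that unfolding diagram_FFFL_def by blast
qed

lemma diagram_FL_le:
  assumes "diagram D" "v \<in> verts D"
  shows "diagram_FL D v \<le> perimeter D + (\<Sum>f\<in>cells D. card f)"
proof -
  from full_shelling_exists[OF assms] obtain Ds where Ds: "full_shelling_to D v Ds"
    "\<forall>E\<in>set Ds. perimeter E \<le> perimeter D + (\<Sum>f\<in>cells D. card f)" by metis
  have "diagram_FL D v \<le> shelling_length Ds" unfolding diagram_FL_def using Ds(1) by (intro Inf_nat_le) blast
  also have "\<dots> \<le> perimeter D + (\<Sum>f\<in>cells D. card f)"
    unfolding shelling_length_def using Ds by (subst Max_le_iff) (auto simp: full_shelling_to_def full_shelling_def)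
  finally show ?thesis .
qed

lemma van_kampen_FL_le:
  assumes "van_kampen A R w D v lab" "\<And>r. r \<in> R \<Longrightarrow> length r \<le> \<rho>"
  shows "diagram_FL D v \<le> \<rho> * card (cells D) + length w"
proof -
  have D: "diagram D" "v \<in> verts D" using assms(1) by (auto simp: van_kampen_def)
  interpret diag D by unfold_locales (rule D)
  have len: "length (circuit_word D lab d) = card (orbit (nxt D) d)" for d by (simp add: circuit_word_def)
  have "perimeter D = length w"
  proof (cases "outer D = {}")
    case True
    then show ?thesis using assms(1) by (simp add: van_kampen_def perimeter_def)
  next
    case False
    then obtain d where "d \<in> outer D" "circuit_word D lab d = w"
      using assms(1) by (auto simp: van_kampen_def)
    then show ?thesis using len[of d] orbit_outer[of d] by (simp add: perimeter_def)
  qed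
  moreover have "card f \<le> \<rho>" if f: "f \<in> cells D" for f
  proof -
    have "\<exists>d\<in>f. circuit_word D lab d \<in> R \<union> inv_word ` R"
      using assms(1) f unfolding van_kampen_def by blast
    then obtain d where d: "d \<in> f" "circuit_word D lab d \<in> R \<union> inv_word ` R" by (rule bexE)
    have "length (circuit_word D lab d) \<le> \<rho>" using d(2) assms(2) by (auto simp: inv_word_def)
    then show ?thesis using len[of d] orbit_cell[OF f d(1)] by simp
  qed
  then have "(\<Sum>f\<in>cells D. card f) \<le> card (cells D) * \<rho>" using sum_bounded_above[of "cells D" card \<rho>] by simp
  ultimately show ?thesis using diagram_FL_le[OF D] by (simp add: mult.commute)
qed

text \<open>Without a van Kampen diagram for \<open>w\<close> all four quantities are the unspecified natural number
  \<open>Inf {}\<close>.\<close>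

lemma word_no_van_kampen:
  assumes "\<And>D v lab. \<not> van_kampen A R w D v lab"
  shows "word_Area A R w = Inf {}" "word_FL A R w = Inf {}" "word_FFL A R w = Inf {}" "word_FFFL A R w = Inf {}"
  using assms by (simp_all add: word_Area_def word_FL_def word_FFL_def word_FFFL_def)

lemma word_FFL_le_FL: "word_FFL A R w \<le> word_FL A R w"
proof (cases "\<exists>D v lab. van_kampen A R w D v lab")
  case True
  then have "{diagram_FL D v | D v lab. van_kampen A R w D v lab} \<noteq> {}" by blast
  from Inf_nat_def1[OF this] obtain D v lab where
    D: "van_kampen A R w D v lab" "word_FL A R w = diagram_FL D v" unfolding word_FL_def by blast
  have "word_FFL A R w \<le> diagram_FFL D" unfolding word_FFL_def using D(1) by (intro Inf_nat_le) blast
  also have "\<dots> \<le> diagram_FL D v" using D(1) by (intro diagram_FFL_le_FL) (auto simp: van_kampen_def)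
  finally show ?thesis using D(2) by simp
qed (simp add: word_no_van_kampen)

lemma word_FFFL_le_FFL: "word_FFFL A R w \<le> word_FFL A R w"
proof (cases "\<exists>D v lab. van_kampen A R w D v lab")
  case True
  then have "{diagram_FFL D | D v lab. van_kampen A R w D v lab} \<noteq> {}" by blast
  from Inf_nat_def1[OF this] obtain D v lab where
    D: "van_kampen A R w D v lab" "word_FFL A R w = diagram_FFL D" unfolding word_FFL_def by blast
  have "word_FFFL A R w \<le> diagram_FFFL D" unfolding word_FFFL_def using D(1) by (intro Inf_nat_le) blast
  also have "\<dots> \<le> diagram_FFL D" using D(1) by (intro diagram_FFFL_le_FFL) (auto simp: van_kampen_def)
  finally show ?thesis using D(2) by simp
qed (simp add: word_no_van_kampen)

lemma word_FL_le_Area: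
  assumes "\<And>r. r \<in> R \<Longrightarrow> length r \<le> \<rho>" "1 \<le> \<rho>"
  shows "word_FL A R w \<le> \<rho> * word_Area A R w + length w"
proof (cases "\<exists>D v lab. van_kampen A R w D v lab")
  case True
  then have "{card (cells D) | D v lab. van_kampen A R w D v lab} \<noteq> {}" by blast
  from Inf_nat_def1[OF this] obtain D v lab where
    D: "van_kampen A R w D v lab" "word_Area A R w = card (cells D)" unfolding word_Area_def by blast
  have "word_FL A R w \<le> diagram_FL D v" unfolding word_FL_def using D(1) by (intro Inf_nat_le) blast
  then show ?thesis using van_kampen_FL_le[OF D(1) assms(1)] D(2) by simp
next
  case False
  have "word_FL A R w = word_Area A R w" using False by (simp add: word_no_van_kampen)
  also have "\<dots> \<le> \<rho> * word_Area A R w" using assms(2) by simp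
  finally show ?thesis by simp
qed

text \<open>The diagram with few cells need not be the one that is shelled: it is built afresh from
  a filling of the boundary word.\<close>

lemma word_Area_le_power_FFFL:
  assumes "finite A" "R \<subseteq> words A" "4 * card A + 1 \<le> c" "2 \<le> c"
  shows "word_Area A R w \<le> c ^ word_FFFL A R w"
proof (cases "\<exists>D v lab. van_kampen A R w D v lab")
  case True
  then have "{diagram_FFFL D | D v lab. van_kampen A R w D v lab} \<noteq> {}" by blast
  from Inf_nat_def1[OF this] obtain D v lab where
    D: "van_kampen A R w D v lab" "word_FFFL A R w = diagram_FFFL D" unfolding word_FFFL_def by blast
  then obtain Ms where Ms: "full_fragmenting_shelling D Ms" "diagram_FFFL D = fragmenting_length Ms"
    using diagram_FFFL_attained by (metis van_kampen_def)
  from fillable_of_shelling[OF assms(1,2) D(1) Ms(1)] obtain n where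
    n: "fillable A (cyclic_relators R) n w" "Suc n \<le> (4 * card A + 1) ^ fragmenting_length Ms" by blast
  from van_kampen_of_fillable[OF assms(2) n(1)] obtain D' v' lab' where
    D': "van_kampen A R w D' v' lab'" "card (cells D') \<le> n" by blast
  have "word_Area A R w \<le> card (cells D')" unfolding word_Area_def using D'(1) by (intro Inf_nat_le) blast
  also have "\<dots> \<le> (4 * card A + 1) ^ fragmenting_length Ms" using D'(2) n(2) by simp
  also have "\<dots> \<le> c ^ fragmenting_length Ms" using assms(3) by (rule power_mono) simp
  finally show ?thesis using D(2) Ms(2) by simp
next
  case False
  have "word_Area A R w = word_FFFL A R w" using False by (simp add: word_no_van_kampen)
  \<comment> \<open>The common default value is not evaluated; it is compared with its own power by
    m < 2^m, which is why the base has to be at least 2.\<close>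
  also have "\<dots> \<le> 2 ^ word_FFFL A R w" by (rule less_imp_le[OF less_exp])
  also have "\<dots> \<le> c ^ word_FFFL A R w" using assms(4) by (rule power_mono) simp
  finally show ?thesis .
qed

text \<open>\<open>Max\<close> behaves well here: a finite alphabet has finitely many words of
  length at most \<open>n\<close>, and the empty word is always among the null-homotopic
  ones.\<close>

lemma filling_function_bounds:
  assumes "finite A"
  shows "null_homotopic A R w \<Longrightarrow> length w \<le> n \<Longrightarrow> M w \<le> filling_function A R M n"
    and "(\<And>w. null_homotopic A R w \<Longrightarrow> length w \<le> n \<Longrightarrow> M w \<le> k) \<Longrightarrow> filling_function A R M n \<le> k"
proof -
  let ?S = "{w. null_homotopic A R w \<and> length w \<le> n}"
  have "?S \<subseteq> {w. set w \<subseteq> A \<times> UNIV \<and> length w \<le> n}" by (auto simp: null_homotopic_def words_def)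
  then have fin: "finite ?S" using finite_lists_length_le[of "A \<times> (UNIV :: bool set)" n] assms
    by (simp add: finite_subset)
  have "[] \<in> ?S" by (simp add: null_homotopic_def words_def group_eq.refl)
  then have ne: "?S \<noteq> {}" by blast
  have eq: "{M w | w. null_homotopic A R w \<and> length w \<le> n} = M ` ?S" by blast
  show "null_homotopic A R w \<Longrightarrow> length w \<le> n \<Longrightarrow> M w \<le> filling_function A R M n"
    unfolding filling_function_def eq using fin by (intro Max_ge) auto
  show "(\<And>w. null_homotopic A R w \<Longrightarrow> length w \<le> n \<Longrightarrow> M w \<le> k) \<Longrightarrow> filling_function A R M n \<le> k"
    unfolding filling_function_def eq using fin ne by (subst Max_le_iff) auto
qed

theorem theorem3:
  fixes A :: "'a set" and R :: "'a word set"
  assumes "finite_presentation A R"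
  shows "\<exists>C::nat. \<forall>n::nat.
    Area A R n \<le> C ^ FFFL A R n \<and>
    FFFL A R n \<le> FFL A R n \<and> FFL A R n \<le> FL A R n \<and> FL A R n \<le> C * Area A R n + n"
proof -
  have fin: "finite A" "finite R" "R \<subseteq> words A" using assms by (auto simp: finite_presentation_def)
  \<comment> \<open>The count of costs asks for \<open>4 * card A + 1\<close>, the additional 1
    makes the base at least 2 even for empty \<open>A\<close>, and the sum dominates the length of
    every relator.\<close>
  define C where "C = 4 * card A + 2 + (\<Sum>r\<in>R. length r)"
  have C: "4 * card A + 1 \<le> C" "2 \<le> C" "1 \<le> C" by (simp_all add: C_def)
  have len: "length r \<le> C" if "r \<in> R" for r
    using member_le_sum[OF that, of length] fin(2) by (simp add: C_def)
  note ge = filling_function_bounds(1)[OF fin(1)] and le = filling_function_bounds(2)[OF fin(1)]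
  show ?thesis
  proof (intro exI[of _ C] allI conjI)
    fix n
    show "Area A R n \<le> C ^ FFFL A R n" unfolding Area_def
    proof (rule le)
      fix w assume w: "null_homotopic A R w" "length w \<le> n"
      have "word_Area A R w \<le> C ^ word_FFFL A R w" by (rule word_Area_le_power_FFFL[OF fin(1,3) C(1,2)])
      also have "\<dots> \<le> C ^ FFFL A R n" unfolding FFFL_def by (rule power_increasing[OF ge[OF w] C(3)])
      finally show "word_Area A R w \<le> C ^ FFFL A R n" .
    qed
    show "FFFL A R n \<le> FFL A R n" unfolding FFFL_def FFL_def
      by (rule le) (rule order_trans[OF word_FFFL_le_FFL ge])
    show "FFL A R n \<le> FL A R n" unfolding FFL_def FL_def
      by (rule le) (rule order_trans[OF word_FFL_le_FL ge])
    show "FL A R n \<le> C * Area A R n + n" unfolding FL_def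
    proof (rule le)
      fix w assume w: "null_homotopic A R w" "length w \<le> n"
      have "word_FL A R w \<le> C * word_Area A R w + length w" by (rule word_FL_le_Area[OF len C(3)])
      also have "\<dots> \<le> C * Area A R n + n" unfolding Area_def by (intro add_mono mult_left_mono ge w) simp
      finally show "word_FL A R w \<le> C * Area A R n + n" .
    qed
  qed
qed

end
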